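(* Let $n=2p+1$ with $p\ge1$. Let $\bar{\mathbf q}$ be the regular $n$-gon equilibrium configuration on $\mathbb{S}^1$ with masses $m_1=\dots=m_n=1$, i.e. $\varphi_j=\frac{2\pi j}{n}$, $\theta_j=\frac{\pi}{2}$ for $j=1,\dots,n$. For $\alpha\in\mathbb{R}$ let $Y_\alpha$ be the equilibrium of the reduced Hamiltonian system $(H_2,\,J_2^{-1}(n\alpha)/SO(2),\,\omega_2)$ corresponding to the relative equilibrium in which $\bar{\mathbf q}$ rotates along $\mathbb{S}^1$ with angular velocity $\alpha$; in the coordinates $(u_2,\dots,u_n,\theta_1,\dots,\theta_n,v_2,\dots,v_n,p_{\theta_1},\dots,p_{\theta_n})$, $$Y_\alpha=\Big(\tfrac2n\pi,\tfrac3n\pi,\dots,\tfrac nn\pi,\ \tfrac\pi2,\dots,\tfrac\pi2,\ 0,\dots,0,\ 0,\dots,0\Big).$$ Then the equilibrium $Y_\alpha$ of the reduced Hamiltonian system $(H_2,\,J_2^{-1}(n\alpha)/SO(2),\,\omega_2)$ is linearly unstable if $$\alpha^2<2\sum_{j=1}^p\frac{1-\cos\left(j\frac{2\pi}{n}\right)}{\sin^3\left(j\frac{2\pi}{n}\right)},$$ and is Lyapunov stable if $$\alpha^2>2\sum_{j=1}^p\frac{1-\cos\left(j\frac{2\pi}{n}\right)}{\sin^3\left(j\frac{2\pi}{n}\right)}.$$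
   Context: The $n$-body problem on the unit sphere $\mathbb{S}^2$ with masses $1$, in spherical coordinates $(x,y,z)=(\sin\theta\cos\varphi,\sin\theta\sin\varphi,\cos\theta)$; $\mathbb{S}^1$ is the equator $\theta=\pi/2$. The distance $d_{ij}\in(0,\pi)$ is given by $\cos d_{ij}=\cos\theta_i\cos\theta_j+\sin\theta_i\sin\theta_j\cos(\varphi_i-\varphi_j)$ (coincident and antipodal pairs are excluded), the potential is $U=\sum_{1\le i<j\le n}\cot d_{ij}$, and the Hamiltonian is $$H=\sum_{i=1}^n\Big(\frac{p_{\varphi_i}^2}{2\sin^2\theta_i}+\frac{p_{\theta_i}^2}{2}\Big)-U .$$ The group $SO(2)$ acts by $\varphi_i\mapsto\varphi_i+s$ (all $i$), with first integral $J_2=\sum_{i=1}^np_{\varphi_i}$. Reduction: use the Jacobi coordinates $$u_k=\varphi_k-\frac1{k-1}\sum_{i=1}^{k-1}\varphi_i\quad(k=2,\dots,n),\qquad g_n=\frac1n\sum_{i=1}^n\varphi_i ,$$ i.e. $(u_2,\dots,u_n,g_n)=\mathcal A(\varphi_1,\dots,\varphi_n)$ with $\mathcal A$ an invertible constant matrix, and conjugate momenta $\vec v=(v_2,\dots,v_n,G_n)$ defined by $(p_{\varphi_1},\dots,p_{\varphi_n})=\mathcal A^T\vec v$, so that $G_n=J_2$. The potential does not depend on $g_n$, so (locally) $U=U(u_2,\dots,u_n,\vec\theta)$ with $\vec\theta=(\theta_1,\dots,\theta_n)$. The reduced space $J_2^{-1}(c)/SO(2)$ has canonical (local) coordinates $(u_2,\dots,u_n,\vec\theta,v_2,\dots,v_n,p_{\theta_1},\dots,p_{\theta_n})$,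 with $\omega_2=d\big(\sum_{i=2}^nu_i\,dv_i+\sum_{i=1}^n\theta_i\,dp_{\theta_i}\big)$, and the reduced Hamiltonian is $$H_2=\tfrac12\vec v^{\,T}P\,\vec v+\sum_{i=1}^n\frac{p_{\theta_i}^2}{2}-U(u_2,\dots,u_n,\vec\theta),\qquad P=\mathcal A\,\mathrm{diag}\Big\{\frac1{\sin^2\theta_1},\dots,\frac1{\sin^2\theta_n}\Big\}\mathcal A^T,$$ where $\vec v=(v_2,\dots,v_n,G_n)$ with $G_n=c$ constant (here $c=n\alpha$). The equations of motion are Hamilton's canonical equations for the conjugate pairs $(u_i,v_i)$ and $(\theta_i,p_{\theta_i})$. An equilibrium is linearly unstable if the origin is an unstable equilibrium of the linearized system at it; Lyapunov stability is in the usual sense. *)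

theory Defs
  imports "HOL-Analysis.Analysis"
begin

text \<open>
  The number of coordinates varies with the number of bodies, so phase points are functions
  from an index type \<open>'c\<close> to the reals, of which only the values on a finite set \<open>I\<close> of
  coordinates matter. The distance is the Euclidean one on those coordinates.
\<close>

section \<open>Stability of equilibria of autonomous systems in coordinates\<close>

definition coord_dist :: "'c set \<Rightarrow> ('c \<Rightarrow> real) \<Rightarrow> ('c \<Rightarrow> real) \<Rightarrow> real" where
  "coord_dist I x y = L2_set (\<lambda>c. x c - y c) I"

definition partial :: "(('c \<Rightarrow> real) \<Rightarrow> real) \<Rightarrow> 'c \<Rightarrow> ('c \<Rightarrow> real) \<Rightarrow> real" where
  "partial F c x = deriv (\<lambda>s. F (x(c := s))) (x c)"

definition solution_on ::
    "'c set \<Rightarrow> ('c \<Rightarrow> real) set \<Rightarrow> (('c \<Rightarrow> real) \<Rightarrow> 'c \<Rightarrow> real) \<Rightarrow> real set \<Rightarrow> (real \<Rightarrow> 'c \<Rightarrow> real) \<Rightarrow> bool"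
  where
  "solution_on I D X T x \<longleftrightarrow>
     (\<forall>t\<in>T. x t \<in> D \<and> (\<forall>c\<in>I. ((\<lambda>s. x s c) has_real_derivative X (x t) c) (at t within T)))"

definition is_equilibrium ::
    "'c set \<Rightarrow> ('c \<Rightarrow> real) set \<Rightarrow> (('c \<Rightarrow> real) \<Rightarrow> 'c \<Rightarrow> real) \<Rightarrow> ('c \<Rightarrow> real) \<Rightarrow> bool" where
  "is_equilibrium I D X e \<longleftrightarrow> e \<in> D \<and> (\<forall>c\<in>I. X e c = 0)"

text \<open>
  Solutions starting close to the equilibrium exist for all future time, and every solution
  starting there stays close for as long as it is defined.
\<close>

definition lyapunov_stable ::
    "'c set \<Rightarrow> ('c \<Rightarrow> real) set \<Rightarrow> (('c \<Rightarrow> real) \<Rightarrow> 'c \<Rightarrow> real) \<Rightarrow> ('c \<Rightarrow> real) \<Rightarrow> bool" where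
  "lyapunov_stable I D X e \<longleftrightarrow>
     is_equilibrium I D X e \<and>
     (\<forall>\<epsilon>>0. \<exists>\<delta>>0. \<forall>a\<in>D. coord_dist I a e < \<delta> \<longrightarrow>
        (\<exists>x. solution_on I D X {0..} x \<and> (\<forall>c\<in>I. x 0 c = a c)) \<and>
        (\<forall>T x. solution_on I D X {0..T} x \<and> (\<forall>c\<in>I. x 0 c = a c) \<longrightarrow>
           (\<forall>t\<in>{0..T}. coord_dist I (x t) e < \<epsilon>)))"

definition unstable ::
    "'c set \<Rightarrow> ('c \<Rightarrow> real) set \<Rightarrow> (('c \<Rightarrow> real) \<Rightarrow> 'c \<Rightarrow> real) \<Rightarrow> ('c \<Rightarrow> real) \<Rightarrow> bool" where
  "unstable I D X e \<longleftrightarrow> is_equilibrium I D X e \<and> \<not> lyapunov_stable I D X e"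

definition linearization ::
    "'c set \<Rightarrow> (('c \<Rightarrow> real) \<Rightarrow> 'c \<Rightarrow> real) \<Rightarrow> ('c \<Rightarrow> real) \<Rightarrow> ('c \<Rightarrow> real) \<Rightarrow> 'c \<Rightarrow> real" where
  "linearization I X e y c = (\<Sum>d\<in>I. partial (\<lambda>x. X x c) d e * y d)"

definition linearly_unstable ::
    "'c set \<Rightarrow> ('c \<Rightarrow> real) set \<Rightarrow> (('c \<Rightarrow> real) \<Rightarrow> 'c \<Rightarrow> real) \<Rightarrow> ('c \<Rightarrow> real) \<Rightarrow> bool" where
  "linearly_unstable I D X e \<longleftrightarrow>
     is_equilibrium I D X e \<and> unstable I UNIV (linearization I X e) (\<lambda>_. 0)"


section \<open>The potential\<close>

definition sphere_distance ::
    "(nat \<Rightarrow> real) \<Rightarrow> (nat \<Rightarrow> real) \<Rightarrow> nat \<Rightarrow> nat \<Rightarrow> real" where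
  "sphere_distance \<phi> \<theta> i j =
     arccos (cos (\<theta> i) * cos (\<theta> j) + sin (\<theta> i) * sin (\<theta> j) * cos (\<phi> i - \<phi> j))"

definition potential :: "nat \<Rightarrow> (nat \<Rightarrow> real) \<Rightarrow> (nat \<Rightarrow> real) \<Rightarrow> real" where
  "potential n \<phi> \<theta> = (\<Sum>j=1..n. \<Sum>i=1..<j. cot (sphere_distance \<phi> \<theta> i j))"


section \<open>Jacobi coordinates\<close>

text \<open>
  The rows of the matrix are indexed by \<open>2, \<dots>, n + 1\<close>: row \<open>k \<le> n\<close> gives \<open>u\<^sub>k\<close> and row
  \<open>n + 1\<close> gives \<open>g\<^sub>n\<close>. Its columns are indexed by \<open>1, \<dots>, n\<close>.
\<close>

definition jacobi_matrix :: "nat \<Rightarrow> nat \<Rightarrow> nat \<Rightarrow> real" where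
  "jacobi_matrix n k i =
     (if k = n + 1 then 1 / real n
      else if i = k then 1
      else if i < k then - 1 / (real k - 1)
      else 0)"

text \<open>The inverse matrix applied to \<open>w = (u\<^sub>2, \<dots>, u\<^sub>n, g\<^sub>n)\<close>; see \<open>jacobi_angles_inverse\<close> below.\<close>

definition jacobi_angles :: "nat \<Rightarrow> (nat \<Rightarrow> real) \<Rightarrow> nat \<Rightarrow> real" where
  "jacobi_angles n w =
     (THE \<phi>. (\<forall>k\<in>{2..n+1}. (\<Sum>i=1..n. jacobi_matrix n k i * \<phi> i) = w k) \<and>
             (\<forall>i. i \<notin> {1..n} \<longrightarrow> \<phi> i = 0))"

definition reduced_kinetic_matrix :: "nat \<Rightarrow> (nat \<Rightarrow> real) \<Rightarrow> nat \<Rightarrow> nat \<Rightarrow> real" where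
  "reduced_kinetic_matrix n \<theta> k l =
     (\<Sum>i=1..n. jacobi_matrix n k i * (1 / (sin (\<theta> i))\<^sup>2) * jacobi_matrix n l i)"


section \<open>The reduced Hamiltonian system\<close>

text \<open>\<open>QU k\<close>, \<open>QTheta i\<close>, \<open>PV k\<close>, \<open>PTheta i\<close> stand for \<open>u\<^sub>k\<close>, \<open>\<theta>\<^sub>i\<close>, \<open>v\<^sub>k\<close> and the momentum of \<open>\<theta>\<^sub>i\<close>.\<close>

datatype coord = QU nat | QTheta nat | PV nat | PTheta nat

definition reduced_coords :: "nat \<Rightarrow> coord set" where
  "reduced_coords n = QU ` {2..n} \<union> QTheta ` {1..n} \<union> PV ` {2..n} \<union> PTheta ` {1..n}"

text \<open>The potential does not depend on \<open>g\<^sub>n\<close>, so the angles are computed with \<open>g\<^sub>n = 0\<close>.\<close>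

definition state_angles :: "nat \<Rightarrow> (coord \<Rightarrow> real) \<Rightarrow> nat \<Rightarrow> real" where
  "state_angles n x = jacobi_angles n (\<lambda>k. if k = n + 1 then 0 else x (QU k))"

definition reduced_phase_space :: "nat \<Rightarrow> (coord \<Rightarrow> real) set" where
  "reduced_phase_space n =
     {x. (\<forall>i\<in>{1..n}. 0 < x (QTheta i) \<and> x (QTheta i) < pi) \<and>
         (\<forall>i\<in>{1..n}. \<forall>j\<in>{1..n}. i < j \<longrightarrow>
            sphere_distance (state_angles n x) (\<lambda>i. x (QTheta i)) i j \<in> {0<..<pi})}"

definition reduced_hamiltonian :: "nat \<Rightarrow> real \<Rightarrow> (coord \<Rightarrow> real) \<Rightarrow> real" where
  "reduced_hamiltonian n c x =
     (let v = (\<lambda>k. if k = n + 1 then c else x (PV k));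
          \<theta> = (\<lambda>i. x (QTheta i))
      in 1/2 * (\<Sum>k=2..n+1. \<Sum>l=2..n+1. v k * reduced_kinetic_matrix n \<theta> k l * v l)
         + (\<Sum>i=1..n. (x (PTheta i))\<^sup>2 / 2)
         - potential n (state_angles n x) \<theta>)"

fun hamiltonian_field :: "((coord \<Rightarrow> real) \<Rightarrow> real) \<Rightarrow> (coord \<Rightarrow> real) \<Rightarrow> coord \<Rightarrow> real" where
  "hamiltonian_field H x (QU k) = partial H (PV k) x"
| "hamiltonian_field H x (QTheta i) = partial H (PTheta i) x"
| "hamiltonian_field H x (PV k) = - partial H (QU k) x"
| "hamiltonian_field H x (PTheta i) = - partial H (QTheta i) x"

text \<open>
  This is \<open>Y\<^sub>\<alpha>\<close>; its coordinates do not depend on \<open>\<alpha>\<close>, which enters through the level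
  \<open>c = n \<alpha>\<close> in the Hamiltonian. The lemmas \<open>ngon_jacobi\<close> and \<open>ngon_momenta\<close> relate it to the
  rotating regular polygon.
\<close>

fun ngon_equilibrium :: "nat \<Rightarrow> coord \<Rightarrow> real" where
  "ngon_equilibrium n (QU k) = real k / real n * pi"
| "ngon_equilibrium n (QTheta i) = pi / 2"
| "ngon_equilibrium n (PV k) = 0"
| "ngon_equilibrium n (PTheta i) = 0"


section \<open>Basic facts\<close>

lemma jacobi_matrix_mean:
  "(\<Sum>i=1..n. jacobi_matrix n (n + 1) i * \<phi> i) = (\<Sum>i=1..n. \<phi> i) / real n"
  by (simp add: jacobi_matrix_def sum_divide_distrib)

lemma jacobi_matrix_relative:
  assumes "k \<in> {2..n}"
  shows "(\<Sum>i=1..n. jacobi_matrix n k i * \<phi> i) = \<phi> k - (\<Sum>i=1..k-1. \<phi> i) / real (k - 1)"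
proof -
  have "{1..n} = insert k ({1..k-1} \<union> {k<..n})" using assms by auto
  then have "(\<Sum>i=1..n. jacobi_matrix n k i * \<phi> i)
      = (\<Sum>i\<in>insert k ({1..k-1} \<union> {k<..n}). jacobi_matrix n k i * \<phi> i)" by simp
  also have "\<dots> = jacobi_matrix n k k * \<phi> k
      + ((\<Sum>i=1..k-1. jacobi_matrix n k i * \<phi> i) + (\<Sum>i\<in>{k<..n}. jacobi_matrix n k i * \<phi> i))"
    using assms by (subst sum.insert) (auto intro!: sum.union_disjoint)
  also have "(\<Sum>i\<in>{k<..n}. jacobi_matrix n k i * \<phi> i) = 0"
    using assms by (intro sum.neutral) (auto simp: jacobi_matrix_def)
  also have "(\<Sum>i=1..k-1. jacobi_matrix n k i * \<phi> i)
      = (\<Sum>i=1..k-1. - (\<phi> i / real (k - 1)))"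
    using assms by (intro sum.cong) (auto simp: jacobi_matrix_def of_nat_diff)
  also have "\<dots> = - ((\<Sum>i=1..k-1. \<phi> i) / real (k - 1))"
    by (simp add: sum_negf sum_divide_distrib)
  finally show ?thesis using assms by (simp add: jacobi_matrix_def)
qed

lemma jacobi_matrix_kernel:
  assumes "n \<ge> 1" and ker: "\<forall>k\<in>{2..n+1}. (\<Sum>i=1..n. jacobi_matrix n k i * \<phi> i) = 0"
    and "i \<in> {1..n}"
  shows "\<phi> i = 0"
proof -
  have const: "m \<in> {1..n} \<Longrightarrow> \<phi> m = \<phi> 1" for m
  proof (induction m rule: less_induct)
    case (less m)
    show ?case
    proof (cases "m = 1")
      case False
      with less.prems have m: "m \<in> {2..n}" by auto
      have "(\<Sum>i=1..m-1. \<phi> i) = (\<Sum>i=1..m-1. \<phi> 1)"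
        using m by (intro sum.cong less.IH) auto
      moreover have "\<phi> m = (\<Sum>i=1..m-1. \<phi> i) / real (m - 1)"
        using ker jacobi_matrix_relative[OF m, of \<phi>] m by simp
      ultimately show ?thesis using m by simp
    qed simp
  qed
  have "(\<Sum>i=1..n. \<phi> i) = (\<Sum>i=1..n. \<phi> 1)" by (intro sum.cong const refl)
  moreover have "(\<Sum>i=1..n. \<phi> i) / real n = 0"
    using ker assms(1) jacobi_matrix_mean[of n \<phi>] by simp
  ultimately have "\<phi> 1 = 0" using assms(1) by simp
  then show ?thesis using const[OF assms(3)] by simp
qed

definition jacobi_angles_explicit :: "nat \<Rightarrow> (nat \<Rightarrow> real) \<Rightarrow> nat \<Rightarrow> real" where
  "jacobi_angles_explicit n w i =
     (if i \<notin> {1..n} then 0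
      else w (n + 1) - (\<Sum>k=max 2 i..n. w k / real k) + (if i = 1 then 0 else w i))"

lemma jacobi_angles_explicit_sum:
  assumes "1 \<le> m" "m \<le> n"
  shows "(\<Sum>i=1..m. jacobi_angles_explicit n w i)
           = real m * (w (n + 1) - (\<Sum>k=m+1..n. w k / real k))"
  using assms
proof (induction m rule: nat_induct_at_least)
  case base
  then show ?case by (simp add: jacobi_angles_explicit_def numeral_2_eq_2)
next
  case (Suc m)
  have "(\<Sum>k=Suc m..n. w k / real k) = w (Suc m) / real (Suc m) + (\<Sum>k=Suc (Suc m)..n. w k / real k)"
    using Suc.prems by (subst sum.atLeast_Suc_atMost) auto
  moreover have "jacobi_angles_explicit n w (Suc m)
      = w (n + 1) - (\<Sum>k=Suc m..n. w k / real k) + w (Suc m)"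
    using Suc.hyps Suc.prems by (simp add: jacobi_angles_explicit_def max_def)
  moreover have "(\<Sum>i=1..m. jacobi_angles_explicit n w i)
      = real m * (w (n + 1) - (\<Sum>k=Suc m..n. w k / real k))"
    using Suc.IH Suc.prems by simp
  ultimately show ?case
    by (simp add: field_simps)
qed

lemma jacobi_angles_explicit_inverse:
  assumes "n \<ge> 1" "k \<in> {2..n+1}"
  shows "(\<Sum>i=1..n. jacobi_matrix n k i * jacobi_angles_explicit n w i) = w k"
proof (cases "k = n + 1")
  case True
  then show ?thesis
    using assms jacobi_matrix_mean[of n "jacobi_angles_explicit n w"]
      jacobi_angles_explicit_sum[of n n w] by simp
next
  case False
  with assms have k: "k \<in> {2..n}" by auto
  have "(\<Sum>i=1..k-1. jacobi_angles_explicit n w i)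
      = real (k - 1) * (w (n + 1) - (\<Sum>l=k..n. w l / real l))"
  proof -
    have "1 \<le> k - 1" "k - 1 \<le> n" "k - 1 + 1 = k" using k by auto
    then show ?thesis using jacobi_angles_explicit_sum[of "k - 1" n w] by simp
  qed
  moreover have "jacobi_angles_explicit n w k = w (n + 1) - (\<Sum>l=k..n. w l / real l) + w k"
    using k by (auto simp: jacobi_angles_explicit_def max_def)
  ultimately show ?thesis
    using k by (simp only: jacobi_matrix_relative) simp
qed

lemma jacobi_angles_eq:
  assumes "n \<ge> 1"
  shows "jacobi_angles n w = jacobi_angles_explicit n w"
  unfolding jacobi_angles_def
proof (rule the_equality)
  show "(\<forall>k\<in>{2..n+1}. (\<Sum>i=1..n. jacobi_matrix n k i * jacobi_angles_explicit n w i) = w k) \<and>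
        (\<forall>i. i \<notin> {1..n} \<longrightarrow> jacobi_angles_explicit n w i = 0)"
    using jacobi_angles_explicit_inverse[OF assms] by (simp add: jacobi_angles_explicit_def)
next
  fix \<phi>
  assume \<phi>: "(\<forall>k\<in>{2..n+1}. (\<Sum>i=1..n. jacobi_matrix n k i * \<phi> i) = w k) \<and>
             (\<forall>i. i \<notin> {1..n} \<longrightarrow> \<phi> i = 0)"
  have "\<forall>k\<in>{2..n+1}. (\<Sum>i=1..n. jacobi_matrix n k i * (\<phi> i - jacobi_angles_explicit n w i)) = 0"
    using \<phi> jacobi_angles_explicit_inverse[OF assms]
    by (simp add: right_diff_distrib sum_subtractf)
  from jacobi_matrix_kernel[OF assms this]
  have "\<phi> i - jacobi_angles_explicit n w i = 0" if "i \<in> {1..n}" for i using that by simp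
  moreover have "\<phi> i = jacobi_angles_explicit n w i" if "i \<notin> {1..n}" for i
    using \<phi> that unfolding jacobi_angles_explicit_def by simp
  ultimately have "\<phi> i = jacobi_angles_explicit n w i" for i
    by (cases "i \<in> {1..n}") (simp_all only: right_minus_eq)
  then show "\<phi> = jacobi_angles_explicit n w" by (rule ext)
qed

lemma jacobi_angles_inverse:
  assumes "n \<ge> 1" "k \<in> {2..n+1}"
  shows "(\<Sum>i=1..n. jacobi_matrix n k i * jacobi_angles n w i) = w k"
  using jacobi_angles_explicit_inverse[OF assms] assms by (simp add: jacobi_angles_eq)

text \<open>The value of \<open>g\<^sub>n\<close> is immaterial for the potential.\<close>

lemma potential_jacobi_angles_indep:
  assumes "n \<ge> 1" and "\<And>k. k \<in> {2..n} \<Longrightarrow> w k = w' k"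
  shows "potential n (jacobi_angles n w) \<theta> = potential n (jacobi_angles n w') \<theta>"
proof -
  have eq: "jacobi_angles n w i = jacobi_angles n w' i + (w (n + 1) - w' (n + 1))"
    if "i \<in> {1..n}" for i
  proof -
    have "(\<Sum>k=max 2 i..n. w k / real k) = (\<Sum>k=max 2 i..n. w' k / real k)"
      using assms(2) by (intro sum.cong) auto
    moreover have "i \<noteq> 1 \<Longrightarrow> w i = w' i" using that assms(2) by auto
    ultimately show ?thesis
      using assms(1) that by (auto simp: jacobi_angles_eq jacobi_angles_explicit_def)
  qed
  show ?thesis
    unfolding potential_def sphere_distance_def
    by (intro sum.cong refl) (simp add: eq)
qed

lemma ngon_jacobi:
  assumes "k \<in> {2..n}"
  shows "(\<Sum>i=1..n. jacobi_matrix n k i * (2 * pi * real i / real n)) = ngon_equilibrium n (QU k)"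
proof -
  have "(\<Sum>i=1..m. 2 * pi * real i / real n) = pi * real m * real (Suc m) / real n" for m
    using assms by (induction m) (simp_all add: field_simps)
  from this[of "k - 1"]
  have "(\<Sum>i=1..k-1. 2 * pi * real i / real n) / real (k - 1) = pi * real k / real n"
    using assms by simp
  then show ?thesis using assms by (simp only: jacobi_matrix_relative) simp
qed

lemma ngon_momenta:
  assumes "i \<in> {1..n}"
  shows "(\<Sum>k=2..n+1. jacobi_matrix n k i *
            (if k = n + 1 then real n * \<alpha> else ngon_equilibrium n (PV k))) = \<alpha>"
proof -
  have "(\<Sum>k=2..n+1. jacobi_matrix n k i *
            (if k = n + 1 then real n * \<alpha> else ngon_equilibrium n (PV k)))
      = (\<Sum>k=2..n+1. if k = n + 1 then \<alpha> else 0)"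
    using assms by (intro sum.cong) (auto simp: jacobi_matrix_def)
  then show ?thesis using assms by simp
qed

end

theory Submission
  imports Defs
begin

text \<open>
  The reduced Hamiltonian is a sum over the bodies of kinetic terms minus a sum over the pairs of
  cotangents of distances. Its quadratic part at the regular polygon splits into an equatorial
  part in the relative longitudes, a transverse part in the colatitudes, and squares of the
  momenta.

  The equatorial part is positive definite for every odd \<open>n\<close> and does not involve \<open>\<alpha>\<close>. This is
  not evident, because pairs at a distance below \<open>\<pi> / 2\<close> contribute negative terms, and only the
  pairs further apart contribute positive ones. The comparison rests on the doubling of shifts: two bodies \<open>2 k\<close> places
  apart are joined by two steps of \<open>k\<close> places, which bounds the sum of squared differences at
  shift \<open>2 k\<close> by four times the one at shift \<open>k\<close>, and the identity
  \<open>cos 2x = cos\<^sup>4 x - sin\<^sup>4 x\<close> shows that the weight at angle \<open>2x\<close>, multiplied by four, is less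
  than half of the absolute weight at \<open>x\<close>. Doubling permutes the residues modulo an odd number, so
  after summation the negative terms account for less than the positive ones
  (\<open>polygon_hessian_negative\<close>).

  In the transverse part, moving two bodies by \<open>a\<close> and \<open>b\<close> off the equator changes the
  cosine of their distance by \<open>cos (a - b) - 1 + (1 - cos a cos b) (1 - cos \<psi>)\<close>, which is at most
  \<open>(a\<^sup>2 + b\<^sup>2) / 2 \<cdot> (1 - cos \<psi>)\<close> (\<open>off_equator_bound\<close>). The bound is attained to second order
  exactly for \<open>a = b\<close>, so the lowest transverse mode is the one in which all bodies leave the
  equator together. Against the centrifugal term \<open>\<alpha>\<^sup>2 / (2 sin\<^sup>2 \<theta>)\<close> its coefficient is
  \<open>\<alpha>\<^sup>2 - S\<close>, where \<open>S\<close> is the threshold of the theorem.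

  If \<open>\<alpha>\<^sup>2 > S\<close>, the polygon is therefore a strict local minimum of the energy
  (\<open>ngon_strict_minimum\<close>), and stability follows from the theorem of Lagrange and Dirichlet
  (\<open>lyapunov_stable_strict_minimum\<close>). The latter includes the existence of solutions for all
  future time, obtained by Picard iteration for a globally Lipschitz field that agrees with the
  given one near the equilibrium. If \<open>\<alpha>\<^sup>2 < S\<close>, the linearized equations have the solution in
  which the mode of common displacement grows like \<open>exp (t sqrt (S - \<alpha>\<^sup>2))\<close>
  (\<open>ngon_linearly_unstable\<close>).
\<close>

section \<open>Global solutions of Lipschitz systems in coordinates\<close>

primrec picard ::
    "(('c \<Rightarrow> real) \<Rightarrow> 'c \<Rightarrow> real) \<Rightarrow> ('c \<Rightarrow> real) \<Rightarrow> nat \<Rightarrow> real \<Rightarrow> 'c \<Rightarrow> real" where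
  "picard Y a 0 = (\<lambda>t c. a c)"
| "picard Y a (Suc k) = (\<lambda>t c. a c + integral {0..t} (\<lambda>s. Y (picard Y a k s) c))"

declare picard.simps [simp del]

lemma coord_dist_nonneg [simp]: "0 \<le> coord_dist I x y"
  by (simp add: coord_dist_def)

lemma coord_dist_self [simp]: "coord_dist I x x = 0"
  by (simp add: coord_dist_def L2_set_def)

lemma coord_dist_le_sum: "coord_dist I x y \<le> (\<Sum>c\<in>I. \<bar>x c - y c\<bar>)"
  unfolding coord_dist_def by (rule L2_set_le_sum_abs)

lemma coord_le_coord_dist: "finite I \<Longrightarrow> c \<in> I \<Longrightarrow> \<bar>x c - y c\<bar> \<le> coord_dist I x y"
  using member_le_L2_set[of I c "\<lambda>c. \<bar>x c - y c\<bar>"] by (simp add: coord_dist_def L2_set_def)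

lemma coord_dist_square: "(coord_dist I x y)\<^sup>2 = (\<Sum>c\<in>I. (x c - y c)\<^sup>2)"
  by (simp add: coord_dist_def L2_set_def sum_nonneg)

lemma coord_dist_cong:
  "(\<And>c. c \<in> I \<Longrightarrow> x c = x' c) \<Longrightarrow> (\<And>c. c \<in> I \<Longrightarrow> y c = y' c) \<Longrightarrow>
     coord_dist I x y = coord_dist I x' y'"
  by (simp add: coord_dist_def cong: L2_set_cong_simp)

lemma continuous_on_coord_dist [continuous_intros]:
  assumes "\<And>c. c \<in> I \<Longrightarrow> continuous_on A (\<lambda>s. z s c)" "\<And>c. c \<in> I \<Longrightarrow> continuous_on A (\<lambda>s. w s c)"
  shows "continuous_on A (\<lambda>s. coord_dist I (z s) (w s))"
  unfolding coord_dist_def L2_set_def by (intro continuous_intros assms)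

lemma continuous_on_lipschitz_field:
  fixes Y :: "('c \<Rightarrow> real) \<Rightarrow> real"
  assumes lip: "\<And>x y. \<bar>Y x - Y y\<bar> \<le> L * coord_dist I x y"
    and cont: "\<And>c. c \<in> I \<Longrightarrow> continuous_on A (\<lambda>s. z s c)"
  shows "continuous_on A (\<lambda>s. Y (z s))"
  unfolding continuous_on_def
proof
  fix s0 assume "s0 \<in> A"
  have "continuous_on A (\<lambda>s. coord_dist I (z s) (z s0))"
    by (intro continuous_intros cont)
  then have "((\<lambda>s. coord_dist I (z s) (z s0)) \<longlongrightarrow> 0) (at s0 within A)"
    using \<open>s0 \<in> A\<close> by (force simp: continuous_on_def)
  then have "((\<lambda>s. L * coord_dist I (z s) (z s0)) \<longlongrightarrow> 0) (at s0 within A)"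
    by (rule tendsto_mult_right_zero)
  then have "((\<lambda>s. Y (z s) - Y (z s0)) \<longlongrightarrow> 0) (at s0 within A)"
    by (rule Lim_null_comparison[rotated]) (simp add: lip)
  then show "((\<lambda>s. Y (z s)) \<longlongrightarrow> Y (z s0)) (at s0 within A)"
    by (simp add: LIM_zero_iff)
qed

lemma continuous_on_picard:
  assumes lip: "\<And>x y c. c \<in> I \<Longrightarrow> \<bar>Y x c - Y y c\<bar> \<le> L * coord_dist I x y" and "c \<in> I"
  shows "continuous_on {0..T} (\<lambda>s. picard Y a k s c)"
  using \<open>c \<in> I\<close>
proof (induction k arbitrary: c)
  case (Suc k)
  have "continuous_on {0..T} (\<lambda>s. Y (picard Y a k s) c)"
    by (rule continuous_on_lipschitz_field[of "\<lambda>x. Y x c" L I]) (fact lip[OF Suc.prems], fact Suc.IH)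
  then have "(\<lambda>s. Y (picard Y a k s) c) integrable_on {0..T}"
    by (rule integrable_continuous_real)
  then show ?case
    by (auto simp: picard.simps intro!: continuous_intros indefinite_integral_continuous_1)
qed (simp add: picard.simps)

lemma continuous_on_field_picard:
  assumes lip: "\<And>x y c. c \<in> I \<Longrightarrow> \<bar>Y x c - Y y c\<bar> \<le> L * coord_dist I x y" and "c \<in> I"
  shows "continuous_on {0..T} (\<lambda>s. Y (picard Y a k s) c)"
proof (rule continuous_on_lipschitz_field[of "\<lambda>x. Y x c" L I])
  show "\<bar>Y x c - Y y c\<bar> \<le> L * coord_dist I x y" for x y using lip \<open>c \<in> I\<close> .
  show "continuous_on {0..T} (\<lambda>s. picard Y a k s c)" if "c \<in> I" for c
    by (rule continuous_on_picard[OF lip that])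
qed

text \<open>
  Integration in time turns a bound by a term of the exponential series into a bound by the next
  term. The factor \<open>K\<close> absorbs the Lipschitz constant and the passage from coordinates to the
  Euclidean distance; the summand \<open>1\<close> makes it at least one, which the first step needs.
\<close>

lemma picard_step_bound:
  fixes Y :: "('c \<Rightarrow> real) \<Rightarrow> 'c \<Rightarrow> real" and a :: "'c \<Rightarrow> real"
  assumes fin: "finite I" and "0 \<le> L"
    and lip: "\<And>x y c. c \<in> I \<Longrightarrow> \<bar>Y x c - Y y c\<bar> \<le> L * coord_dist I x y"
    and "c \<in> I" "0 \<le> t"
  defines "K \<equiv> L * real (card I) + 1" and "M \<equiv> \<Sum>c\<in>I. \<bar>Y a c\<bar>"
  shows "\<bar>picard Y a (Suc k) t c - picard Y a k t c\<bar> \<le> M * ((K * t) ^ Suc k / fact (Suc k))"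
  using \<open>c \<in> I\<close> \<open>0 \<le> t\<close>
proof (induction k arbitrary: c t)
  case 0
  have "\<bar>Y a c\<bar> \<le> M" unfolding M_def using 0 fin by (intro member_le_sum) auto
  moreover have "1 \<le> K" unfolding K_def using \<open>0 \<le> L\<close> by simp
  ultimately have "\<bar>Y a c\<bar> * (1 * t) \<le> M * (K * t)"
    using 0 by (intro mult_mono) auto
  then show ?case using 0 by (simp add: picard.simps abs_mult mult.commute)
next
  case (Suc k)
  let ?B = "\<lambda>s. K * (M * ((K * s) ^ Suc k / fact (Suc k)))"
  have M: "0 \<le> M" unfolding M_def by (intro sum_nonneg) simp
  have K: "0 \<le> K" unfolding K_def using \<open>0 \<le> L\<close> by simp
  have int: "(\<lambda>s. Y (picard Y a j s) c) integrable_on {0..t}" for j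
    by (rule integrable_continuous_real[OF continuous_on_field_picard[OF lip \<open>c \<in> I\<close>]])
  have B: "(?B has_integral M * ((K * t) ^ Suc (Suc k) / fact (Suc (Suc k)))
              - M * ((K * 0) ^ Suc (Suc k) / fact (Suc (Suc k)))) {0..t}"
  proof (rule fundamental_theorem_of_calculus)
    show "0 \<le> t" by fact
    fix s
    have "((\<lambda>s. M * ((K * s) ^ Suc (Suc k) / fact (Suc (Suc k)))) has_real_derivative
        M * ((real (Suc (Suc k)) * ((K * s) ^ Suc k * K)) / fact (Suc (Suc k)))) (at s within {0..t})"
      by (auto intro!: derivative_eq_intros simp del: power_Suc fact_Suc)
    also have "M * ((real (Suc (Suc k)) * ((K * s) ^ Suc k * K)) / fact (Suc (Suc k))) = ?B s"
      unfolding fact_Suc[of "Suc k"] by (simp del: fact_Suc power_Suc of_nat_Suc)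
    finally show "((\<lambda>s. M * ((K * s) ^ Suc (Suc k) / fact (Suc (Suc k)))) has_vector_derivative ?B s)
        (at s within {0..t})"
      by (simp add: has_real_derivative_iff_has_vector_derivative)
  qed
  have pt: "\<bar>Y (picard Y a (Suc k) s) c - Y (picard Y a k s) c\<bar> \<le> ?B s" if s: "s \<in> {0..t}" for s
  proof -
    have "coord_dist I (picard Y a (Suc k) s) (picard Y a k s)
        \<le> (\<Sum>c\<in>I. M * ((K * s) ^ Suc k / fact (Suc k)))"
      using Suc.IH s by (intro order_trans[OF coord_dist_le_sum] sum_mono) auto
    also have "\<dots> = real (card I) * (M * ((K * s) ^ Suc k / fact (Suc k)))" by simp
    finally have "L * coord_dist I (picard Y a (Suc k) s) (picard Y a k s)
        \<le> L * (real (card I) * (M * ((K * s) ^ Suc k / fact (Suc k))))"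
      using \<open>0 \<le> L\<close> by (rule mult_left_mono)
    also have "\<dots> = (L * real (card I)) * (M * ((K * s) ^ Suc k / fact (Suc k)))"
      by (rule mult.assoc[symmetric])
    also have "\<dots> \<le> K * (M * ((K * s) ^ Suc k / fact (Suc k)))"
    proof (rule mult_right_mono)
      show "L * real (card I) \<le> K" by (simp add: K_def)
      have "0 \<le> K * s" using K s by simp
      then have "0 \<le> (K * s) ^ Suc k / fact (Suc k)"
        by (intro divide_nonneg_nonneg zero_le_power fact_ge_zero)
      then show "0 \<le> M * ((K * s) ^ Suc k / fact (Suc k))" using M by (rule mult_nonneg_nonneg[rotated])
    qed
    finally show ?thesis using lip[OF \<open>c \<in> I\<close>, of "picard Y a (Suc k) s" "picard Y a k s"] by linarith
  qed
  have "picard Y a (Suc (Suc k)) t c - picard Y a (Suc k) t c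
      = integral {0..t} (\<lambda>s. Y (picard Y a (Suc k) s) c - Y (picard Y a k s) c)"
    using int[of "Suc k"] int[of k] by (subst integral_diff) (simp_all add: picard.simps(2))
  moreover have "norm \<dots> \<le> integral {0..t} ?B"
  proof (rule integral_norm_bound_integral)
    show "(\<lambda>s. Y (picard Y a (Suc k) s) c - Y (picard Y a k s) c) integrable_on {0..t}"
      using int[of "Suc k"] int[of k] by (rule integrable_diff)
    show "?B integrable_on {0..t}" using B by (rule has_integral_integrable)
  qed (simp only: real_norm_def pt)
  moreover have "integral {0..t} ?B = M * ((K * t) ^ Suc (Suc k) / fact (Suc (Suc k)))"
    using integral_unique[OF B] by simp
  ultimately show ?case by (simp only: real_norm_def)
qed

text \<open>
  Successive Picard iterates differ by terms of an exponential series, so the iterates converge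
  uniformly on bounded time intervals, and the limit satisfies the integral equation.
\<close>

theorem lipschitz_global_solution:
  fixes Y :: "('c \<Rightarrow> real) \<Rightarrow> 'c \<Rightarrow> real"
  assumes fin: "finite I" and "0 \<le> L"
    and lip: "\<And>x y c. c \<in> I \<Longrightarrow> \<bar>Y x c - Y y c\<bar> \<le> L * coord_dist I x y"
  shows "\<exists>x. (\<forall>c\<in>I. x 0 c = a c) \<and>
           (\<forall>t\<ge>0. \<forall>c\<in>I. ((\<lambda>s. x s c) has_real_derivative Y (x t) c) (at t within {0..}))"
proof -
  define K where "K = L * real (card I) + 1"
  define M where "M = (\<Sum>c\<in>I. \<bar>Y a c\<bar>)"
  define x where "x t c = a c + (\<Sum>k. picard Y a (Suc k) t c - picard Y a k t c)" for t c
  have M: "0 \<le> M" unfolding M_def by (intro sum_nonneg) simp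
  have K: "0 \<le> K" unfolding K_def using \<open>0 \<le> L\<close> by simp
  have tele: "picard Y a m t c = a c + (\<Sum>k<m. picard Y a (Suc k) t c - picard Y a k t c)" for m t c
    using sum_lessThan_telescope[of "\<lambda>k. picard Y a k t c" m] by (simp add: picard.simps(1))
  have unif: "uniform_limit {0..T} (\<lambda>m t. picard Y a m t c) (\<lambda>t. x t c) sequentially"
    if "c \<in> I" for T c
  proof -
    have "summable (\<lambda>k. M * ((K * T) ^ Suc k / fact (Suc k)))"
      using summable_exp[of "K * T"]
      by (intro summable_mult) (subst summable_Suc_iff, simp add: divide_inverse mult.commute)
    then have "uniform_limit {0..T} (\<lambda>m t. \<Sum>k<m. picard Y a (Suc k) t c - picard Y a k t c)
        (\<lambda>t. \<Sum>k. picard Y a (Suc k) t c - picard Y a k t c) sequentially"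
    proof (rule Weierstrass_m_test[rotated])
      fix k t assume t: "t \<in> {0..T}"
      have "\<bar>picard Y a (Suc k) t c - picard Y a k t c\<bar> \<le> M * ((K * t) ^ Suc k / fact (Suc k))"
        using picard_step_bound[OF fin \<open>0 \<le> L\<close> lip \<open>c \<in> I\<close>, where t = t and a = a and k = k] t
        unfolding K_def M_def by simp
      also have "\<dots> \<le> M * ((K * T) ^ Suc k / fact (Suc k))"
        using M K t by (intro mult_left_mono divide_right_mono power_mono) (simp_all del: power_Suc fact_Suc)
      finally show "norm (picard Y a (Suc k) t c - picard Y a k t c)
          \<le> M * ((K * T) ^ Suc k / fact (Suc k))" by simp
    qed
    then have "uniform_limit {0..T} (\<lambda>m t. a c + (\<Sum>k<m. picard Y a (Suc k) t c - picard Y a k t c))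
        (\<lambda>t. a c + (\<Sum>k. picard Y a (Suc k) t c - picard Y a k t c)) sequentially"
      by (intro uniform_limit_add uniform_limit_const)
    then show ?thesis unfolding x_def tele[symmetric] .
  qed
  have contx: "continuous_on {0..T} (\<lambda>t. x t c)" if "c \<in> I" for T c
    by (rule uniform_limit_theorem[OF _ unif[OF that]])
       (auto intro!: always_eventually continuous_on_picard[OF lip that])
  have contY: "continuous_on {0..T} (\<lambda>t. Y (x t) c)" if "c \<in> I" for T c
    by (rule continuous_on_lipschitz_field[of "\<lambda>x. Y x c" L I]) (fact lip[OF that], rule contx)
  have unifY: "uniform_limit {0..T} (\<lambda>m t. Y (picard Y a m t) c) (\<lambda>t. Y (x t) c) sequentially"
    if c: "c \<in> I" for T c
  proof (rule uniform_limitI)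
    fix e :: real assume "0 < e"
    define d where "d = e / K"
    have "0 < K" unfolding K_def using \<open>0 \<le> L\<close> by (simp add: add_nonneg_pos)
    then have "0 < d" using \<open>0 < e\<close> by (simp add: d_def)
    have "\<forall>\<^sub>F m in sequentially. \<forall>c'\<in>I. \<forall>t\<in>{0..T}. dist (picard Y a m t c') (x t c') < d"
      using fin \<open>0 < d\<close> unif by (intro eventually_ball_finite ballI uniform_limitD) auto
    then show "\<forall>\<^sub>F m in sequentially. \<forall>t\<in>{0..T}. dist (Y (picard Y a m t) c) (Y (x t) c) < e"
    proof eventually_elim
      case (elim m)
      show ?case
      proof
        fix t assume t: "t \<in> {0..T}"
        have "coord_dist I (picard Y a m t) (x t) \<le> (\<Sum>c'\<in>I. d)"
          using elim t
          by (intro order_trans[OF coord_dist_le_sum] sum_mono) (auto simp: dist_real_def less_imp_le)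
        then have "L * coord_dist I (picard Y a m t) (x t) \<le> L * (real (card I) * d)"
          using \<open>0 \<le> L\<close> by (intro mult_left_mono) auto
        also have "\<dots> < K * d" using \<open>0 < d\<close> by (simp add: K_def algebra_simps)
        also have "\<dots> = e" using \<open>0 < K\<close> by (simp add: d_def)
        finally show "dist (Y (picard Y a m t) c) (Y (x t) c) < e"
          using lip[OF c, of "picard Y a m t" "x t"] by (simp add: dist_real_def)
      qed
    qed
  qed
  have inteq: "x t c = a c + integral {0..t} (\<lambda>s. Y (x s) c)" if "0 \<le> t" "c \<in> I" for t c
  proof -
    have cont: "continuous_on {0..t} (\<lambda>s. Y (picard Y a m s) c)" for m
      by (rule continuous_on_field_picard[OF lip \<open>c \<in> I\<close>])
    obtain J J' where J: "\<And>m. ((\<lambda>s. Y (picard Y a m s) c) has_integral J m) {0..t}"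
        "((\<lambda>s. Y (x s) c) has_integral J') {0..t}" "J \<longlonglongrightarrow> J'"
      using uniform_limit_integral[OF unifY[OF \<open>c \<in> I\<close>] cont] by (metis sequentially_bot)
    have "(\<lambda>m. picard Y a (Suc m) t c) \<longlonglongrightarrow> a c + J'"
      unfolding picard.simps integral_unique[OF J(1)] by (intro tendsto_intros J(3))
    moreover have "(\<lambda>m. picard Y a m t c) \<longlonglongrightarrow> x t c"
      using unif[OF \<open>c \<in> I\<close>, of t] \<open>0 \<le> t\<close> by (auto intro: tendsto_uniform_limitI)
    then have "(\<lambda>m. picard Y a (Suc m) t c) \<longlonglongrightarrow> x t c"
      by (rule LIMSEQ_Suc)
    ultimately show ?thesis using J(2) LIMSEQ_unique by (auto simp: integral_unique)
  qed
  show ?thesis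
  proof (intro exI[of _ x] conjI ballI allI impI)
    fix c assume "c \<in> I"
    then show "x 0 c = a c" using inteq[of 0 c] by simp
  next
    fix t :: real and c assume t: "0 \<le> t" and c: "c \<in> I"
    have "((\<lambda>u. integral {0..u} (\<lambda>s. Y (x s) c)) has_real_derivative Y (x t) c) (at t within {0..t+1})"
      using t by (intro integral_has_real_derivative contY c) auto
    then have "((\<lambda>u. a c + integral {0..u} (\<lambda>s. Y (x s) c)) has_real_derivative Y (x t) c)
        (at t within {0..t+1})"
      by (auto intro!: derivative_eq_intros)
    then have "((\<lambda>u. x u c) has_real_derivative Y (x t) c) (at t within {0..t+1})"
      using t c inteq by (elim has_field_derivative_transform_within[of _ _ _ _ 1]) auto
    moreover have "at t within {0..t+1} = at t within {0..}"
      by (rule at_within_nhd[of _ "{..<t+1}"]) auto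
    ultimately show "((\<lambda>s. x s c) has_real_derivative Y (x t) c) (at t within {0..})" by simp
  qed
qed

section \<open>Functions near a point of coordinate space\<close>

text \<open>
  Only the coordinates in \<open>I\<close> are close to those of \<open>e\<close>; the others are arbitrary. As a filter,
  this notion of nearness lets finitely many local estimates be combined.
\<close>

definition nbhd :: "'c set \<Rightarrow> ('c \<Rightarrow> real) \<Rightarrow> ('c \<Rightarrow> real) filter" where
  "nbhd I e = filtercomap (\<lambda>x. coord_dist I x e) (nhds 0)"

lemma eventually_nbhd:
  "eventually P (nbhd I e) \<longleftrightarrow> (\<exists>r>0. \<forall>x. coord_dist I x e < r \<longrightarrow> P x)"
proof
  assume "eventually P (nbhd I e)"
  then obtain Q where Q: "eventually Q (nhds (0::real))" "\<And>x. Q (coord_dist I x e) \<Longrightarrow> P x"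
    by (auto simp: nbhd_def eventually_filtercomap)
  then obtain r where "r > 0" "\<And>s. dist s 0 < r \<Longrightarrow> Q s"
    by (auto simp: eventually_nhds_metric)
  then show "\<exists>r>0. \<forall>x. coord_dist I x e < r \<longrightarrow> P x"
    using Q(2) by (intro exI[of _ r]) (auto simp: dist_real_def)
next
  assume "\<exists>r>0. \<forall>x. coord_dist I x e < r \<longrightarrow> P x"
  then obtain r where r: "r > 0" "\<And>x. coord_dist I x e < r \<Longrightarrow> P x" by blast
  have "eventually (\<lambda>s. s < r) (nhds (0::real))"
    using r(1) by (rule eventually_nhds_in_open[of "{..<r}" 0, simplified])
  then show "eventually P (nbhd I e)"
    unfolding nbhd_def eventually_filtercomap using r(2) by blast
qed

lemma eventually_nbhd_self: "eventually P (nbhd I e) \<Longrightarrow> P e"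
  by (auto simp: eventually_nbhd)

lemma coord_dist_tendsto_nbhd: "((\<lambda>x. coord_dist I x e) \<longlongrightarrow> 0) (nbhd I e)"
  unfolding nbhd_def by (rule filterlim_filtercomap)

text \<open>
  Picard iteration needs a vector field that is Lipschitz near the equilibrium. The fields below
  are explicit expressions in the coordinates, so closure rules for this property suffice.
\<close>

definition lipschitz_near :: "'c set \<Rightarrow> ('c \<Rightarrow> real) \<Rightarrow> (('c \<Rightarrow> real) \<Rightarrow> real) \<Rightarrow> bool" where
  "lipschitz_near I e F \<longleftrightarrow>
     (\<exists>L\<ge>0. \<exists>r>0. \<forall>x y. coord_dist I x e < r \<longrightarrow> coord_dist I y e < r \<longrightarrow>
        \<bar>F x - F y\<bar> \<le> L * coord_dist I x y)"

lemma lipschitz_nearI: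
  assumes "eventually P (nbhd I e)"
    and "\<And>x y. P x \<Longrightarrow> P y \<Longrightarrow> \<bar>F x - F y\<bar> \<le> L * coord_dist I x y"
  shows "lipschitz_near I e F"
proof -
  obtain r where r: "r > 0" "\<And>x. coord_dist I x e < r \<Longrightarrow> P x"
    using assms(1) by (auto simp: eventually_nbhd)
  have "\<bar>F x - F y\<bar> \<le> \<bar>L\<bar> * coord_dist I x y" if "coord_dist I x e < r" "coord_dist I y e < r" for x y
  proof -
    have "L * coord_dist I x y \<le> \<bar>L\<bar> * coord_dist I x y" by (intro mult_right_mono) auto
    with assms(2)[OF r(2)[OF that(1)] r(2)[OF that(2)]] show ?thesis by linarith
  qed
  then show ?thesis unfolding lipschitz_near_def using r(1) by (intro exI[of _ "\<bar>L\<bar>"]) auto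
qed

lemma lipschitz_nearD:
  assumes "lipschitz_near I e F"
  shows "\<exists>L P. L \<ge> 0 \<and> eventually P (nbhd I e) \<and>
           (\<forall>x y. P x \<longrightarrow> P y \<longrightarrow> \<bar>F x - F y\<bar> \<le> L * coord_dist I x y)"
proof -
  obtain L r where L: "L \<ge> 0" "r > 0" "\<forall>x y. coord_dist I x e < r \<longrightarrow> coord_dist I y e < r \<longrightarrow>
        \<bar>F x - F y\<bar> \<le> L * coord_dist I x y"
    using assms unfolding lipschitz_near_def by blast
  moreover have "eventually (\<lambda>x. coord_dist I x e < r) (nbhd I e)"
    using \<open>r > 0\<close> by (auto simp: eventually_nbhd)
  ultimately show ?thesis by blast
qed

lemma lipschitz_near_tendsto:
  assumes "lipschitz_near I e F"
  shows "(F \<longlongrightarrow> F e) (nbhd I e)"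
proof -
  obtain L P where "L \<ge> 0" and L: "eventually P (nbhd I e)"
    "\<forall>x y. P x \<longrightarrow> P y \<longrightarrow> \<bar>F x - F y\<bar> \<le> L * coord_dist I x y"
    using lipschitz_nearD[OF assms] by blast
  have "((\<lambda>x. L * coord_dist I x e) \<longlongrightarrow> 0) (nbhd I e)"
    by (intro tendsto_mult_right_zero coord_dist_tendsto_nbhd)
  moreover have "eventually (\<lambda>x. norm (F x - F e) \<le> L * coord_dist I x e) (nbhd I e)"
    using L(1)
  proof eventually_elim
    case (elim x)
    show ?case using L(2) elim eventually_nbhd_self[OF L(1)] by auto
  qed
  ultimately have "((\<lambda>x. F x - F e) \<longlongrightarrow> 0) (nbhd I e)" by (rule Lim_null_comparison[rotated])
  then show ?thesis by (simp add: LIM_zero_iff)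
qed

named_theorems lipschitz_intros

lemma lipschitz_near_const [lipschitz_intros]: "lipschitz_near I e (\<lambda>x. k)"
  by (rule lipschitz_nearI[of "\<lambda>_. True" _ _ _ 0]) auto

lemma lipschitz_near_coord [lipschitz_intros]:
  "finite I \<Longrightarrow> c \<in> I \<Longrightarrow> lipschitz_near I e (\<lambda>x. x c)"
  by (rule lipschitz_nearI[of "\<lambda>_. True" _ _ _ 1]) (auto intro: coord_le_coord_dist)

lemma lipschitz_near_add [lipschitz_intros]:
  assumes "lipschitz_near I e F" "lipschitz_near I e G"
  shows "lipschitz_near I e (\<lambda>x. F x + G x)"
proof -
  obtain L P where L: "L \<ge> 0" "eventually P (nbhd I e)"
    "\<forall>x y. P x \<longrightarrow> P y \<longrightarrow> \<bar>F x - F y\<bar> \<le> L * coord_dist I x y"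
    using lipschitz_nearD[OF assms(1)] by blast
  obtain M Q where M: "M \<ge> 0" "eventually Q (nbhd I e)"
    "\<forall>x y. Q x \<longrightarrow> Q y \<longrightarrow> \<bar>G x - G y\<bar> \<le> M * coord_dist I x y"
    using lipschitz_nearD[OF assms(2)] by blast
  show ?thesis
  proof (rule lipschitz_nearI[OF eventually_conj[OF L(2) M(2)]])
    fix x y assume "P x \<and> Q x" "P y \<and> Q y"
    then have "\<bar>F x - F y\<bar> \<le> L * coord_dist I x y" "\<bar>G x - G y\<bar> \<le> M * coord_dist I x y"
      using L(3) M(3) by blast+
    then show "\<bar>F x + G x - (F y + G y)\<bar> \<le> (L + M) * coord_dist I x y"
      by (simp add: distrib_right)
  qed
qed

lemma lipschitz_near_mult [lipschitz_intros]:
  assumes "lipschitz_near I e F" "lipschitz_near I e G"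
  shows "lipschitz_near I e (\<lambda>x. F x * G x)"
proof -
  obtain L P where L: "L \<ge> 0" "eventually P (nbhd I e)"
    "\<forall>x y. P x \<longrightarrow> P y \<longrightarrow> \<bar>F x - F y\<bar> \<le> L * coord_dist I x y"
    using lipschitz_nearD[OF assms(1)] by blast
  obtain M Q where M: "M \<ge> 0" "eventually Q (nbhd I e)"
    "\<forall>x y. Q x \<longrightarrow> Q y \<longrightarrow> \<bar>G x - G y\<bar> \<le> M * coord_dist I x y"
    using lipschitz_nearD[OF assms(2)] by blast
  have bd: "eventually (\<lambda>x. \<bar>F x\<bar> < \<bar>F e\<bar> + 1) (nbhd I e)" "eventually (\<lambda>x. \<bar>G x\<bar> < \<bar>G e\<bar> + 1) (nbhd I e)"
    using lipschitz_near_tendsto[OF assms(1)] lipschitz_near_tendsto[OF assms(2)]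
    by (auto intro!: order_tendstoD(2)[OF tendsto_rabs])
  show ?thesis
  proof (rule lipschitz_nearI[OF eventually_conj[OF eventually_conj[OF L(2) M(2)] eventually_conj[OF bd]],
        where L = "(\<bar>F e\<bar> + 1) * M + (\<bar>G e\<bar> + 1) * L"])
    fix x y
    assume x: "(P x \<and> Q x) \<and> \<bar>F x\<bar> < \<bar>F e\<bar> + 1 \<and> \<bar>G x\<bar> < \<bar>G e\<bar> + 1"
      and y: "(P y \<and> Q y) \<and> \<bar>F y\<bar> < \<bar>F e\<bar> + 1 \<and> \<bar>G y\<bar> < \<bar>G e\<bar> + 1"
    have "\<bar>F x * G x - F y * G y\<bar> = \<bar>F x * (G x - G y) + G y * (F x - F y)\<bar>"
      by (simp add: algebra_simps)
    also have "\<dots> \<le> \<bar>F x\<bar> * \<bar>G x - G y\<bar> + \<bar>G y\<bar> * \<bar>F x - F y\<bar>"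
      by (rule order_trans[OF abs_triangle_ineq]) (simp add: abs_mult)
    also have "\<dots> \<le> (\<bar>F e\<bar> + 1) * (M * coord_dist I x y) + (\<bar>G e\<bar> + 1) * (L * coord_dist I x y)"
      using x y L(3) M(3) by (intro add_mono mult_mono) auto
    finally show "\<bar>F x * G x - F y * G y\<bar> \<le> ((\<bar>F e\<bar> + 1) * M + (\<bar>G e\<bar> + 1) * L) * coord_dist I x y"
      by (simp add: algebra_simps)
  qed
qed

lemma lipschitz_near_uminus [lipschitz_intros]:
  assumes "lipschitz_near I e F"
  shows "lipschitz_near I e (\<lambda>x. - F x)"
  using lipschitz_near_mult[OF lipschitz_near_const assms, of "-1"] by (simp only: mult_minus1)

lemma lipschitz_near_diff [lipschitz_intros]:
  assumes "lipschitz_near I e F" "lipschitz_near I e G"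
  shows "lipschitz_near I e (\<lambda>x. F x - G x)"
  using lipschitz_near_add[OF assms(1) lipschitz_near_uminus[OF assms(2)]]
  by (simp only: add_uminus_conv_diff)

lemma lipschitz_near_power [lipschitz_intros]:
  assumes "lipschitz_near I e F"
  shows "lipschitz_near I e (\<lambda>x. F x ^ k)"
proof (induction k)
  case 0
  show ?case by (simp only: power_0 lipschitz_near_const)
next
  case (Suc k)
  show ?case unfolding power_Suc by (rule lipschitz_near_mult[OF assms Suc.IH])
qed

lemma lipschitz_near_sum [lipschitz_intros]:
  assumes "\<And>k. k \<in> A \<Longrightarrow> lipschitz_near I e (F k)"
  shows "lipschitz_near I e (\<lambda>x. \<Sum>k\<in>A. F k x)"
  using assms
proof (induction A rule: infinite_finite_induct)
  case (insert k A)
  have "lipschitz_near I e (\<lambda>x. F k x + (\<Sum>k\<in>A. F k x))"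
    by (rule lipschitz_near_add) (use insert in blast)+
  then show ?case using insert.hyps by simp
qed (simp_all add: lipschitz_near_const)

text \<open>
  Near \<open>F e\<close> the derivative of \<open>g\<close> is bounded by continuity, so the mean value theorem gives a
  Lipschitz constant for \<open>g\<close> there.
\<close>

lemma lipschitz_near_compose:
  fixes g g' :: "real \<Rightarrow> real"
  assumes F: "lipschitz_near I e F"
    and g: "eventually (\<lambda>u. (g has_real_derivative g' u) (at u)) (nhds (F e))" and g': "isCont g' (F e)"
  shows "lipschitz_near I e (\<lambda>x. g (F x))"
proof -
  have "eventually (\<lambda>u. \<bar>g' u\<bar> < \<bar>g' (F e)\<bar> + 1) (nhds (F e))"
    using g' by (intro order_tendstoD(2)[OF tendsto_rabs]) (auto simp: isCont_def tendsto_nhds_iff)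
  with g have "eventually (\<lambda>u. (g has_real_derivative g' u) (at u) \<and> \<bar>g' u\<bar> < \<bar>g' (F e)\<bar> + 1) (nhds (F e))"
    by (rule eventually_conj)
  then obtain \<rho> where \<rho>: "\<rho> > 0"
    "\<And>u. dist u (F e) < \<rho> \<Longrightarrow> (g has_real_derivative g' u) (at u) \<and> \<bar>g' u\<bar> < \<bar>g' (F e)\<bar> + 1"
    unfolding eventually_nhds_metric by blast
  have bd: "\<bar>g u - g v\<bar> \<le> (\<bar>g' (F e)\<bar> + 1) * \<bar>u - v\<bar>" if "u \<in> ball (F e) \<rho>" "v \<in> ball (F e) \<rho>" for u v
  proof -
    have "norm (g u - g v) \<le> (\<bar>g' (F e)\<bar> + 1) * norm (u - v)"
    proof (rule field_differentiable_bound[OF convex_ball _ _ that(1) that(2)])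
      fix w assume "w \<in> ball (F e) \<rho>"
      then have w: "dist w (F e) < \<rho>" by (simp add: dist_commute)
      show "(g has_real_derivative g' w) (at w within ball (F e) \<rho>)"
        using \<rho>(2)[OF w] by (blast intro: has_field_derivative_at_within)
      show "norm (g' w) \<le> \<bar>g' (F e)\<bar> + 1" using \<rho>(2)[OF w] by simp
    qed
    then show ?thesis by simp
  qed
  obtain L P where L: "L \<ge> 0" "eventually P (nbhd I e)"
    "\<forall>x y. P x \<longrightarrow> P y \<longrightarrow> \<bar>F x - F y\<bar> \<le> L * coord_dist I x y"
    using lipschitz_nearD[OF F] by blast
  have "eventually (\<lambda>x. dist (F x) (F e) < \<rho>) (nbhd I e)"
    using lipschitz_near_tendsto[OF F] \<open>\<rho> > 0\<close> by (rule tendstoD)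
  from eventually_conj[OF L(2) this] show ?thesis
  proof (rule lipschitz_nearI)
    fix x y assume xy: "P x \<and> dist (F x) (F e) < \<rho>" "P y \<and> dist (F y) (F e) < \<rho>"
    then have "\<bar>g (F x) - g (F y)\<bar> \<le> (\<bar>g' (F e)\<bar> + 1) * \<bar>F x - F y\<bar>"
      by (intro bd) (auto simp: dist_commute)
    also have "\<dots> \<le> (\<bar>g' (F e)\<bar> + 1) * (L * coord_dist I x y)"
      using L(3) xy by (intro mult_left_mono) auto
    finally show "\<bar>g (F x) - g (F y)\<bar> \<le> (\<bar>g' (F e)\<bar> + 1) * L * coord_dist I x y"
      by (simp add: mult.assoc)
  qed
qed

lemma lipschitz_near_sin [lipschitz_intros]:
  "lipschitz_near I e F \<Longrightarrow> lipschitz_near I e (\<lambda>x. sin (F x))"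
  by (rule lipschitz_near_compose[of _ _ _ sin cos]) (simp_all add: DERIV_sin)

lemma lipschitz_near_cos [lipschitz_intros]:
  "lipschitz_near I e F \<Longrightarrow> lipschitz_near I e (\<lambda>x. cos (F x))"
  by (rule lipschitz_near_compose[of _ _ _ cos "\<lambda>u. - sin u"])
     (simp_all add: DERIV_cos)

lemma lipschitz_near_inverse [lipschitz_intros]:
  assumes "lipschitz_near I e F" "F e \<noteq> 0"
  shows "lipschitz_near I e (\<lambda>x. inverse (F x))"
proof (rule lipschitz_near_compose[OF assms(1), of inverse "\<lambda>u. - (inverse u ^ 2)"])
  have "eventually (\<lambda>u. u \<in> - {0}) (nhds (F e))"
    using assms(2) by (intro eventually_nhds_in_open) auto
  then show "\<forall>\<^sub>F u in nhds (F e). (inverse has_real_derivative - (inverse u ^ 2)) (at u)"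
    by eventually_elim (auto intro!: derivative_eq_intros simp: power2_eq_square)
qed (use assms(2) in \<open>auto intro!: isCont_minus isCont_power continuous_at_within_inverse continuous_real_sqrt isCont_divide\<close>)

lemma lipschitz_near_divide [lipschitz_intros]:
  "lipschitz_near I e F \<Longrightarrow> lipschitz_near I e G \<Longrightarrow> G e \<noteq> 0 \<Longrightarrow> lipschitz_near I e (\<lambda>x. F x / G x)"
  unfolding divide_inverse by (intro lipschitz_intros)

lemma lipschitz_near_sqrt [lipschitz_intros]:
  assumes "lipschitz_near I e F" "F e > 0"
  shows "lipschitz_near I e (\<lambda>x. sqrt (F x))"
proof (rule lipschitz_near_compose[OF assms(1), of sqrt "\<lambda>u. inverse (sqrt u) / 2"])
  have "eventually (\<lambda>u. u \<in> {0<..}) (nhds (F e))"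
    using assms(2) by (intro eventually_nhds_in_open) auto
  then show "\<forall>\<^sub>F u in nhds (F e). (sqrt has_real_derivative inverse (sqrt u) / 2) (at u)"
    by eventually_elim (auto intro: DERIV_real_sqrt)
qed (use assms(2) in \<open>auto intro!: isCont_minus isCont_power continuous_at_within_inverse continuous_real_sqrt isCont_divide\<close>)

lemma lipschitz_near_cong:
  assumes "lipschitz_near I e F" "eventually (\<lambda>x. F x = G x) (nbhd I e)"
  shows "lipschitz_near I e G"
proof -
  obtain L P where "L \<ge> 0" and L: "eventually P (nbhd I e)"
    "\<forall>x y. P x \<longrightarrow> P y \<longrightarrow> \<bar>F x - F y\<bar> \<le> L * coord_dist I x y"
    using lipschitz_nearD[OF assms(1)] by blast
  show ?thesis
    by (rule lipschitz_nearI[OF eventually_conj[OF L(1) assms(2)], where L = L]) (metis L(2))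
qed

lemma lipschitz_near_uniform:
  assumes fin: "finite I" and lip: "\<And>c. c \<in> I \<Longrightarrow> lipschitz_near I e (\<lambda>x. X x c)"
  shows "\<exists>L P. L \<ge> 0 \<and> eventually P (nbhd I e) \<and>
           (\<forall>x y. \<forall>c\<in>I. P x \<longrightarrow> P y \<longrightarrow> \<bar>X x c - X y c\<bar> \<le> L * coord_dist I x y)"
proof -
  have "\<forall>c\<in>I. \<exists>L P. L \<ge> 0 \<and> eventually P (nbhd I e) \<and>
      (\<forall>x y. P x \<longrightarrow> P y \<longrightarrow> \<bar>X x c - X y c\<bar> \<le> L * coord_dist I x y)"
    using lipschitz_nearD[OF lip] by blast
  then obtain L P where L: "\<And>c. c \<in> I \<Longrightarrow> L c \<ge> 0" "\<And>c. c \<in> I \<Longrightarrow> eventually (P c) (nbhd I e)"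
      "\<And>x y c. c \<in> I \<Longrightarrow> P c x \<Longrightarrow> P c y \<Longrightarrow> \<bar>X x c - X y c\<bar> \<le> L c * coord_dist I x y"
    by metis
  show ?thesis
  proof (intro exI[of _ "\<Sum>c\<in>I. L c"] exI[of _ "\<lambda>x. \<forall>c\<in>I. P c x"] conjI allI ballI impI)
    show "0 \<le> (\<Sum>c\<in>I. L c)" using L(1) by (rule sum_nonneg)
    show "\<forall>\<^sub>F x in nbhd I e. \<forall>c\<in>I. P c x" using fin L(2) by (intro eventually_ball_finite) auto
    fix x y c assume a: "c \<in> I" "\<forall>c\<in>I. P c x" "\<forall>c\<in>I. P c y"
    have "L c \<le> (\<Sum>c\<in>I. L c)" using fin L(1) a(1) by (intro member_le_sum) auto
    then have "L c * coord_dist I x y \<le> (\<Sum>c\<in>I. L c) * coord_dist I x y"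
      by (rule mult_right_mono) simp
    moreover have "\<bar>X x c - X y c\<bar> \<le> L c * coord_dist I x y" using L(3) a by blast
    ultimately show "\<bar>X x c - X y c\<bar> \<le> (\<Sum>c\<in>I. L c) * coord_dist I x y" by linarith
  qed
qed

section \<open>Stability at a strict minimum of a conserved quantity\<close>

text \<open>
  Precomposition with this retraction onto a box around \<open>e\<close> turns a field that is Lipschitz near
  \<open>e\<close> into one that is Lipschitz everywhere, without changing it in the box.
\<close>

definition clamp_coords :: "real \<Rightarrow> ('c \<Rightarrow> real) \<Rightarrow> ('c \<Rightarrow> real) \<Rightarrow> 'c \<Rightarrow> real" where
  "clamp_coords \<rho> e x = (\<lambda>c. max (e c - \<rho>) (min (e c + \<rho>) (x c)))"

lemma coord_dist_clamp:
  "coord_dist I (clamp_coords \<rho> e x) (clamp_coords \<rho> e y) \<le> coord_dist I x y"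
proof -
  have "coord_dist I (clamp_coords \<rho> e x) (clamp_coords \<rho> e y)
      = L2_set (\<lambda>c. \<bar>clamp_coords \<rho> e x c - clamp_coords \<rho> e y c\<bar>) I"
    by (simp add: coord_dist_def L2_set_def)
  also have "\<dots> \<le> L2_set (\<lambda>c. \<bar>x c - y c\<bar>) I"
    by (rule L2_set_mono) (auto simp: clamp_coords_def max_def min_def)
  also have "\<dots> = coord_dist I x y" by (simp add: coord_dist_def L2_set_def)
  finally show ?thesis .
qed

lemma clamp_coords_near:
  assumes "0 \<le> \<rho>"
  shows "coord_dist I (clamp_coords \<rho> e x) e \<le> real (card I) * \<rho>"
proof -
  have "coord_dist I (clamp_coords \<rho> e x) e \<le> (\<Sum>c\<in>I. \<rho>)"
    using assms by (intro order_trans[OF coord_dist_le_sum] sum_mono)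
      (auto simp: clamp_coords_def max_def min_def)
  then show ?thesis by simp
qed

text \<open>
  A curve that starts in the open ball of radius \<open>\<epsilon>\<close> at a level of \<open>H\<close> below the minimum of
  \<open>H\<close> on the sphere of radius \<open>\<epsilon>\<close> would have to cross that sphere in order to leave the ball, and
  up to the first crossing time it keeps its level.
\<close>

lemma energy_barrier:
  fixes H :: "('c \<Rightarrow> real) \<Rightarrow> real"
  assumes "0 \<le> T" and cont: "\<And>c. c \<in> I \<Longrightarrow> continuous_on {0..T} (\<lambda>s. x s c)"
    and start: "coord_dist I (x 0) e < \<epsilon>" "H (x 0) < m"
    and sphere: "\<And>z. coord_dist I z e = \<epsilon> \<Longrightarrow> m \<le> H z"
    and level: "\<And>t. t \<in> {0..T} \<Longrightarrow> coord_dist I (x t) e \<le> \<epsilon> \<Longrightarrow>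
        ((\<lambda>s. H (x s)) has_real_derivative 0) (at t within {0..T})"
    and "t \<in> {0..T}"
  shows "coord_dist I (x t) e < \<epsilon>"
proof (rule ccontr)
  define d where "d s = coord_dist I (x s) e" for s
  assume "\<not> coord_dist I (x t) e < \<epsilon>"
  then have "\<epsilon> \<le> d t" by (simp add: d_def)
  have contd: "continuous_on {0..T} d"
    unfolding d_def by (intro continuous_intros cont)
  define S where "S = {0..T} \<inter> d -` {\<epsilon>..}"
  have "closed S"
    unfolding S_def by (rule continuous_closed_preimage[OF contd]) auto
  moreover have "t \<in> S" using \<open>t \<in> {0..T}\<close> \<open>\<epsilon> \<le> d t\<close> by (simp add: S_def)
  moreover have bdd: "bdd_below S" unfolding S_def by (rule bdd_belowI[of _ 0]) simp
  ultimately have "Inf S \<in> S" by (intro closed_contains_Inf) auto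
  define \<tau> where "\<tau> = Inf S"
  have \<tau>: "\<tau> \<in> {0..T}" "\<epsilon> \<le> d \<tau>" using \<open>Inf S \<in> S\<close> by (auto simp: S_def \<tau>_def)
  have before: "s \<notin> S" if "s < \<tau>" for s
    using cInf_lower[OF _ bdd, of s] that unfolding \<tau>_def by linarith
  have "d \<tau> = \<epsilon>"
  proof (rule ccontr)
    assume "d \<tau> \<noteq> \<epsilon>"
    obtain s where s: "0 \<le> s" "s \<le> \<tau>" "d s = \<epsilon>"
      using IVT'[of d 0 \<epsilon> \<tau>] start(1) \<tau> continuous_on_subset[OF contd, of "{0..\<tau>}"]
      by (force simp: d_def)
    then have "s < \<tau>" using \<open>d \<tau> \<noteq> \<epsilon>\<close> by (cases "s = \<tau>") auto
    then show False using before[of s] s \<tau> by (simp add: S_def)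
  qed
  have inside: "d s \<le> \<epsilon>" if "s \<in> {0..\<tau>}" for s
    using before[of s] that \<tau>(1) \<open>d \<tau> = \<epsilon>\<close> by (cases "s = \<tau>") (auto simp: S_def)
  have "\<exists>k. \<forall>s\<in>{0..\<tau>}. H (x s) = k"
  proof (rule has_field_derivative_zero_constant)
    fix s assume s: "s \<in> {0..\<tau>}"
    show "((\<lambda>s. H (x s)) has_real_derivative 0) (at s within {0..\<tau>})"
      using level[of s] inside[OF s] s \<tau>(1)
      by (intro DERIV_subset[of _ _ _ "{0..T}" "{0..\<tau>}"]) (auto simp: d_def)
  qed simp
  then have "H (x \<tau>) = H (x 0)" using \<tau>(1) by force
  then show False using sphere[of "x \<tau>"] \<open>d \<tau> = \<epsilon>\<close> start(2) by (simp add: d_def)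
qed

text \<open>
  This is the theorem of Lagrange and Dirichlet. The level sets of \<open>H\<close> slightly above its minimum
  confine solutions to small balls. Replacing the field by its composition with the
  retraction onto a box yields solutions for all future time; being confined to a ball inside the
  box, they solve the original system as well.
\<close>

theorem lyapunov_stable_strict_minimum:
  fixes H :: "('c \<Rightarrow> real) \<Rightarrow> real"
  assumes fin: "finite I"
    and equilibrium: "\<And>c. c \<in> I \<Longrightarrow> X e c = 0"
    and dom: "eventually (\<lambda>x. x \<in> D) (nbhd I e)"
    and lip: "\<And>c. c \<in> I \<Longrightarrow> lipschitz_near I e (\<lambda>x. X x c)"
    and conserved: "eventually (\<lambda>z. \<forall>x t T. x t = z \<longrightarrow>
          (\<forall>c\<in>I. ((\<lambda>s. x s c) has_real_derivative X z c) (at t within T)) \<longrightarrow>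
          ((\<lambda>s. H (x s)) has_real_derivative 0) (at t within T)) (nbhd I e)"
    and "\<kappa> > 0"
    and min: "eventually (\<lambda>x. H e + \<kappa> * (coord_dist I x e)\<^sup>2 \<le> H x) (nbhd I e)"
    and contH: "(H \<longlongrightarrow> H e) (nbhd I e)"
  shows "lyapunov_stable I D X e"
proof -
  obtain L P where "L \<ge> 0" and P: "eventually P (nbhd I e)"
    and L': "\<forall>x y. \<forall>c\<in>I. P x \<longrightarrow> P y \<longrightarrow> \<bar>X x c - X y c\<bar> \<le> L * coord_dist I x y"
    using lipschitz_near_uniform[where X = X, OF fin lip] by blast
  have L: "\<bar>X x c - X y c\<bar> \<le> L * coord_dist I x y" if "P x" "P y" "c \<in> I" for x y c
    using L' that by blast
  define Q where "Q z \<longleftrightarrow> (\<forall>x t T. x t = z \<longrightarrow>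
      (\<forall>c\<in>I. ((\<lambda>s. x s c) has_real_derivative X z c) (at t within T)) \<longrightarrow>
      ((\<lambda>s. H (x s)) has_real_derivative 0) (at t within T))" for z
  have "eventually Q (nbhd I e)" using conserved unfolding Q_def .
  then have "eventually (\<lambda>x. x \<in> D \<and> P x \<and> Q x \<and> H e + \<kappa> * (coord_dist I x e)\<^sup>2 \<le> H x) (nbhd I e)"
    by (intro eventually_conj dom P min)
  then obtain r0 where r0: "r0 > 0" and near_r0: "\<forall>x. coord_dist I x e < r0 \<longrightarrow>
      x \<in> D \<and> P x \<and> Q x \<and> H e + \<kappa> * (coord_dist I x e)\<^sup>2 \<le> H x"
    unfolding eventually_nbhd by blast
  have in_D: "x \<in> D" and in_P: "P x" and in_Q: "Q x"
    and minr: "H e + \<kappa> * (coord_dist I x e)\<^sup>2 \<le> H x" if "coord_dist I x e < r0" for x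
    using near_r0 that by auto
  have cons: "((\<lambda>s. H (x s)) has_real_derivative 0) (at t within T)"
    if "coord_dist I (x t) e < r0"
      and "\<And>c. c \<in> I \<Longrightarrow> ((\<lambda>s. x s c) has_real_derivative X (x t) c) (at t within T)" for x t T
    using in_Q[OF that(1)] that(2) unfolding Q_def by blast
  \<comment> \<open>The box with half side \<open>\<rho>\<close> contains the ball of radius \<open>\<rho>\<close> and lies in the ball of radius \<open>r0\<close>.\<close>
  define \<rho> where "\<rho> = r0 / (real (card I) + 2)"
  have "\<rho> > 0" using r0 by (simp add: \<rho>_def add_nonneg_pos)
  have \<rho>: "real (card I) * \<rho> < r0" "\<rho> < r0" using r0 by (auto simp: \<rho>_def field_simps intro!: add_pos_nonneg)
  define Y where "Y x = X (clamp_coords \<rho> e x)" for x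
  have clamp_r0: "coord_dist I (clamp_coords \<rho> e x) e < r0" for x
    using clamp_coords_near[of \<rho> I e x] \<open>\<rho> > 0\<close> \<rho>(1) by linarith
  have Y_lip: "\<bar>Y x c - Y y c\<bar> \<le> L * coord_dist I x y" if "c \<in> I" for x y c
  proof -
    have "\<bar>Y x c - Y y c\<bar> \<le> L * coord_dist I (clamp_coords \<rho> e x) (clamp_coords \<rho> e y)"
      unfolding Y_def by (intro L in_P clamp_r0 that)
    also have "\<dots> \<le> L * coord_dist I x y"
      using \<open>L \<ge> 0\<close> by (intro mult_left_mono coord_dist_clamp)
    finally show ?thesis .
  qed
  have Y_eq: "Y x c = X x c" if "coord_dist I x e \<le> \<rho>" "c \<in> I" for x c
  proof -
    have "x c' = clamp_coords \<rho> e x c'" if "c' \<in> I" for c'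
      using coord_le_coord_dist[OF fin that, of x e] \<open>coord_dist I x e \<le> \<rho>\<close>
      by (auto simp: clamp_coords_def max_def min_def abs_le_iff)
    then have "coord_dist I (clamp_coords \<rho> e x) x = 0"
      by (simp add: coord_dist_def L2_set_def)
    then show ?thesis
      using L[OF in_P[OF clamp_r0] in_P, of x c x] that \<rho>(2) by (simp add: Y_def)
  qed
  have "\<exists>\<delta>>0. \<forall>a\<in>D. coord_dist I a e < \<delta> \<longrightarrow>
        (\<exists>x. solution_on I D X {0..} x \<and> (\<forall>c\<in>I. x 0 c = a c)) \<and>
        (\<forall>T x. solution_on I D X {0..T} x \<and> (\<forall>c\<in>I. x 0 c = a c) \<longrightarrow>
           (\<forall>t\<in>{0..T}. coord_dist I (x t) e < \<epsilon>))" if "\<epsilon> > 0" for \<epsilon>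
  proof -
    define \<epsilon>' where "\<epsilon>' = min \<epsilon> \<rho>"
    have \<epsilon>': "\<epsilon>' > 0" "\<epsilon>' \<le> \<epsilon>" "\<epsilon>' \<le> \<rho>" using \<open>\<epsilon> > 0\<close> \<open>\<rho> > 0\<close> by (auto simp: \<epsilon>'_def)
    define m where "m = H e + \<kappa> * \<epsilon>'\<^sup>2"
    have "H e < m" using \<epsilon>'(1) \<open>\<kappa> > 0\<close> by (simp add: m_def)
    then have "eventually (\<lambda>x. H x < m) (nbhd I e)" by (rule order_tendstoD(2)[OF contH])
    then obtain \<delta>0 where \<delta>0: "\<delta>0 > 0" "\<And>x. coord_dist I x e < \<delta>0 \<Longrightarrow> H x < m"
      unfolding eventually_nbhd by blast
    define \<delta> where "\<delta> = min \<delta>0 \<epsilon>'"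
    have "\<delta> > 0" using \<delta>0(1) \<epsilon>'(1) by (simp add: \<delta>_def)
    have stays: "coord_dist I (x t) e < \<epsilon>'"
      if start: "coord_dist I (x 0) e < \<delta>" and t: "t \<in> {0..T}"
        and deriv: "\<And>t c. t \<in> {0..T} \<Longrightarrow> c \<in> I \<Longrightarrow> ((\<lambda>s. x s c) has_real_derivative V t c) (at t within {0..T})"
        and V: "\<And>t c. t \<in> {0..T} \<Longrightarrow> c \<in> I \<Longrightarrow> coord_dist I (x t) e \<le> \<epsilon>' \<Longrightarrow> V t c = X (x t) c"
      for x t T V
    proof (rule energy_barrier[of T I x e \<epsilon>' H m, OF _ _ _ _ _ _ t])
      show "0 \<le> T" using t by simp
      show "continuous_on {0..T} (\<lambda>s. x s c)" if "c \<in> I" for c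
        by (rule DERIV_continuous_on[OF deriv[OF _ that]])
      show "coord_dist I (x 0) e < \<epsilon>'" "H (x 0) < m"
        using start \<delta>0(2) by (auto simp: \<delta>_def)
      show "m \<le> H z" if "coord_dist I z e = \<epsilon>'" for z
        using minr[of z] that \<epsilon>'(3) \<rho>(2) by (simp add: m_def)
      show "((\<lambda>s. H (x s)) has_real_derivative 0) (at u within {0..T})"
        if "u \<in> {0..T}" "coord_dist I (x u) e \<le> \<epsilon>'" for u
      proof (rule cons)
        show "coord_dist I (x u) e < r0" using that(2) \<epsilon>'(3) \<rho>(2) by linarith
        fix c assume "c \<in> I"
        then show "((\<lambda>s. x s c) has_real_derivative X (x u) c) (at u within {0..T})"
          using deriv[OF that(1)] V[OF that(1) _ that(2)] by simp
      qed
    qed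
    show ?thesis
    proof (intro exI[of _ \<delta>] conjI ballI impI allI)
      show "\<delta> > 0" by fact
      fix a assume a: "coord_dist I a e < \<delta>"
      obtain x where x0: "\<forall>c\<in>I. x 0 c = a c"
        and x: "\<forall>t\<ge>0. \<forall>c\<in>I. ((\<lambda>s. x s c) has_real_derivative Y (x t) c) (at t within {0..})"
        using lipschitz_global_solution[where Y = Y and a = a, OF fin \<open>L \<ge> 0\<close> Y_lip] by blast
      have "coord_dist I (x 0) e = coord_dist I a e" using x0 by (intro coord_dist_cong) auto
      then have near: "coord_dist I (x t) e < \<epsilon>'" if "0 \<le> t" for t
      proof (intro stays[of x t t "\<lambda>t. Y (x t)"])
        fix u c assume "u \<in> {0..t}" "c \<in> I"
        then show "((\<lambda>s. x s c) has_real_derivative Y (x u) c) (at u within {0..t})"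
          using x by (intro DERIV_subset[of _ _ _ "{0..}" "{0..t}"]) auto
      qed (use a that Y_eq \<epsilon>'(3) in auto)
      have "solution_on I D X {0..} x"
        unfolding solution_on_def
      proof (intro ballI conjI)
        fix t :: real assume "t \<in> {0..}"
        then have n: "coord_dist I (x t) e < \<epsilon>'" by (intro near) simp
        then show "x t \<in> D" using \<epsilon>'(3) \<rho>(2) by (intro in_D) linarith
        fix c assume "c \<in> I"
        then show "((\<lambda>s. x s c) has_real_derivative X (x t) c) (at t within {0..})"
          using x[rule_format, of t c] \<open>t \<in> {0..}\<close> Y_eq[of "x t" c] n \<epsilon>'(3) by simp
      qed
      then show "\<exists>x. solution_on I D X {0..} x \<and> (\<forall>c\<in>I. x 0 c = a c)" using x0 by blast
    next
      fix a T x t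
      assume a: "coord_dist I a e < \<delta>" and x: "solution_on I D X {0..T} x \<and> (\<forall>c\<in>I. x 0 c = a c)"
        and t: "t \<in> {0..T}"
      have "coord_dist I (x 0) e = coord_dist I a e" using x by (intro coord_dist_cong) auto
      then have "coord_dist I (x t) e < \<epsilon>'"
        using a t x by (intro stays[of x t T "\<lambda>t. X (x t)"]) (auto simp: solution_on_def)
      then show "coord_dist I (x t) e < \<epsilon>" using \<epsilon>'(2) by linarith
    qed
  qed
  then show ?thesis
    using equilibrium eventually_nbhd_self[OF dom]
    unfolding lyapunov_stable_def is_equilibrium_def by blast
qed

section \<open>Sums over a regular polygon\<close>

lemma sum_pairs_symmetric:
  fixes F :: "nat \<Rightarrow> nat \<Rightarrow> real"
  assumes sym: "\<And>i j. F i j = F j i" and diag: "\<And>i. F i i = 0"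
  shows "(\<Sum>i=1..n. \<Sum>j=1..n. F i j) = 2 * (\<Sum>j=1..n. \<Sum>i=1..<j. F i j)"
proof (induction n)
  case (Suc n)
  have "(\<Sum>j=1..n. F (Suc n) j) = (\<Sum>i=1..n. F i (Suc n))"
    by (intro sum.cong refl sym)
  moreover have "{1..<Suc n} = {1..n}" by auto
  ultimately show ?case using Suc.IH by (simp add: sum.distrib diag)
qed simp

lemma periodic_mod:
  fixes f :: "int \<Rightarrow> 'a"
  assumes "\<And>m. f (m + n) = f m"
  shows "f (m mod n) = f m"
proof -
  have up: "f (m + int k * n) = f m" for m k
  proof (induction k)
    case (Suc k)
    have "f (m + int (Suc k) * n) = f ((m + int k * n) + n)" by (simp add: algebra_simps)
    then show ?case using Suc assms by simp
  qed simp
  have "f (m + k * n) = f m" for m k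
  proof (cases "0 \<le> k")
    case True
    then show ?thesis using up[of m "nat k"] by simp
  next
    case False
    then show ?thesis using up[of "m + k * n" "nat (- k)"] by simp
  qed
  from this[of "m mod n" "m div n"] show ?thesis by (simp add: mod_mult_div_eq mult.commute)
qed

lemma sum_period_shift:
  fixes f :: "int \<Rightarrow> real"
  assumes per: "\<And>m. f (m + n) = f m" and "0 < n"
  shows "(\<Sum>m\<in>{0..<n}. f (m + k)) = (\<Sum>m\<in>{0..<n}. f m)"
proof (rule sum.reindex_bij_witness[of _ "\<lambda>m. (m - k) mod n" "\<lambda>m. (m + k) mod n"])
  fix m assume "m \<in> {0..<n}"
  then show "((m + k) mod n - k) mod n = m" "((m - k) mod n + k) mod n = m"
    by (auto simp: mod_simps)
  show "f ((m + k) mod n) = f (m + k)" by (rule periodic_mod[of f n, OF per])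
qed (use \<open>0 < n\<close> in auto)

lemma sum_period_minus:
  fixes f :: "int \<Rightarrow> real"
  assumes per: "\<And>m. f (m + n) = f m" and "0 < n"
  shows "(\<Sum>m\<in>{0..<n}. f (- m)) = (\<Sum>m\<in>{0..<n}. f m)"
proof (rule sum.reindex_bij_witness[of _ "\<lambda>m. (- m) mod n" "\<lambda>m. (- m) mod n"])
  fix m assume "m \<in> {0..<n}"
  then show "(- ((- m) mod n)) mod n = m" "(- ((- m) mod n)) mod n = m" by (auto simp: mod_simps)
  show "f ((- m) mod n) = f (- m)" by (rule periodic_mod[of f n, OF per])
qed (use \<open>0 < n\<close> in auto)

text \<open>For odd \<open>n\<close>, multiplication by \<open>(n + 1) / 2\<close> inverts the doubling of residues modulo \<open>n\<close>.\<close>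

lemma sum_period_double:
  fixes f :: "int \<Rightarrow> real"
  assumes per: "\<And>m. f (m + n) = f m" and "0 < n" and "odd n"
  shows "(\<Sum>m\<in>{0..<n}. f (2 * m)) = (\<Sum>m\<in>{0..<n}. f m)"
proof -
  obtain q where q: "n = 2 * q + 1" using \<open>odd n\<close> by (auto elim: oddE)
  have inv: "(2 * ((q + 1) * m)) mod n = m" if "m \<in> {0..<n}" for m
  proof -
    have "2 * ((q + 1) * m) = m + m * n" by (simp add: q algebra_simps)
    then show ?thesis using that by simp
  qed
  show ?thesis
  proof (rule sum.reindex_bij_witness[of _ "\<lambda>m. ((q + 1) * m) mod n" "\<lambda>m. (2 * m) mod n"])
    fix m assume m: "m \<in> {0..<n}"
    show "((q + 1) * ((2 * m) mod n)) mod n = m"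
      unfolding mod_mult_right_eq mult.left_commute[of "q + 1" 2 m] by (rule inv[OF m])
    show "(2 * (((q + 1) * m) mod n)) mod n = m"
      unfolding mod_mult_right_eq by (rule inv[OF m])
    show "f ((2 * m) mod n) = f (2 * m)" by (rule periodic_mod[of f n, OF per])
  qed (use \<open>0 < n\<close> in auto)
qed

lemma sum_nat_period:
  fixes f :: "int \<Rightarrow> real"
  assumes per: "\<And>m. f (m + int n) = f m" and "0 < n"
  shows "(\<Sum>i=1..n. f (int i)) = (\<Sum>m\<in>{0..<int n}. f m)"
proof -
  have "(\<Sum>i=1..n. f (int i)) = (\<Sum>m\<in>{0..<int n}. f (m + 1))"
    by (rule sum.reindex_bij_witness[of _ "\<lambda>m. nat (m + 1)" "\<lambda>i. int i - 1"]) auto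
  also have "\<dots> = (\<Sum>m\<in>{0..<int n}. f m)"
    using assms by (intro sum_period_shift) auto
  finally show ?thesis .
qed

text \<open>The difference in longitude between two bodies \<open>k\<close> places apart.\<close>

definition polygon_angle :: "nat \<Rightarrow> int \<Rightarrow> real" where
  "polygon_angle n k = 2 * pi * of_int k / real n"

lemma polygon_angle_period:
  "0 < n \<Longrightarrow> polygon_angle n (k + int n) = polygon_angle n k + 2 * pi"
  by (simp add: polygon_angle_def field_simps)

lemma polygon_angle_minus [simp]: "polygon_angle n (- k) = - polygon_angle n k"
  by (simp add: polygon_angle_def)

lemma polygon_angle_double: "polygon_angle n (2 * k) = 2 * polygon_angle n k"
  by (simp add: polygon_angle_def)

text \<open>Seen from each of its vertices, a regular polygon looks the same.\<close>

lemma sum_polygon_angle: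
  fixes g :: "real \<Rightarrow> real"
  assumes "0 < n" and per: "\<And>x. g (x + 2 * pi) = g x"
  shows "(\<Sum>j=1..n. g (polygon_angle n (int i - int j))) = (\<Sum>k\<in>{0..<int n}. g (polygon_angle n k))"
proof -
  define f where "f m = g (polygon_angle n (int i - m))" for m
  have f: "f (m + int n) = f m" for m
    using per[of "polygon_angle n (int i - m - int n)"] polygon_angle_period[OF \<open>0 < n\<close>, of "int i - m - int n"]
    by (simp add: f_def algebra_simps)
  have g: "g (polygon_angle n (k + int n)) = g (polygon_angle n k)" for k
    by (simp add: per polygon_angle_period[OF \<open>0 < n\<close>])
  have "(\<Sum>j=1..n. g (polygon_angle n (int i - int j))) = (\<Sum>m\<in>{0..<int n}. f m)"
    using sum_nat_period[of f n, OF f \<open>0 < n\<close>] by (simp add: f_def)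
  also have "\<dots> = (\<Sum>m\<in>{0..<int n}. f (- m))"
    using \<open>0 < n\<close> by (intro sum_period_minus[symmetric] f) auto
  also have "\<dots> = (\<Sum>m\<in>{0..<int n}. g (polygon_angle n (m + int i)))"
    by (simp add: f_def add.commute)
  also have "\<dots> = (\<Sum>m\<in>{0..<int n}. g (polygon_angle n m))"
    using \<open>0 < n\<close> by (intro sum_period_shift[of "\<lambda>k. g (polygon_angle n k)"] g) auto
  finally show ?thesis .
qed

lemma sum_polygon_angle_odd:
  fixes g :: "real \<Rightarrow> real"
  assumes "0 < n" and per: "\<And>x. g (x + 2 * pi) = g x" and odd: "\<And>x. g (- x) = - g x"
  shows "(\<Sum>j=1..n. g (polygon_angle n (int i - int j))) = 0"
proof -
  have g: "g (polygon_angle n (k + int n)) = g (polygon_angle n k)" for k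
    by (simp add: per polygon_angle_period[OF \<open>0 < n\<close>])
  have "(\<Sum>k\<in>{0..<int n}. g (polygon_angle n (- k))) = (\<Sum>k\<in>{0..<int n}. g (polygon_angle n k))"
    using \<open>0 < n\<close> by (intro sum_period_minus g) auto
  then show ?thesis
    unfolding sum_polygon_angle[of n g, OF \<open>0 < n\<close> per] by (simp add: odd sum_negf)
qed

lemma sum_polygon_angle_even:
  fixes g :: "real \<Rightarrow> real"
  assumes n: "n = 2 * p + 1" and per: "\<And>x. g (x + 2 * pi) = g x" and even: "\<And>x. g (- x) = g x" and "g 0 = 0"
  shows "(\<Sum>j=1..n. g (polygon_angle n (int i - int j))) = 2 * (\<Sum>j=1..p. g (polygon_angle n (int j)))"
proof -
  have "0 < n" using n by simp
  have "{0..<int n} = {0} \<union> {1..int p} \<union> {int p+1..2 * int p}" using n by auto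
  then have "(\<Sum>k\<in>{0..<int n}. g (polygon_angle n k)) = g (polygon_angle n 0)
      + (\<Sum>k\<in>{1..int p}. g (polygon_angle n k)) + (\<Sum>k\<in>{int p+1..2 * int p}. g (polygon_angle n k))"
    by (simp only:) (subst sum.union_disjoint; auto)+
  moreover have "(\<Sum>k\<in>{int p+1..2 * int p}. g (polygon_angle n k)) = (\<Sum>k\<in>{1..int p}. g (polygon_angle n k))"
  proof (rule sum.reindex_bij_witness[of _ "\<lambda>k. int n - k" "\<lambda>k. int n - k"])
    fix k
    have "g (polygon_angle n (int n - k)) = g (polygon_angle n (- k) + 2 * pi)"
      using polygon_angle_period[OF \<open>0 < n\<close>, of "- k"] by (simp add: add.commute)
    also have "\<dots> = g (polygon_angle n (- k))" by (rule per)
    also have "\<dots> = g (polygon_angle n k)" by (simp add: even)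
    finally show "g (polygon_angle n (int n - k)) = g (polygon_angle n k)" .
  qed (use n in auto)
  moreover have "(\<Sum>k\<in>{1..int p}. g (polygon_angle n k)) = (\<Sum>j=1..p. g (polygon_angle n (int j)))"
    by (rule sum.reindex_bij_witness[of _ int nat]) auto
  ultimately show ?thesis
    unfolding sum_polygon_angle[of n g, OF \<open>0 < n\<close> per] using \<open>g 0 = 0\<close> by (simp add: polygon_angle_def)
qed

lemma polygon_angle_sin_nonzero:
  assumes "odd n" "\<not> int n dvd k"
  shows "sin (polygon_angle n k) \<noteq> 0"
proof
  have "n > 0" using \<open>odd n\<close> by (cases n) auto
  assume "sin (polygon_angle n k) = 0"
  then obtain m :: int where "2 * pi * of_int k / real n = of_int m * pi"
    by (auto simp: sin_zero_iff_int2 polygon_angle_def)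
  then have "real_of_int (2 * k) = real_of_int (m * int n)"
    using \<open>n > 0\<close> by (simp add: field_simps)
  then have "2 * k = m * int n" by (simp only: of_int_eq_iff)
  then have "int n dvd 2 * k" by simp
  moreover have "coprime (int n) 2" using \<open>odd n\<close> by simp
  ultimately show False using assms(2) coprime_dvd_mult_right_iff by blast
qed

lemma polygon_angle_cos_nonzero:
  assumes "odd n"
  shows "cos (polygon_angle n k) \<noteq> 0"
proof
  have "n > 0" using \<open>odd n\<close> by (cases n) auto
  assume "cos (polygon_angle n k) = 0"
  then obtain m :: int where "odd m" "2 * pi * of_int k / real n = of_int m * (pi / 2)"
    by (auto simp: cos_zero_iff_int polygon_angle_def)
  then have "real_of_int (4 * k) = real_of_int (m * int n)"
    using \<open>n > 0\<close> by (simp add: field_simps)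
  then have "4 * k = m * int n" by (simp only: of_int_eq_iff)
  then have "even (m * int n)" by (metis dvd_mult2 even_numeral)
  then show False using \<open>odd m\<close> \<open>odd n\<close> by simp
qed

text \<open>
  On the equator the potential of a pair at the difference \<open>x\<close> in longitude is \<open>cos x / \<bar>sin x\<bar>\<close>,
  and half of its second derivative is this weight.
\<close>

definition hessian_weight :: "real \<Rightarrow> real" where
  "hessian_weight x = cos x / \<bar>sin x\<bar> ^ 3"

text \<open>
  The identity \<open>cos 2x = cos\<^sup>4 x - sin\<^sup>4 x\<close> makes the weight at \<open>2x\<close>, multiplied by four, smaller
  than half of the absolute weight at \<open>x\<close>. The factor four is what the doubling of a shift costs
  in the sums of squared differences.
\<close>

lemma hessian_weight_double:
  assumes "\<eta> \<le> \<bar>sin x\<bar> / 2" "\<eta> \<le> \<bar>cos x\<bar> / 2" "sin x \<noteq> 0" "cos x \<noteq> 0"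
  shows "max 0 (4 * hessian_weight (2 * x)) \<le> \<bar>hessian_weight x\<bar> / 2 - \<eta>"
proof -
  define s c where "s = \<bar>sin x\<bar>" and "c = \<bar>cos x\<bar>"
  have s: "0 < s" "s \<le> 1" and c: "0 < c" "c \<le> 1" using assms by (auto simp: s_def c_def)
  have pyth: "s\<^sup>2 + c\<^sup>2 = 1" by (simp add: s_def c_def)
  have "cos (2 * x) = c\<^sup>2 - s\<^sup>2" by (simp add: s_def c_def cos_double)
  also have "\<dots> = (c\<^sup>2 - s\<^sup>2) * (s\<^sup>2 + c\<^sup>2)" using pyth by simp
  also have "\<dots> = c ^ 4 - s ^ 4" by algebra
  finally have cos2: "cos (2 * x) = c ^ 4 - s ^ 4" .
  have "\<bar>sin (2 * x)\<bar> = 2 * s * c" by (simp add: sin_double s_def c_def abs_mult)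
  moreover have "4 * (u / (2 * s * c) ^ 3) = u / (2 * s ^ 3 * c ^ 3)" for u
    by (simp add: power_mult_distrib)
  ultimately have "4 * hessian_weight (2 * x) = (c ^ 4 - s ^ 4) / (2 * s ^ 3 * c ^ 3)"
    unfolding hessian_weight_def cos2 by (simp only:)
  also have "\<dots> = c / (2 * s ^ 3) - s / (2 * c ^ 3)"
    using s c by (simp add: field_simps power4_eq_xxxx power3_eq_cube)
  finally have *: "4 * hessian_weight (2 * x) = c / (2 * s ^ 3) - s / (2 * c ^ 3)" .
  have "s \<le> s / c ^ 3" "c \<le> c / s ^ 3"
    using s c by (simp_all add: le_divide_eq mult_left_le power_le_one)
  moreover have "s / (2 * c ^ 3) = (s / c ^ 3) / 2" "c / (2 * s ^ 3) = (c / s ^ 3) / 2" by simp_all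
  moreover have "\<bar>hessian_weight x\<bar> = c / s ^ 3"
    by (simp add: hessian_weight_def s_def c_def abs_divide power_abs)
  ultimately show ?thesis using * assms(1,2) unfolding s_def[symmetric] c_def[symmetric]
    by linarith
qed

lemma hessian_weight_period: "hessian_weight (x + 2 * pi) = hessian_weight x"
  by (simp add: hessian_weight_def)

text \<open>
  Let \<open>D k\<close> be the sum of the squared differences over the pairs at distance \<open>k\<close> along the
  polygon, and \<open>a k\<close> its product with the weight. Since \<open>D (2 k) \<le> 4 D k\<close>, the positive part of
  \<open>a (2 k)\<close> falls short of half of \<open>\<bar>a k\<bar>\<close> by at least a fixed multiple of \<open>D k\<close>. For odd \<open>n\<close>, doubling permutes the residues, so summing
  over \<open>k\<close> shows that the positive terms are outweighed by the negative ones.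
\<close>

lemma polygon_hessian_negative:
  assumes "odd n"
  shows "\<exists>\<kappa>>0. \<forall>\<xi> :: nat \<Rightarrow> real.
    (\<Sum>i=1..n. \<Sum>j=1..n. hessian_weight (polygon_angle n (int i - int j)) * (\<xi> i - \<xi> j)\<^sup>2)
      \<le> - \<kappa> * (\<Sum>i=1..n. \<Sum>j=1..n. (\<xi> i - \<xi> j)\<^sup>2)"
proof -
  have "n > 0" using \<open>odd n\<close> by (cases n) auto
  define Z where "Z = {0..<int n}"
  have "finite Z" by (simp add: Z_def)
  \<comment> \<open>A common lower bound for the slack in the doubling inequality. The element \<open>1\<close> of \<open>M\<close> makes
    the minimum meaningful for \<open>n = 1\<close>.\<close>
  define M where "M = insert 1 ((\<lambda>k. min (\<bar>sin (polygon_angle n k)\<bar>) (\<bar>cos (polygon_angle n k)\<bar>)) ` (Z - {0}))"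
  define \<eta> where "\<eta> = Min M / 2"
  have nz: "sin (polygon_angle n k) \<noteq> 0" if "k \<in> Z - {0}" for k
    using that polygon_angle_sin_nonzero[OF \<open>odd n\<close>, of k] zdvd_not_zless[of k "int n"] by (auto simp: Z_def)
  have "finite M" "M \<noteq> {}" using \<open>finite Z\<close> by (auto simp: M_def)
  moreover have "\<forall>m\<in>M. 0 < m"
    using nz polygon_angle_cos_nonzero[OF \<open>odd n\<close>] by (auto simp: M_def)
  ultimately have "\<eta> > 0" by (auto simp: \<eta>_def)
  have \<eta>: "\<eta> \<le> \<bar>sin (polygon_angle n k)\<bar> / 2" "\<eta> \<le> \<bar>cos (polygon_angle n k)\<bar> / 2" if "k \<in> Z - {0}" for k
  proof -
    have "Min M \<le> min (\<bar>sin (polygon_angle n k)\<bar>) (\<bar>cos (polygon_angle n k)\<bar>)"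
      using \<open>finite M\<close> that by (intro Min_le) (auto simp: M_def)
    then show "\<eta> \<le> \<bar>sin (polygon_angle n k)\<bar> / 2" "\<eta> \<le> \<bar>cos (polygon_angle n k)\<bar> / 2"
      by (auto simp: \<eta>_def)
  qed
  have "(\<Sum>i=1..n. \<Sum>j=1..n. hessian_weight (polygon_angle n (int i - int j)) * (\<xi> i - \<xi> j)\<^sup>2)
      \<le> - (2 * \<eta>) * (\<Sum>i=1..n. \<Sum>j=1..n. (\<xi> i - \<xi> j)\<^sup>2)" for \<xi> :: "nat \<Rightarrow> real"
  proof -
    \<comment> \<open>The periodic extension of \<open>\<xi>\<close> to the integers.\<close>
    define \<zeta> where "\<zeta> m = \<xi> (nat ((m - 1) mod int n) + 1)" for m
    have \<zeta>_per: "\<zeta> (m + int n) = \<zeta> m" for m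
    proof -
      have "(m + int n - 1) mod int n = (m - 1 + int n) mod int n" by (simp add: algebra_simps)
      then show ?thesis by (simp add: \<zeta>_def)
    qed
    have \<zeta>_per': "\<zeta> (m + (k + int n)) = \<zeta> (m + k)" for m k
      using \<zeta>_per[of "m + k"] by (simp add: add.assoc)
    have \<zeta>: "\<zeta> (int i) = \<xi> i" if "i \<in> {1..n}" for i
      using that by (simp add: \<zeta>_def nat_diff_distrib)
    define D where "D k = (\<Sum>i\<in>Z. (\<zeta> (i + k) - \<zeta> i)\<^sup>2)" for k
    have D0: "D 0 = 0" by (simp add: D_def)
    have D_nonneg: "0 \<le> D k" for k by (simp add: D_def sum_nonneg)
    have D_per: "D (k + int n) = D k" for k
      by (simp add: D_def \<zeta>_per')
    have D_double: "D (2 * k) \<le> 4 * D k" for k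
    proof -
      have "D (2 * k) \<le> (\<Sum>i\<in>Z. 2 * (\<zeta> (i + k + k) - \<zeta> (i + k))\<^sup>2 + 2 * (\<zeta> (i + k) - \<zeta> i)\<^sup>2)"
        unfolding D_def
      proof (rule sum_mono)
        fix i
        have "(x + y)\<^sup>2 \<le> 2 * x\<^sup>2 + 2 * y\<^sup>2" for x y :: real
          using zero_le_power2[of "x - y"] by (simp add: power2_eq_square algebra_simps)
        from this[of "\<zeta> (i + k + k) - \<zeta> (i + k)" "\<zeta> (i + k) - \<zeta> i"]
        show "(\<zeta> (i + 2 * k) - \<zeta> i)\<^sup>2 \<le> 2 * (\<zeta> (i + k + k) - \<zeta> (i + k))\<^sup>2 + 2 * (\<zeta> (i + k) - \<zeta> i)\<^sup>2"
          by (simp add: add.assoc)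
      qed
      also have "\<dots> = 2 * (\<Sum>i\<in>Z. (\<zeta> (i + k + k) - \<zeta> (i + k))\<^sup>2) + 2 * D k"
        by (simp add: sum.distrib sum_distrib_left D_def)
      also have "(\<Sum>i\<in>Z. (\<zeta> (i + k + k) - \<zeta> (i + k))\<^sup>2) = D k"
        unfolding D_def Z_def using \<open>n > 0\<close> \<zeta>_per \<zeta>_per'
        by (intro sum_period_shift[of "\<lambda>i. (\<zeta> (i + k) - \<zeta> i)\<^sup>2"]) (auto simp: algebra_simps)
      finally show ?thesis by simp
    qed
    have shift: "(\<Sum>i=1..n. \<Sum>j=1..n. g (polygon_angle n (int i - int j)) * (\<xi> i - \<xi> j)\<^sup>2)
        = (\<Sum>k\<in>Z. g (polygon_angle n k) * D k)"
      if per: "\<And>x. g (x + 2 * pi) = g x" for g :: "real \<Rightarrow> real"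
    proof -
      have g: "g (polygon_angle n (k + int n)) = g (polygon_angle n k)" for k
        by (simp add: per polygon_angle_period[OF \<open>0 < n\<close>])
      have "(\<Sum>i=1..n. \<Sum>j=1..n. g (polygon_angle n (int i - int j)) * (\<xi> i - \<xi> j)\<^sup>2)
          = (\<Sum>j=1..n. \<Sum>i=1..n. g (polygon_angle n (int i - int j)) * (\<zeta> (int i) - \<zeta> (int j))\<^sup>2)"
        by (subst sum.swap) (intro sum.cong refl, simp add: \<zeta>)
      also have "\<dots> = (\<Sum>j=1..n. \<Sum>k\<in>Z. g (polygon_angle n k) * (\<zeta> (int j + k) - \<zeta> (int j))\<^sup>2)"
      proof (rule sum.cong[OF refl])
        fix j
        have "(\<Sum>i=1..n. g (polygon_angle n (int i - int j)) * (\<zeta> (int i) - \<zeta> (int j))\<^sup>2)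
            = (\<Sum>m\<in>Z. g (polygon_angle n (m - int j)) * (\<zeta> m - \<zeta> (int j))\<^sup>2)"
          unfolding Z_def using g[of "m - int j" for m] \<zeta>_per \<open>n > 0\<close>
          by (intro sum_nat_period[of "\<lambda>m. g (polygon_angle n (m - int j)) * (\<zeta> m - \<zeta> (int j))\<^sup>2"])
             (auto simp: algebra_simps)
        also have "\<dots> = (\<Sum>m\<in>Z. g (polygon_angle n (m + int j - int j)) * (\<zeta> (m + int j) - \<zeta> (int j))\<^sup>2)"
          unfolding Z_def using g[of "m - int j" for m] \<zeta>_per \<open>n > 0\<close>
          by (intro sum_period_shift[symmetric, of "\<lambda>m. g (polygon_angle n (m - int j)) * (\<zeta> m - \<zeta> (int j))\<^sup>2"])
             (auto simp: algebra_simps)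
        finally show "(\<Sum>i=1..n. g (polygon_angle n (int i - int j)) * (\<zeta> (int i) - \<zeta> (int j))\<^sup>2)
            = (\<Sum>k\<in>Z. g (polygon_angle n k) * (\<zeta> (int j + k) - \<zeta> (int j))\<^sup>2)"
          by (simp add: add.commute)
      qed
      also have "\<dots> = (\<Sum>j\<in>Z. \<Sum>k\<in>Z. g (polygon_angle n k) * (\<zeta> (j + k) - \<zeta> j)\<^sup>2)"
      proof -
        have "\<zeta> (m + int n + k) = \<zeta> (m + k)" for m k
          using \<zeta>_per[of "m + k"] by (simp add: algebra_simps)
        then show ?thesis unfolding Z_def using \<zeta>_per \<open>n > 0\<close>
          by (intro sum_nat_period[of "\<lambda>j. \<Sum>k\<in>{0..<int n}. g (polygon_angle n k) * (\<zeta> (j + k) - \<zeta> j)\<^sup>2"]) auto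
      qed
      also have "\<dots> = (\<Sum>k\<in>Z. g (polygon_angle n k) * D k)"
        by (subst sum.swap) (simp add: D_def sum_distrib_left)
      finally show ?thesis .
    qed
    define a where "a k = hessian_weight (polygon_angle n k) * D k" for k
    have pos_double: "max 0 (a (2 * k)) \<le> \<bar>a k\<bar> / 2 - \<eta> * D k" if "k \<in> Z" for k
    proof (cases "k = 0")
      case True
      then show ?thesis by (simp add: a_def D0)
    next
      case False
      let ?x = "polygon_angle n k"
      have w: "max 0 (4 * hessian_weight (2 * ?x)) \<le> \<bar>hessian_weight ?x\<bar> / 2 - \<eta>"
        using False that \<eta> nz polygon_angle_cos_nonzero[OF \<open>odd n\<close>] by (intro hessian_weight_double) auto
      have "max 0 (a (2 * k)) \<le> max 0 (hessian_weight (2 * ?x)) * D (2 * k)"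
        unfolding a_def polygon_angle_double
        using D_nonneg[of "2 * k"] by (intro max.boundedI mult_right_mono mult_nonneg_nonneg) auto
      also have "\<dots> \<le> max 0 (hessian_weight (2 * ?x)) * (4 * D k)"
        by (intro mult_left_mono D_double) auto
      also have "\<dots> = max 0 (4 * hessian_weight (2 * ?x)) * D k" by (auto simp: max_def)
      also have "\<dots> \<le> (\<bar>hessian_weight ?x\<bar> / 2 - \<eta>) * D k"
        using w D_nonneg by (rule mult_right_mono)
      also have "\<dots> = \<bar>a k\<bar> / 2 - \<eta> * D k"
        using D_nonneg[of k] by (simp add: a_def abs_mult algebra_simps)
      finally show ?thesis .
    qed
    \<comment> \<open>The sum of the positive parts is on both ends of the following chain and cancels.\<close>
    have "(\<Sum>k\<in>Z. max 0 (a k)) = (\<Sum>k\<in>Z. max 0 (a (2 * k)))"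
      unfolding Z_def using \<open>n > 0\<close> \<open>odd n\<close>
      by (intro sum_period_double[symmetric, of "\<lambda>k. max 0 (a k)"])
         (auto simp: a_def D_per polygon_angle_period hessian_weight_period)
    also have "\<dots> \<le> (\<Sum>k\<in>Z. (max 0 (a k) - a k / 2) - \<eta> * D k)"
    proof (rule sum_mono)
      fix k assume "k \<in> Z"
      moreover have "\<bar>a k\<bar> / 2 = max 0 (a k) - a k / 2" by (auto simp: max_def)
      ultimately show "max 0 (a (2 * k)) \<le> max 0 (a k) - a k / 2 - \<eta> * D k" using pos_double by metis
    qed
    also have "\<dots> = (\<Sum>k\<in>Z. max 0 (a k)) - (\<Sum>k\<in>Z. a k) / 2 - \<eta> * (\<Sum>k\<in>Z. D k)"
      by (simp add: sum_subtractf sum_divide_distrib sum_distrib_left)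
    finally have "(\<Sum>k\<in>Z. a k) \<le> - (2 * \<eta>) * (\<Sum>k\<in>Z. D k)" by simp
    then show ?thesis
      using shift[of hessian_weight] shift[of "\<lambda>_. 1"] by (simp add: a_def hessian_weight_period)
  qed
  then show ?thesis using \<open>\<eta> > 0\<close> by (intro exI[of _ "2 * \<eta>"]) auto
qed

section \<open>The gradient of the reduced Hamiltonian\<close>

text \<open>
  The momentum conjugate to the longitude of the \<open>i\<close>-th body, a component of the transposed Jacobi
  matrix applied to the reduced momenta and the level \<open>c\<close>. The level \<open>c = 0\<close> gives its linear part,
  which is also its derivative in the direction \<open>x\<close>.
\<close>

definition momentum :: "nat \<Rightarrow> real \<Rightarrow> (coord \<Rightarrow> real) \<Rightarrow> nat \<Rightarrow> real" where
  "momentum n c x i = (\<Sum>k=2..n+1. jacobi_matrix n k i * (if k = n + 1 then c else x (PV k)))"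

definition cos_dist :: "nat \<Rightarrow> (coord \<Rightarrow> real) \<Rightarrow> nat \<Rightarrow> nat \<Rightarrow> real" where
  "cos_dist n x i j = cos (x (QTheta i)) * cos (x (QTheta j))
     + sin (x (QTheta i)) * sin (x (QTheta j)) * cos (state_angles n x i - state_angles n x j)"

text \<open>
  The derivative at \<open>x\<close> in the direction \<open>y\<close>. The longitudes are linear in the coordinates, so
  those of \<open>y\<close> are the derivatives of those of \<open>x\<close>.
\<close>

definition cos_dist_derivative :: "nat \<Rightarrow> (coord \<Rightarrow> real) \<Rightarrow> (coord \<Rightarrow> real) \<Rightarrow> nat \<Rightarrow> nat \<Rightarrow> real" where
  "cos_dist_derivative n x y i j =
     (let \<psi> = state_angles n x i - state_angles n x j; \<theta> = x (QTheta i); \<theta>' = x (QTheta j)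
      in (cos \<theta> * sin \<theta>' * cos \<psi> - sin \<theta> * cos \<theta>') * y (QTheta i)
         + (sin \<theta> * cos \<theta>' * cos \<psi> - cos \<theta> * sin \<theta>') * y (QTheta j)
         - sin \<theta> * sin \<theta>' * sin \<psi> * (state_angles n y i - state_angles n y j))"

definition cot_arccos_derivative :: "real \<Rightarrow> real" where
  "cot_arccos_derivative c = 1 / sqrt (1 - c\<^sup>2) ^ 3"

definition hamiltonian_derivative :: "nat \<Rightarrow> real \<Rightarrow> (coord \<Rightarrow> real) \<Rightarrow> (coord \<Rightarrow> real) \<Rightarrow> real" where
  "hamiltonian_derivative n c x y =
     (\<Sum>i=1..n. momentum n c x i * momentum n 0 y i / (sin (x (QTheta i)))\<^sup>2
        - (momentum n c x i)\<^sup>2 * cos (x (QTheta i)) / sin (x (QTheta i)) ^ 3 * y (QTheta i))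
     + (\<Sum>i=1..n. x (PTheta i) * y (PTheta i))
     - (\<Sum>j=1..n. \<Sum>i=1..<j. cot_arccos_derivative (cos_dist n x i j) * cos_dist_derivative n x y i j)"

text \<open>
  The condition under which all terms of the Hamiltonian are differentiable: no body at a pole, no
  two bodies coincident or antipodal.
\<close>

definition noncollision :: "nat \<Rightarrow> (coord \<Rightarrow> real) \<Rightarrow> bool" where
  "noncollision n x \<longleftrightarrow> (\<forall>i\<in>{1..n}. sin (x (QTheta i)) \<noteq> 0) \<and>
     (\<forall>j\<in>{1..n}. \<forall>i\<in>{1..<j}. \<bar>cos_dist n x i j\<bar> < 1)"

lemma DERIV_cot_arccos:
  assumes "\<bar>c\<bar> < 1"
  shows "((\<lambda>c. cot (arccos c)) has_real_derivative cot_arccos_derivative c) (at c)"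
proof -
  define r where "r = sqrt (1 - c\<^sup>2)"
  have "c\<^sup>2 < 1" using assms by (simp add: abs_square_less_1)
  then have r: "r > 0" by (simp add: r_def)
  have s: "sin (arccos c) = r" using assms by (simp add: sin_arccos_abs r_def)
  have "((\<lambda>c. cot (arccos c)) has_real_derivative
      - inverse ((sin (arccos c))\<^sup>2) * inverse (- sqrt (1 - c\<^sup>2))) (at c)"
    using assms s r by (intro DERIV_chain2[OF DERIV_cot DERIV_arccos]) auto
  moreover have "- inverse ((sin (arccos c))\<^sup>2) * inverse (- sqrt (1 - c\<^sup>2)) = cot_arccos_derivative c"
    unfolding s r_def[symmetric] cot_arccos_derivative_def
    using r by (simp add: field_simps power2_eq_square power3_eq_cube)
  ultimately show ?thesis by simp
qed

lemma sum_reduced_coords: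
  "(\<Sum>c\<in>reduced_coords n. f c) = (\<Sum>k=2..n. f (QU k)) + (\<Sum>i=1..n. f (QTheta i))
     + (\<Sum>k=2..n. f (PV k)) + (\<Sum>i=1..n. f (PTheta i))"
proof -
  have "(\<Sum>c\<in>reduced_coords n. f c) = (\<Sum>c\<in>QU ` {2..n}. f c) + (\<Sum>c\<in>QTheta ` {1..n}. f c)
      + (\<Sum>c\<in>PV ` {2..n}. f c) + (\<Sum>c\<in>PTheta ` {1..n}. f c)"
    unfolding reduced_coords_def by (subst sum.union_disjoint; auto)+
  then show ?thesis by (simp add: sum.reindex inj_on_def)
qed

lemma finite_reduced_coords [simp]: "finite (reduced_coords n)"
  by (simp add: reduced_coords_def)

lemma state_angles_explicit:
  assumes "i \<in> {1..n}"
  shows "state_angles n x i = (if i = 1 then 0 else x (QU i)) - (\<Sum>k=max 2 i..n. x (QU k) / real k)"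
proof -
  have "(\<Sum>k=max 2 i..n. (if k = n + 1 then 0 else x (QU k)) / real k) = (\<Sum>k=max 2 i..n. x (QU k) / real k)"
    by (intro sum.cong) auto
  then show ?thesis
    using assms by (simp add: state_angles_def jacobi_angles_eq jacobi_angles_explicit_def)
qed

lemma state_angles_linear:
  assumes "i \<in> {1..n}"
  shows "state_angles n (\<lambda>d. a * y d + z d) i = a * state_angles n y i + state_angles n z i"
  using assms
  by (simp add: state_angles_explicit add_divide_distrib sum.distrib sum_distrib_left algebra_simps)

lemma momentum_linear:
  "momentum n 0 (\<lambda>d. a * y d + z d) i = a * momentum n 0 y i + momentum n 0 z i"
  unfolding momentum_def sum_distrib_left sum.distrib[symmetric]
  by (intro sum.cong refl) (simp add: algebra_simps)

lemma reduced_hamiltonian_eq: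
  "reduced_hamiltonian n c x = (\<Sum>i=1..n. (momentum n c x i)\<^sup>2 / (2 * (sin (x (QTheta i)))\<^sup>2))
     + (\<Sum>i=1..n. (x (PTheta i))\<^sup>2 / 2) - (\<Sum>j=1..n. \<Sum>i=1..<j. cot (arccos (cos_dist n x i j)))"
proof -
  define v where "v k = (if k = n + 1 then c else x (PV k))" for k
  define w where "w i = 1 / (sin (x (QTheta i)))\<^sup>2" for i
  have "(\<Sum>k=2..n+1. \<Sum>l=2..n+1. v k * reduced_kinetic_matrix n (\<lambda>i. x (QTheta i)) k l * v l)
      = (\<Sum>k=2..n+1. \<Sum>l=2..n+1. \<Sum>i=1..n. w i * ((jacobi_matrix n k i * v k) * (jacobi_matrix n l i * v l)))"
    unfolding reduced_kinetic_matrix_def w_def[symmetric]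
    by (intro sum.cong refl) (simp add: sum_distrib_left sum_distrib_right mult_ac)
  also have "\<dots> = (\<Sum>k=2..n+1. \<Sum>i=1..n. \<Sum>l=2..n+1. w i * ((jacobi_matrix n k i * v k) * (jacobi_matrix n l i * v l)))"
    by (intro sum.cong refl sum.swap)
  also have "\<dots> = (\<Sum>i=1..n. \<Sum>k=2..n+1. \<Sum>l=2..n+1. w i * ((jacobi_matrix n k i * v k) * (jacobi_matrix n l i * v l)))"
    by (rule sum.swap)
  also have "\<dots> = (\<Sum>i=1..n. w i * (momentum n c x i)\<^sup>2)"
    unfolding momentum_def v_def[symmetric] power2_eq_square sum_product
    by (simp only: sum_distrib_left)
  finally have "1/2 * (\<Sum>k=2..n+1. \<Sum>l=2..n+1. v k * reduced_kinetic_matrix n (\<lambda>i. x (QTheta i)) k l * v l)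
      = (\<Sum>i=1..n. (momentum n c x i)\<^sup>2 / (2 * (sin (x (QTheta i)))\<^sup>2))"
    by (simp add: sum_distrib_left w_def)
  then show ?thesis
    unfolding reduced_hamiltonian_def v_def potential_def sphere_distance_def cos_dist_def Let_def
    by simp
qed

subsection \<open>Derivatives along curves\<close>

lemma momentum_has_derivative:
  assumes "\<And>d. d \<in> reduced_coords n \<Longrightarrow> ((\<lambda>s. x s d) has_real_derivative y d) (at t within T)"
  shows "((\<lambda>s. momentum n c (x s) i) has_real_derivative momentum n 0 y i) (at t within T)"
  unfolding momentum_def
proof (rule DERIV_sum)
  fix k assume k: "k \<in> {2..n+1}"
  show "((\<lambda>s. jacobi_matrix n k i * (if k = n + 1 then c else x s (PV k))) has_real_derivative
      jacobi_matrix n k i * (if k = n + 1 then 0 else y (PV k))) (at t within T)"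
  proof (cases "k = n + 1")
    case False
    then have "PV k \<in> reduced_coords n" using k by (auto simp: reduced_coords_def)
    from DERIV_cmult[OF assms[OF this]] False show ?thesis by simp
  qed simp
qed

lemma state_angles_has_derivative:
  assumes x: "\<And>d. d \<in> reduced_coords n \<Longrightarrow> ((\<lambda>s. x s d) has_real_derivative y d) (at t within T)"
    and i: "i \<in> {1..n}"
  shows "((\<lambda>s. state_angles n (x s) i) has_real_derivative state_angles n y i) (at t within T)"
proof -
  have "((\<lambda>s. \<Sum>k=max 2 i..n. x s (QU k) / real k) has_real_derivative (\<Sum>k=max 2 i..n. y (QU k) / real k))
      (at t within T)"
    by (intro DERIV_sum DERIV_cdivide x) (auto simp: reduced_coords_def)
  moreover have "((\<lambda>s. if i = 1 then 0 else x s (QU i)) has_real_derivative (if i = 1 then 0 else y (QU i)))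
      (at t within T)"
    using i by (cases "i = 1") (auto intro!: x simp: reduced_coords_def)
  ultimately show ?thesis
    unfolding state_angles_explicit[OF i] by (rule DERIV_diff[rotated])
qed

lemma cos_dist_has_derivative:
  assumes x: "\<And>d. d \<in> reduced_coords n \<Longrightarrow> ((\<lambda>s. x s d) has_real_derivative y d) (at t within T)"
    and ij: "i \<in> {1..n}" "j \<in> {1..n}"
  shows "((\<lambda>s. cos_dist n (x s) i j) has_real_derivative cos_dist_derivative n (x t) y i j) (at t within T)"
proof -
  have \<theta>: "((\<lambda>s. x s (QTheta l)) has_real_derivative y (QTheta l)) (at t within T)" if "l \<in> {1..n}" for l
    using that by (intro x) (auto simp: reduced_coords_def)
  note [derivative_intros] = \<theta>[OF ij(1)] \<theta>[OF ij(2)]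
    state_angles_has_derivative[OF x ij(1)] state_angles_has_derivative[OF x ij(2)]
  show ?thesis
    unfolding cos_dist_def cos_dist_derivative_def Let_def
    by (auto intro!: derivative_eq_intros simp: algebra_simps)
qed

text \<open>
  The chain rule along an arbitrary curve serves two purposes: a curve that moves one
  coordinate gives the partial derivatives, and a solution of the equations of motion gives the
  rate of change of the energy.
\<close>

lemma reduced_hamiltonian_has_derivative:
  assumes x: "\<And>d. d \<in> reduced_coords n \<Longrightarrow> ((\<lambda>s. x s d) has_real_derivative y d) (at t within T)"
    and reg: "noncollision n (x t)"
  shows "((\<lambda>s. reduced_hamiltonian n c (x s)) has_real_derivative hamiltonian_derivative n c (x t) y)
    (at t within T)"
  unfolding reduced_hamiltonian_eq hamiltonian_derivative_def
proof (intro DERIV_diff DERIV_add DERIV_sum)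
  fix i assume i: "i \<in> {1..n}"
  have \<theta>: "((\<lambda>s. x s (QTheta i)) has_real_derivative y (QTheta i)) (at t within T)"
    and p: "((\<lambda>s. x s (PTheta i)) has_real_derivative y (PTheta i)) (at t within T)"
    using i by (auto intro!: x simp: reduced_coords_def)
  have s: "sin (x t (QTheta i)) \<noteq> 0" using reg i by (auto simp: noncollision_def)
  note [derivative_intros] = \<theta> p momentum_has_derivative[OF x]
  show "((\<lambda>s. (momentum n c (x s) i)\<^sup>2 / (2 * (sin (x s (QTheta i)))\<^sup>2)) has_real_derivative
      momentum n c (x t) i * momentum n 0 y i / (sin (x t (QTheta i)))\<^sup>2
        - (momentum n c (x t) i)\<^sup>2 * cos (x t (QTheta i)) / sin (x t (QTheta i)) ^ 3 * y (QTheta i))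
      (at t within T)"
    using s by (auto intro!: derivative_eq_intros simp: field_simps power2_eq_square power3_eq_cube)
  show "((\<lambda>s. (x s (PTheta i))\<^sup>2 / 2) has_real_derivative x t (PTheta i) * y (PTheta i)) (at t within T)"
    by (auto intro!: derivative_eq_intros)
next
  fix j i assume ij: "j \<in> {1..n}" "i \<in> {1..<j}"
  then have C: "\<bar>cos_dist n (x t) i j\<bar> < 1" using reg by (auto simp: noncollision_def)
  show "((\<lambda>s. cot (arccos (cos_dist n (x s) i j))) has_real_derivative
      cot_arccos_derivative (cos_dist n (x t) i j) * cos_dist_derivative n (x t) y i j) (at t within T)"
    using ij
    by (intro DERIV_chain2[where g = "\<lambda>s. cos_dist n (x s) i j", OF DERIV_cot_arccos[OF C]]
          cos_dist_has_derivative x) auto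
qed

subsection \<open>The Hamiltonian vector field\<close>

definition unit_vector :: "'c \<Rightarrow> 'c \<Rightarrow> real" where
  "unit_vector c = (\<lambda>d. if d = c then 1 else 0)"

lemma linear_coordinate_expansion:
  fixes F :: "('c \<Rightarrow> real) \<Rightarrow> real"
  assumes "finite I" and lin: "\<And>a y z. F (\<lambda>d. a * y d + z d) = a * F y + F z"
    and cong: "\<And>y z. (\<And>d. d \<in> I \<Longrightarrow> y d = z d) \<Longrightarrow> F y = F z"
  shows "F y = (\<Sum>c\<in>I. y c * F (unit_vector c))"
proof -
  have zero: "F (\<lambda>_. 0) = 0" using lin[of 1 "\<lambda>_. 0" "\<lambda>_. 0"] by simp
  have "F (\<lambda>d. if d \<in> S then y d else 0) = (\<Sum>c\<in>S. y c * F (unit_vector c))" if "finite S" for S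
    using that
  proof (induction S rule: finite_induct)
    case (insert c S)
    have "(\<lambda>d. if d \<in> insert c S then y d else 0)
        = (\<lambda>d. y c * unit_vector c d + (if d \<in> S then y d else 0))"
      using insert.hyps(2) by (auto simp: unit_vector_def fun_eq_iff)
    then show ?case using insert lin by simp
  qed (simp add: zero)
  from this[OF \<open>finite I\<close>] cong[of y "\<lambda>d. if d \<in> I then y d else 0"] show ?thesis by simp
qed

lemma hamiltonian_derivative_linear:
  "hamiltonian_derivative n c x (\<lambda>d. a * y d + z d)
     = a * hamiltonian_derivative n c x y + hamiltonian_derivative n c x z"
proof -
  have pair: "cos_dist_derivative n x (\<lambda>d. a * y d + z d) i j
      = a * cos_dist_derivative n x y i j + cos_dist_derivative n x z i j"
    if "j \<in> {1..n}" "i \<in> {1..<j}" for i j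
  proof -
    have "i \<in> {1..n}" using that by auto
    from state_angles_linear[OF this] state_angles_linear[OF that(1)] show ?thesis
      by (simp add: cos_dist_derivative_def Let_def algebra_simps)
  qed
  have "(\<Sum>j=1..n. \<Sum>i=1..<j. cot_arccos_derivative (cos_dist n x i j)
          * cos_dist_derivative n x (\<lambda>d. a * y d + z d) i j)
      = a * (\<Sum>j=1..n. \<Sum>i=1..<j. cot_arccos_derivative (cos_dist n x i j) * cos_dist_derivative n x y i j)
        + (\<Sum>j=1..n. \<Sum>i=1..<j. cot_arccos_derivative (cos_dist n x i j) * cos_dist_derivative n x z i j)"
    unfolding sum_distrib_left sum.distrib[symmetric]
    by (intro sum.cong refl) (simp only: pair distrib_left mult.left_commute[of a])
  moreover have "(\<Sum>i=1..n. momentum n c x i * momentum n 0 (\<lambda>d. a * y d + z d) i / (sin (x (QTheta i)))\<^sup>2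
        - (momentum n c x i)\<^sup>2 * cos (x (QTheta i)) / sin (x (QTheta i)) ^ 3 * (a * y (QTheta i) + z (QTheta i)))
      = a * (\<Sum>i=1..n. momentum n c x i * momentum n 0 y i / (sin (x (QTheta i)))\<^sup>2
        - (momentum n c x i)\<^sup>2 * cos (x (QTheta i)) / sin (x (QTheta i)) ^ 3 * y (QTheta i))
      + (\<Sum>i=1..n. momentum n c x i * momentum n 0 z i / (sin (x (QTheta i)))\<^sup>2
        - (momentum n c x i)\<^sup>2 * cos (x (QTheta i)) / sin (x (QTheta i)) ^ 3 * z (QTheta i))"
    unfolding sum_distrib_left sum.distrib[symmetric] momentum_linear
    by (intro sum.cong refl) (simp add: add_divide_distrib algebra_simps)
  moreover have "(\<Sum>i=1..n. x (PTheta i) * (a * y (PTheta i) + z (PTheta i)))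
      = a * (\<Sum>i=1..n. x (PTheta i) * y (PTheta i)) + (\<Sum>i=1..n. x (PTheta i) * z (PTheta i))"
    unfolding sum_distrib_left sum.distrib[symmetric]
    by (intro sum.cong refl) (simp add: algebra_simps)
  ultimately show ?thesis
    unfolding hamiltonian_derivative_def by (simp add: algebra_simps)
qed

lemma hamiltonian_derivative_cong:
  assumes "\<And>d. d \<in> reduced_coords n \<Longrightarrow> y d = z d"
  shows "hamiltonian_derivative n c x y = hamiltonian_derivative n c x z"
proof -
  have yz: "k \<in> {2..n} \<Longrightarrow> y (QU k) = z (QU k)" "k \<in> {2..n} \<Longrightarrow> y (PV k) = z (PV k)"
    "i \<in> {1..n} \<Longrightarrow> y (QTheta i) = z (QTheta i)" "i \<in> {1..n} \<Longrightarrow> y (PTheta i) = z (PTheta i)" for i k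
    using assms by (auto simp: reduced_coords_def)
  have mom: "momentum n 0 y i = momentum n 0 z i" for i
    unfolding momentum_def by (intro sum.cong refl) (auto simp: yz)
  have ang: "state_angles n y i = state_angles n z i" if "i \<in> {1..n}" for i
  proof -
    have "(\<Sum>k=max 2 i..n. y (QU k) / real k) = (\<Sum>k=max 2 i..n. z (QU k) / real k)"
      by (intro sum.cong refl) (auto simp: yz)
    then show ?thesis using that by (auto simp: state_angles_explicit yz)
  qed
  have "cos_dist_derivative n x y i j = cos_dist_derivative n x z i j" if "j \<in> {1..n}" "i \<in> {1..<j}" for i j
    using that ang[of i] ang[of j] yz(3)[of i] yz(3)[of j] by (simp add: cos_dist_derivative_def Let_def)
  then show ?thesis
    unfolding hamiltonian_derivative_def by (simp add: mom yz)
qed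

lemma hamiltonian_derivative_expansion:
  "hamiltonian_derivative n c x y
     = (\<Sum>d\<in>reduced_coords n. y d * hamiltonian_derivative n c x (unit_vector d))"
  by (intro linear_coordinate_expansion hamiltonian_derivative_linear hamiltonian_derivative_cong) auto

lemma partial_reduced_hamiltonian:
  assumes "noncollision n x"
  shows "partial (reduced_hamiltonian n c) d x = hamiltonian_derivative n c x (unit_vector d)"
proof -
  have "((\<lambda>s. reduced_hamiltonian n c (x(d := s))) has_real_derivative
      hamiltonian_derivative n c (x(d := x d)) (unit_vector d)) (at (x d))"
  proof (rule reduced_hamiltonian_has_derivative)
    show "((\<lambda>s. (x(d := s)) b) has_real_derivative unit_vector d b) (at (x d))" for b
      by (cases "b = d") (auto simp: unit_vector_def)
  qed (use assms in simp)
  then show ?thesis unfolding partial_def by (simp add: DERIV_imp_deriv)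
qed

text \<open>
  In the sum over the coordinates, each coordinate and its conjugate momentum contribute products
  of the same two partial derivatives with opposite signs.
\<close>

lemma hamiltonian_derivative_field:
  assumes "noncollision n x"
  shows "hamiltonian_derivative n c x (hamiltonian_field (reduced_hamiltonian n c) x) = 0"
  unfolding hamiltonian_derivative_expansion[of n c x "hamiltonian_field _ _"] sum_reduced_coords
  by (simp add: partial_reduced_hamiltonian[OF assms] sum_negf mult.commute)

section \<open>The regular polygon as an equilibrium\<close>

lemma ngon_angle_difference:
  assumes "i \<in> {1..n}" "j \<in> {1..n}"
  shows "state_angles n (ngon_equilibrium n) i - state_angles n (ngon_equilibrium n) j
    = polygon_angle n (int i - int j)"
proof -
  have "state_angles n (ngon_equilibrium n) i = (2 * real i - real n - 1) * pi / real n" if "i \<in> {1..n}" for i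
  proof -
    have "(\<Sum>k=max 2 i..n. ngon_equilibrium n (QU k) / real k) = (\<Sum>k=max 2 i..n. pi / real n)"
      by (intro sum.cong) auto
    also have "\<dots> = (real (n + 1) - real (max 2 i)) * (pi / real n)"
      using that by (cases "i = 1") (auto simp: of_nat_diff max_def not_le)
    finally have "(\<Sum>k=max 2 i..n. ngon_equilibrium n (QU k) / real k)
        = (real (n + 1) - real (max 2 i)) * (pi / real n)" .
    then show ?thesis
      using that unfolding state_angles_explicit[OF that]
      by (cases "i = 1") (auto simp: max_def field_simps)
  qed
  from this[OF assms(1)] this[OF assms(2)] show ?thesis
    using assms by (simp add: polygon_angle_def field_simps)
qed

lemma polygon_angle_sin_pair:
  assumes "odd n" "i \<in> {1..n}" "j \<in> {1..n}" "i \<noteq> j"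
  shows "sin (polygon_angle n (int i - int j)) \<noteq> 0"
proof (rule polygon_angle_sin_nonzero[OF \<open>odd n\<close>])
  have "\<bar>int i - int j\<bar> < int n" "int i - int j \<noteq> 0" using assms by auto
  then show "\<not> int n dvd int i - int j" using dvd_imp_le_int[of "int i - int j" "int n"] by auto
qed

lemma abs_cos_less_one:
  fixes x :: real
  assumes "sin x \<noteq> 0"
  shows "\<bar>cos x\<bar> < 1"
proof -
  have "0 < (sin x)\<^sup>2" using assms by simp
  then have "(cos x)\<^sup>2 < 1" unfolding cos_squared_eq by linarith
  then show ?thesis by (simp add: abs_square_less_1)
qed

lemma ngon_cos_dist:
  assumes "i \<in> {1..n}" "j \<in> {1..n}"
  shows "cos_dist n (ngon_equilibrium n) i j = cos (polygon_angle n (int i - int j))"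
  by (simp add: cos_dist_def ngon_angle_difference[OF assms])

lemma ngon_noncollision:
  assumes "odd n"
  shows "noncollision n (ngon_equilibrium n)"
  unfolding noncollision_def
  using polygon_angle_sin_pair[OF assms]
  by (auto simp: ngon_cos_dist intro!: abs_cos_less_one)

lemma cot_arccos_derivative_cos: "cot_arccos_derivative (cos x) = 1 / \<bar>sin x\<bar> ^ 3"
proof -
  have "1 - (cos x)\<^sup>2 = (sin x)\<^sup>2" by (simp add: sin_squared_eq)
  then show ?thesis by (simp add: cot_arccos_derivative_def)
qed

lemma ngon_momentum:
  assumes "i \<in> {1..n}"
  shows "momentum n (real n * \<alpha>) (ngon_equilibrium n) i = \<alpha>"
  unfolding momentum_def using ngon_momenta[OF assms] .

lemma jacobi_matrix_row_sum:
  assumes "k \<in> {2..n}"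
  shows "(\<Sum>i=1..n. jacobi_matrix n k i) = 0"
  using jacobi_matrix_relative[OF assms, of "\<lambda>_. 1"] assms by simp

lemma momentum_split:
  assumes "n \<ge> 1"
  shows "momentum n c x i = (\<Sum>k=2..n. jacobi_matrix n k i * x (PV k)) + c / real n"
proof -
  have "{2..n+1} = insert (n + 1) {2..n}" using assms by auto
  moreover have "(\<Sum>k=2..n. jacobi_matrix n k i * (if k = n + 1 then c else x (PV k)))
      = (\<Sum>k=2..n. jacobi_matrix n k i * x (PV k))"
    by (intro sum.cong refl) auto
  ultimately show ?thesis by (simp add: momentum_def jacobi_matrix_def)
qed

lemma sum_momentum_zero:
  assumes "n \<ge> 1"
  shows "(\<Sum>i=1..n. momentum n 0 x i) = 0"
proof -
  have "(\<Sum>i=1..n. momentum n 0 x i) = (\<Sum>k=2..n. (\<Sum>i=1..n. jacobi_matrix n k i) * x (PV k))"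
    unfolding momentum_split[OF assms] sum_distrib_right by (simp, rule sum.swap)
  also have "\<dots> = 0" by (intro sum.neutral ballI) (simp only: jacobi_matrix_row_sum mult_zero_left)
  finally show ?thesis .
qed

text \<open>
  For an odd function \<open>g\<close>, each vertex receives opposite contributions from the vertices on its
  two sides, so the coefficient of each \<open>\<xi> i\<close> vanishes.
\<close>

lemma sum_odd_pairs:
  fixes g :: "real \<Rightarrow> real" and \<xi> :: "nat \<Rightarrow> real"
  assumes "0 < n" and per: "\<And>x. g (x + 2 * pi) = g x" and odd: "\<And>x. g (- x) = - g x"
  shows "(\<Sum>j=1..n. \<Sum>i=1..<j. g (polygon_angle n (int i - int j)) * (\<xi> i - \<xi> j)) = 0"
proof -
  let ?g = "\<lambda>i j :: nat. g (polygon_angle n (int i - int j))"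
  have flip: "?g i j = - ?g j i" for i j
    using odd[of "polygon_angle n (int j - int i)"] polygon_angle_minus[of n "int j - int i"] by simp
  have zero: "(\<Sum>j=1..n. ?g i j) = 0" for i by (rule sum_polygon_angle_odd[OF assms])
  have "2 * (\<Sum>j=1..n. \<Sum>i=1..<j. ?g i j * (\<xi> i - \<xi> j)) = (\<Sum>i=1..n. \<Sum>j=1..n. ?g i j * (\<xi> i - \<xi> j))"
    by (rule sum_pairs_symmetric[symmetric]) (subst flip, auto simp: algebra_simps)
  also have "\<dots> = (\<Sum>i=1..n. \<xi> i * (\<Sum>j=1..n. ?g i j)) + (\<Sum>i=1..n. \<Sum>j=1..n. ?g j i * \<xi> j)"
    unfolding sum.distrib[symmetric] sum_distrib_left
  proof (intro sum.cong refl)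
    fix i j show "?g i j * (\<xi> i - \<xi> j) = \<xi> i * ?g i j + ?g j i * \<xi> j"
      by (subst flip[of j i]) (simp add: algebra_simps)
  qed
  also have "(\<Sum>i=1..n. \<Sum>j=1..n. ?g j i * \<xi> j) = (\<Sum>j=1..n. (\<Sum>i=1..n. ?g j i) * \<xi> j)"
    unfolding sum_distrib_right by (rule sum.swap)
  finally show ?thesis unfolding zero by simp
qed

text \<open>
  The polygon is a critical point: the longitudinal forces cancel by symmetry, the transverse
  derivatives vanish because sines are extremal on the equator, and the derivatives in the
  momenta vanish because all bodies have the same angular velocity \<open>\<alpha>\<close>, while the relative momenta
  add up to zero.
\<close>

lemma ngon_hamiltonian_derivative:
  assumes "odd n"
  shows "hamiltonian_derivative n (real n * \<alpha>) (ngon_equilibrium n) y = 0"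
proof -
  have "n \<ge> 1" using assms by (cases n) auto
  let ?g = "\<lambda>x. - (sin x / \<bar>sin x\<bar> ^ 3)"
  have "(\<Sum>j=1..n. \<Sum>i=1..<j. cot_arccos_derivative (cos_dist n (ngon_equilibrium n) i j)
          * cos_dist_derivative n (ngon_equilibrium n) y i j)
      = (\<Sum>j=1..n. \<Sum>i=1..<j. ?g (polygon_angle n (int i - int j)) * (state_angles n y i - state_angles n y j))"
    by (intro sum.cong refl)
       (auto simp: ngon_cos_dist cot_arccos_derivative_cos cos_dist_derivative_def Let_def ngon_angle_difference)
  also have "\<dots> = 0"
    using \<open>n \<ge> 1\<close> by (intro sum_odd_pairs) auto
  finally have pairs: "(\<Sum>j=1..n. \<Sum>i=1..<j. cot_arccos_derivative (cos_dist n (ngon_equilibrium n) i j)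
          * cos_dist_derivative n (ngon_equilibrium n) y i j) = 0" .
  have "(\<Sum>i=1..n. momentum n (real n * \<alpha>) (ngon_equilibrium n) i * momentum n 0 y i) = \<alpha> * (\<Sum>i=1..n. momentum n 0 y i)"
    unfolding sum_distrib_left by (intro sum.cong refl) (simp only: ngon_momentum)
  then show ?thesis
    unfolding hamiltonian_derivative_def pairs using sum_momentum_zero[OF \<open>n \<ge> 1\<close>] by simp
qed

lemma hamiltonian_field_eq:
  assumes "noncollision n x"
  shows "hamiltonian_field (reduced_hamiltonian n c) x d =
    (case d of QU k \<Rightarrow> hamiltonian_derivative n c x (unit_vector (PV k))
     | QTheta i \<Rightarrow> hamiltonian_derivative n c x (unit_vector (PTheta i))
     | PV k \<Rightarrow> - hamiltonian_derivative n c x (unit_vector (QU k))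
     | PTheta i \<Rightarrow> - hamiltonian_derivative n c x (unit_vector (QTheta i)))"
  by (cases d) (simp_all add: partial_reduced_hamiltonian[OF assms])

lemma ngon_field:
  assumes "odd n"
  shows "hamiltonian_field (reduced_hamiltonian n (real n * \<alpha>)) (ngon_equilibrium n) d = 0"
  unfolding hamiltonian_field_eq[OF ngon_noncollision[OF assms]]
  by (cases d) (simp_all add: ngon_hamiltonian_derivative[OF assms])

subsection \<open>Regularity near the polygon\<close>

abbreviation ngon_nbhd :: "nat \<Rightarrow> (coord \<Rightarrow> real) filter" where
  "ngon_nbhd n \<equiv> nbhd (reduced_coords n) (ngon_equilibrium n)"

lemma lipschitz_near_state_angles [lipschitz_intros]:
  assumes "i \<in> {1..n}"
  shows "lipschitz_near (reduced_coords n) e (\<lambda>x. state_angles n x i)"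
proof -
  have "lipschitz_near (reduced_coords n) e (\<lambda>x. \<Sum>k=max 2 i..n. x (QU k) * inverse (real k))"
    by (intro lipschitz_near_sum lipschitz_near_mult lipschitz_near_const lipschitz_near_coord)
       (auto simp: reduced_coords_def)
  moreover have "lipschitz_near (reduced_coords n) e (\<lambda>x. if i = 1 then 0 else x (QU i))"
    using assms by (cases "i = 1") (auto intro!: lipschitz_near_const lipschitz_near_coord simp: reduced_coords_def)
  ultimately show ?thesis
    unfolding state_angles_explicit[OF assms] divide_inverse by (rule lipschitz_near_diff[rotated])
qed

lemma lipschitz_near_momentum [lipschitz_intros]:
  "lipschitz_near (reduced_coords n) e (\<lambda>x. momentum n c x i)"
  unfolding momentum_def
proof (intro lipschitz_near_sum lipschitz_near_mult lipschitz_near_const)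
  fix k assume "k \<in> {2..n+1}"
  then show "lipschitz_near (reduced_coords n) e (\<lambda>x. if k = n + 1 then c else x (PV k))"
    by (cases "k = n + 1") (auto intro!: lipschitz_near_const lipschitz_near_coord simp: reduced_coords_def)
qed

lemma lipschitz_near_theta [lipschitz_intros]:
  "i \<in> {1..n} \<Longrightarrow> lipschitz_near (reduced_coords n) e (\<lambda>x. x (QTheta i))"
  "i \<in> {1..n} \<Longrightarrow> lipschitz_near (reduced_coords n) e (\<lambda>x. x (PTheta i))"
  by (auto intro!: lipschitz_near_coord simp: reduced_coords_def)

lemma lipschitz_near_cos_dist [lipschitz_intros]:
  "i \<in> {1..n} \<Longrightarrow> j \<in> {1..n} \<Longrightarrow> lipschitz_near (reduced_coords n) e (\<lambda>x. cos_dist n x i j)"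
  unfolding cos_dist_def by (intro lipschitz_intros)

lemma lipschitz_near_hamiltonian_derivative:
  assumes "noncollision n e"
  shows "lipschitz_near (reduced_coords n) e (\<lambda>x. hamiltonian_derivative n c x y)"
  unfolding hamiltonian_derivative_def
proof (rule lipschitz_near_diff, rule lipschitz_near_add)
  show "lipschitz_near (reduced_coords n) e (\<lambda>x. \<Sum>i=1..n.
      momentum n c x i * momentum n 0 y i / (sin (x (QTheta i)))\<^sup>2
        - (momentum n c x i)\<^sup>2 * cos (x (QTheta i)) / sin (x (QTheta i)) ^ 3 * y (QTheta i))"
    using assms
    by (intro lipschitz_near_sum lipschitz_near_diff lipschitz_near_divide lipschitz_near_mult
        lipschitz_near_power lipschitz_near_sin lipschitz_near_cos lipschitz_near_const
        lipschitz_near_momentum lipschitz_near_theta)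
       (auto simp: noncollision_def)
  show "lipschitz_near (reduced_coords n) e (\<lambda>x. \<Sum>i=1..n. x (PTheta i) * y (PTheta i))"
    by (intro lipschitz_near_sum lipschitz_near_mult lipschitz_near_const lipschitz_near_theta)
  show "lipschitz_near (reduced_coords n) e (\<lambda>x. \<Sum>j=1..n. \<Sum>i=1..<j.
      cot_arccos_derivative (cos_dist n x i j) * cos_dist_derivative n x y i j)"
  proof (intro lipschitz_near_sum lipschitz_near_mult)
    fix i j assume ij: "j \<in> {1..n}" "i \<in> {1..<j}"
    then have i: "i \<in> {1..n}" by auto
    have C: "\<bar>cos_dist n e i j\<bar> < 1" using assms ij by (auto simp: noncollision_def)
    then have "1 - (cos_dist n e i j)\<^sup>2 > 0" by (simp add: abs_square_less_1)
    then show "lipschitz_near (reduced_coords n) e (\<lambda>x. cot_arccos_derivative (cos_dist n x i j))"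
      unfolding cot_arccos_derivative_def
      by (intro lipschitz_near_divide lipschitz_near_power lipschitz_near_sqrt lipschitz_near_diff
          lipschitz_near_const lipschitz_near_cos_dist i ij(1)) auto
    show "lipschitz_near (reduced_coords n) e (\<lambda>x. cos_dist_derivative n x y i j)"
      unfolding cos_dist_derivative_def Let_def
      by (intro lipschitz_near_diff lipschitz_near_add lipschitz_near_mult lipschitz_near_sin
          lipschitz_near_cos lipschitz_near_const lipschitz_near_theta lipschitz_near_state_angles i ij(1))
  qed
qed

lemma eventually_noncollision:
  assumes "noncollision n e"
  shows "eventually (noncollision n) (nbhd (reduced_coords n) e)"
  unfolding noncollision_def
proof (intro eventually_conj eventually_ball_finite ballI finite_atLeastAtMost finite_atLeastLessThan)
  fix i assume i: "i \<in> {1..n}"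
  have "((\<lambda>x. sin (x (QTheta i))) \<longlongrightarrow> sin (e (QTheta i))) (nbhd (reduced_coords n) e)"
    by (intro lipschitz_near_tendsto lipschitz_intros i)
  then show "\<forall>\<^sub>F x in nbhd (reduced_coords n) e. sin (x (QTheta i)) \<noteq> 0"
    using assms i by (intro tendsto_imp_eventually_ne) (auto simp: noncollision_def)
next
  fix i j assume ij: "j \<in> {1..n}" "i \<in> {1..<j}"
  have "((\<lambda>x. \<bar>cos_dist n x i j\<bar>) \<longlongrightarrow> \<bar>cos_dist n e i j\<bar>) (nbhd (reduced_coords n) e)"
    using ij by (intro tendsto_rabs lipschitz_near_tendsto lipschitz_intros) auto
  then show "\<forall>\<^sub>F x in nbhd (reduced_coords n) e. \<bar>cos_dist n x i j\<bar> < 1"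
    using assms ij by (intro order_tendstoD(2)) (auto simp: noncollision_def)
qed

lemma lipschitz_near_hamiltonian_field:
  assumes "noncollision n e"
  shows "lipschitz_near (reduced_coords n) e (\<lambda>x. hamiltonian_field (reduced_hamiltonian n c) x d)"
proof -
  have "lipschitz_near (reduced_coords n) e (\<lambda>x.
    (case d of QU k \<Rightarrow> hamiltonian_derivative n c x (unit_vector (PV k))
     | QTheta i \<Rightarrow> hamiltonian_derivative n c x (unit_vector (PTheta i))
     | PV k \<Rightarrow> - hamiltonian_derivative n c x (unit_vector (QU k))
     | PTheta i \<Rightarrow> - hamiltonian_derivative n c x (unit_vector (QTheta i))))"
    by (cases d) (auto intro!: lipschitz_near_hamiltonian_derivative lipschitz_near_uminus assms)
  then show ?thesis
    by (rule lipschitz_near_cong)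
       (use eventually_noncollision[OF assms] in \<open>eventually_elim, simp add: hamiltonian_field_eq\<close>)
qed

lemma ngon_eventually_phase_space:
  assumes "odd n"
  shows "eventually (\<lambda>x. x \<in> reduced_phase_space n) (ngon_nbhd n)"
proof -
  have "eventually (\<lambda>x. \<forall>i\<in>{1..n}. 0 < x (QTheta i) \<and> x (QTheta i) < pi) (ngon_nbhd n)"
  proof (intro eventually_ball_finite ballI finite_atLeastAtMost eventually_conj)
    fix i assume "i \<in> {1..n}"
    then have "((\<lambda>x. x (QTheta i)) \<longlongrightarrow> ngon_equilibrium n (QTheta i)) (ngon_nbhd n)"
      by (intro lipschitz_near_tendsto lipschitz_intros)
    then show "\<forall>\<^sub>F x in ngon_nbhd n. 0 < x (QTheta i)" "\<forall>\<^sub>F x in ngon_nbhd n. x (QTheta i) < pi"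
      by (auto intro!: order_tendstoD)
  qed
  with eventually_noncollision[OF ngon_noncollision[OF assms]] show ?thesis
  proof eventually_elim
    case (elim x)
    have "sphere_distance (state_angles n x) (\<lambda>i. x (QTheta i)) i j \<in> {0<..<pi}"
      if "i \<in> {1..n}" "j \<in> {1..n}" "i < j" for i j
      using elim(1) that arccos_lt_bounded[of "cos_dist n x i j"]
      by (auto simp: sphere_distance_def noncollision_def cos_dist_def[symmetric] abs_less_iff)
    then show ?case using elim(2) by (auto simp: reduced_phase_space_def)
  qed
qed

lemma reduced_hamiltonian_tendsto:
  assumes "noncollision n e"
  shows "(reduced_hamiltonian n c \<longlongrightarrow> reduced_hamiltonian n c e) (nbhd (reduced_coords n) e)"
proof -
  let ?N = "nbhd (reduced_coords n) e"
  have \<theta>: "((\<lambda>x. x (QTheta i)) \<longlongrightarrow> e (QTheta i)) ?N" "((\<lambda>x. x (PTheta i)) \<longlongrightarrow> e (PTheta i)) ?N"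
    if "i \<in> {1..n}" for i
    using that by (auto intro!: lipschitz_near_tendsto lipschitz_near_theta)
  have sin_\<theta>: "((\<lambda>x. sin (x (QTheta i))) \<longlongrightarrow> sin (e (QTheta i))) ?N" if "i \<in> {1..n}" for i
    using that by (intro lipschitz_near_tendsto lipschitz_near_sin lipschitz_near_theta)
  have mom: "((\<lambda>x. momentum n c x i) \<longlongrightarrow> momentum n c e i) ?N" for i
    by (rule lipschitz_near_tendsto[OF lipschitz_near_momentum])
  have "((\<lambda>x. \<Sum>i=1..n. (momentum n c x i)\<^sup>2 / (2 * (sin (x (QTheta i)))\<^sup>2)) \<longlongrightarrow>
      (\<Sum>i=1..n. (momentum n c e i)\<^sup>2 / (2 * (sin (e (QTheta i)))\<^sup>2))) ?N"
    using assms
    by (intro tendsto_sum tendsto_divide tendsto_power tendsto_mult tendsto_const sin_\<theta> mom)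
       (auto simp: noncollision_def)
  moreover have "((\<lambda>x. \<Sum>i=1..n. (x (PTheta i))\<^sup>2 / 2) \<longlongrightarrow> (\<Sum>i=1..n. (e (PTheta i))\<^sup>2 / 2)) ?N"
    by (intro tendsto_intros \<theta>) auto
  moreover have "((\<lambda>x. \<Sum>j=1..n. \<Sum>i=1..<j. cot (arccos (cos_dist n x i j))) \<longlongrightarrow>
      (\<Sum>j=1..n. \<Sum>i=1..<j. cot (arccos (cos_dist n e i j)))) ?N"
  proof (intro tendsto_sum)
    fix j i assume ij: "j \<in> {1..n}" "i \<in> {1..<j}"
    then have C: "\<bar>cos_dist n e i j\<bar> < 1" using assms by (auto simp: noncollision_def)
    show "((\<lambda>x. cot (arccos (cos_dist n x i j))) \<longlongrightarrow> cot (arccos (cos_dist n e i j))) ?N"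
      using ij by (intro isCont_tendsto_compose[OF DERIV_isCont[OF DERIV_cot_arccos[OF C]]]
          lipschitz_near_tendsto lipschitz_near_cos_dist) auto
  qed
  ultimately show ?thesis
    unfolding reduced_hamiltonian_eq by (intro tendsto_diff tendsto_add)
qed

section \<open>The polygon as a strict minimum of the energy\<close>

text \<open>
  Subtracting \<open>m / 2 (u - a)\<^sup>2\<close> leaves a function that is convex near \<open>a\<close> and hence lies above its
  tangent.
\<close>

lemma second_order_lower_bound:
  fixes f :: "real \<Rightarrow> real"
  assumes f: "eventually (\<lambda>u. (f has_real_derivative f' u) (at u)) (nhds a)"
    and f': "eventually (\<lambda>u. (f' has_real_derivative f'' u) (at u)) (nhds a)"
    and "isCont f'' a" "m < f'' a"
  shows "eventually (\<lambda>u. f a + f' a * (u - a) + m / 2 * (u - a)\<^sup>2 \<le> f u) (nhds a)"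
proof -
  have "eventually (\<lambda>u. m < f'' u) (nhds a)"
    using assms(3,4) by (intro order_tendstoD(1)) (auto simp: isCont_def tendsto_nhds_iff)
  with f f' have "eventually (\<lambda>u. (f has_real_derivative f' u) (at u) \<and>
      (f' has_real_derivative f'' u) (at u) \<and> m < f'' u) (nhds a)"
    by eventually_elim auto
  then obtain \<rho> where "\<rho> > 0" and \<rho>: "\<forall>u. dist u a < \<rho> \<longrightarrow> (f has_real_derivative f' u) (at u) \<and>
      (f' has_real_derivative f'' u) (at u) \<and> m < f'' u"
    unfolding eventually_nhds_metric by blast
  have "f a + f' a * (u - a) + m / 2 * (u - a)\<^sup>2 \<le> f u" if u: "dist u a < \<rho>" for u
  proof -
    define h where "h u = f u - m / 2 * (u - a)\<^sup>2" for u
    define h' where "h' u = f' u - m * (u - a)" for u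
    have "h' a * (u - a) \<le> h u - h a"
    proof (rule f''_imp_f'[of "ball a \<rho>" h h' "\<lambda>u. f'' u - m"])
      fix w assume "w \<in> ball a \<rho>"
      then have w: "(f has_real_derivative f' w) (at w)" "(f' has_real_derivative f'' w) (at w)" "m < f'' w"
        using \<rho> by (auto simp: dist_commute)
      show "(h has_real_derivative h' w) (at w)"
        unfolding h_def h'_def by (auto intro!: derivative_eq_intros w)
      show "(h' has_real_derivative f'' w - m) (at w)"
        unfolding h'_def by (auto intro!: derivative_eq_intros w)
      show "0 \<le> f'' w - m" using w(3) by simp
    qed (use \<open>\<rho> > 0\<close> u in \<open>auto simp: dist_commute\<close>)
    then show ?thesis by (simp add: h_def h'_def)
  qed
  then show ?thesis unfolding eventually_nhds_metric using \<open>\<rho> > 0\<close> by blast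
qed

lemma cot_arccos_cos_second_order:
  assumes s0: "sin \<psi>0 \<noteq> 0" and h: "hessian_weight \<psi>0 < h"
  shows "eventually (\<lambda>\<psi>. cot (arccos (cos \<psi>)) \<le> cot (arccos (cos \<psi>0))
           - sin \<psi>0 / \<bar>sin \<psi>0\<bar> ^ 3 * (\<psi> - \<psi>0) + h * (\<psi> - \<psi>0)\<^sup>2) (nhds \<psi>0)"
proof -
  define \<sigma> where "\<sigma> = sgn (sin \<psi>0)"
  have \<sigma>: "\<sigma> * \<sigma> = 1" using s0 by (auto simp: \<sigma>_def sgn_if)
  have "((\<lambda>\<psi>. \<sigma> * sin \<psi>) \<longlongrightarrow> \<sigma> * sin \<psi>0) (nhds \<psi>0)"
    by (intro tendsto_intros filterlim_ident)
  moreover have "\<sigma> * sin \<psi>0 > 0" using s0 by (auto simp: \<sigma>_def sgn_if)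
  ultimately have pos: "eventually (\<lambda>\<psi>. \<sigma> * sin \<psi> > 0) (nhds \<psi>0)" by (rule order_tendstoD(1))
  have abs: "\<bar>sin \<psi>\<bar> = \<sigma> * sin \<psi>" if "\<sigma> * sin \<psi> > 0" for \<psi>
    using that s0 by (auto simp: \<sigma>_def sgn_if split: if_splits)
  have cube: "\<bar>sin \<psi>\<bar> ^ 3 = \<sigma> * sin \<psi> ^ 3" if "\<sigma> * sin \<psi> > 0" for \<psi>
  proof -
    have "\<bar>sin \<psi>\<bar> ^ 3 = (\<sigma> * \<sigma>) * \<sigma> * sin \<psi> ^ 3"
      unfolding abs[OF that] by (simp add: power3_eq_cube)
    then show ?thesis by (simp add: \<sigma>)
  qed
  have inv: "u / (\<sigma> * v) = \<sigma> * u / v" for u v :: real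
  proof -
    have "\<sigma> \<noteq> 0" using \<sigma> by auto
    then have "u / (\<sigma> * v) = (\<sigma> * \<sigma>) * u / (\<sigma> * v)" by (simp add: \<sigma>)
    also have "\<dots> = \<sigma> * u / v" using \<open>\<sigma> \<noteq> 0\<close> by simp
    finally show ?thesis .
  qed
  have "eventually (\<lambda>u. - cot (arccos (cos \<psi>0)) + \<sigma> / (sin \<psi>0)\<^sup>2 * (u - \<psi>0) + (- 2 * h) / 2 * (u - \<psi>0)\<^sup>2
      \<le> - cot (arccos (cos u))) (nhds \<psi>0)"
  proof (rule second_order_lower_bound[where f'' = "\<lambda>u. - 2 * \<sigma> * cos u / sin u ^ 3"])
    show "\<forall>\<^sub>F u in nhds \<psi>0. ((\<lambda>u. - cot (arccos (cos u))) has_real_derivative \<sigma> / (sin u)\<^sup>2) (at u)"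
      using pos
    proof eventually_elim
      case (elim u)
      then have s: "sin u \<noteq> 0" by auto
      have "((\<lambda>u. - cot (arccos (cos u))) has_real_derivative
          - (cot_arccos_derivative (cos u) * (- sin u))) (at u)"
        by (intro DERIV_minus DERIV_chain2[where g = cos, OF DERIV_cot_arccos[OF abs_cos_less_one[OF s]]]
              DERIV_cos)
      moreover have "- (cot_arccos_derivative (cos u) * (- sin u)) = \<sigma> / (sin u)\<^sup>2"
        using s unfolding cot_arccos_derivative_cos cube[OF elim]
        by (simp add: inv power2_eq_square power3_eq_cube)
      ultimately show ?case by simp
    qed
    show "\<forall>\<^sub>F u in nhds \<psi>0. ((\<lambda>u. \<sigma> / (sin u)\<^sup>2) has_real_derivative - 2 * \<sigma> * cos u / sin u ^ 3) (at u)"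
      using pos
    proof eventually_elim
      case (elim u)
      then have s: "sin u \<noteq> 0" by auto
      then show ?case
        by (auto intro!: derivative_eq_intros simp: field_simps power2_eq_square power3_eq_cube)
    qed
    show "isCont (\<lambda>u. - 2 * \<sigma> * cos u / sin u ^ 3) \<psi>0"
      using s0 by (intro continuous_intros) auto
    have "hessian_weight \<psi>0 = \<sigma> * cos \<psi>0 / sin \<psi>0 ^ 3"
      unfolding hessian_weight_def cube[OF \<open>\<sigma> * sin \<psi>0 > 0\<close>] by (rule inv)
    then show "- 2 * h < - 2 * \<sigma> * cos \<psi>0 / sin \<psi>0 ^ 3" using h by simp
  qed
  moreover have "\<sigma> / (sin \<psi>0)\<^sup>2 = sin \<psi>0 / \<bar>sin \<psi>0\<bar> ^ 3"
    unfolding cube[OF \<open>\<sigma> * sin \<psi>0 > 0\<close>] using s0 by (simp add: inv power2_eq_square power3_eq_cube)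
  ultimately show ?thesis by (auto elim!: eventually_mono)
qed

text \<open>
  As a function of the cosine of the distance, the potential of a pair is increasing, with a
  derivative below \<open>M\<close> near \<open>c0\<close>. Therefore an upper bound for the cosine suffices; its exact
  value off the equator need not be expanded.
\<close>

lemma cot_arccos_increase:
  assumes c0: "\<bar>c0\<bar> < 1" and M: "cot_arccos_derivative c0 < M"
    and lim: "(C \<longlongrightarrow> c0) F" "(C' \<longlongrightarrow> c0) F" "(h \<longlongrightarrow> 0) F"
  shows "eventually (\<lambda>x. 0 \<le> h x \<longrightarrow> C x \<le> C' x + h x \<longrightarrow>
           cot (arccos (C x)) \<le> cot (arccos (C' x)) + M * h x) F"
proof -
  have "1 - c0\<^sup>2 > 0" using c0 by (simp add: abs_square_less_1)
  then have "isCont cot_arccos_derivative c0"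
    unfolding cot_arccos_derivative_def[abs_def] by (intro continuous_intros) auto
  then have "eventually (\<lambda>c. cot_arccos_derivative c < M) (nhds c0)"
    using M by (intro order_tendstoD(2)) (auto simp: isCont_def tendsto_nhds_iff)
  moreover have "eventually (\<lambda>c. c \<in> {-1<..<1}) (nhds c0)"
    using c0 by (intro eventually_nhds_in_open) auto
  ultimately have "eventually (\<lambda>c. cot_arccos_derivative c < M \<and> \<bar>c\<bar> < 1) (nhds c0)"
    by eventually_elim auto
  then obtain \<rho> where "\<rho> > 0" and \<rho>: "\<forall>c. dist c c0 < \<rho> \<longrightarrow> cot_arccos_derivative c < M \<and> \<bar>c\<bar> < 1"
    unfolding eventually_nhds_metric by blast
  have "((\<lambda>x. C' x + h x) \<longlongrightarrow> c0 + 0) F" by (intro tendsto_add lim)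
  then have "eventually (\<lambda>x. dist (C' x + h x) c0 < \<rho>) F" using \<open>\<rho> > 0\<close> by (intro tendstoD) auto
  with tendstoD[OF lim(1) \<open>\<rho> > 0\<close>] tendstoD[OF lim(2) \<open>\<rho> > 0\<close>] show ?thesis
  proof eventually_elim
    case (elim x)
    have in_ball: "dist c c0 < \<rho>" if "a \<le> c" "c \<le> b" "dist a c0 < \<rho>" "dist b c0 < \<rho>" for a b c
      using that by (auto simp: dist_real_def abs_less_iff)
    show ?case
    proof (intro impI)
      assume h: "0 \<le> h x" and le: "C x \<le> C' x + h x"
      have "cot (arccos (C x)) \<le> cot (arccos (C' x + h x))"
      proof (rule DERIV_nonneg_imp_nondecreasing[OF le])
        fix c assume "C x \<le> c" "c \<le> C' x + h x"
        from in_ball[OF this elim(1) elim(3)] have "\<bar>c\<bar> < 1" using \<rho> by blast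
        moreover have "cot_arccos_derivative c \<ge> 0"
          unfolding cot_arccos_derivative_def using \<open>\<bar>c\<bar> < 1\<close> by (simp add: abs_square_le_1)
        ultimately show "\<exists>y. ((\<lambda>c. cot (arccos c)) has_real_derivative y) (at c) \<and> 0 \<le> y"
          using DERIV_cot_arccos by blast
      qed
      moreover have "M * C' x - cot (arccos (C' x)) \<le> M * (C' x + h x) - cot (arccos (C' x + h x))"
      proof (rule DERIV_nonneg_imp_nondecreasing[of "C' x" "C' x + h x" "\<lambda>c. M * c - cot (arccos c)"])
        show "C' x \<le> C' x + h x" using h by simp
        fix c assume "C' x \<le> c" "c \<le> C' x + h x"
        from in_ball[OF this elim(2) elim(3)] have "\<bar>c\<bar> < 1" "cot_arccos_derivative c < M" using \<rho> by blast+
        then show "\<exists>y. ((\<lambda>c. M * c - cot (arccos c)) has_real_derivative y) (at c) \<and> 0 \<le> y"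
          by (intro exI[of _ "M - cot_arccos_derivative c"] conjI)
             (auto intro!: derivative_eq_intros DERIV_cot_arccos)
      qed
      ultimately show "cot (arccos (C x)) \<le> cot (arccos (C' x)) + M * h x"
        by (simp add: algebra_simps)
    qed
  qed
qed

lemma cos_ge_quadratic: "1 - x\<^sup>2 / 2 \<le> cos (x :: real)"
proof -
  have "(sin (x / 2))\<^sup>2 \<le> (x / 2)\<^sup>2"
    using abs_sin_x_le_abs_x[of "x / 2"] by (simp only: abs_le_square_iff)
  then show ?thesis using cos_double_sin[of "x / 2"] by (simp add: power_divide)
qed

text \<open>
  The left-hand side equals \<open>cos \<psi> + (cos (a - b) - 1) + (1 - cos a cos b) (1 - cos \<psi>)\<close>, and the
  term \<open>cos (a - b) - 1\<close> is not positive.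
\<close>

lemma off_equator_bound:
  fixes a b \<psi> :: real
  shows "sin a * sin b + cos a * cos b * cos \<psi> \<le> cos \<psi> + (a\<^sup>2 + b\<^sup>2) / 2 * (1 - cos \<psi>)"
proof -
  have "1 - cos a * cos b \<le> (a\<^sup>2 + b\<^sup>2) / 2"
    using cos_ge_quadratic[of "a - b"] cos_ge_quadratic[of "a + b"]
    unfolding cos_add cos_diff by (simp add: power2_sum power2_diff field_simps)
  then have "(1 - cos a * cos b) * (1 - cos \<psi>) \<le> (a\<^sup>2 + b\<^sup>2) / 2 * (1 - cos \<psi>)"
    by (rule mult_right_mono) simp
  moreover have "sin a * sin b + cos a * cos b \<le> 1"
    using cos_le_one[of "a - b"] by (simp only: cos_diff add.commute)
  moreover have "sin a * sin b + cos a * cos b * cos \<psi>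
      = (sin a * sin b + cos a * cos b - 1) + (1 - cos a * cos b) * (1 - cos \<psi>) + cos \<psi>"
    by (simp add: algebra_simps)
  ultimately show ?thesis by linarith
qed

text \<open>
  The derivative \<open>1 / \<bar>sin x\<bar>\<^sup>3\<close> of the potential with respect to the cosine of the distance, times
  the factor \<open>1 - cos x\<close> that the bound for pairs off the equator puts on the mean of their squared
  displacements.
\<close>

definition transverse_weight :: "real \<Rightarrow> real" where
  "transverse_weight x = (1 - cos x) / \<bar>sin x\<bar> ^ 3"

text \<open>
  The two effects are separated: leaving the equator increases the cosine of the distance by at
  most a multiple of the squared displacements, and the remaining dependence on the longitudes is
  that of an equatorial pair. The factor \<open>\<mu>\<close> and the summand \<open>\<kappa>\<close> leave room for the terms of
  higher order.
\<close>

lemma pair_potential_bound: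
  assumes "odd n" and ij: "i \<in> {1..n}" "j \<in> {1..n}" "i \<noteq> j" and "1 < \<mu>" and "0 < \<kappa>"
  defines "\<psi>0 \<equiv> polygon_angle n (int i - int j)"
  shows "eventually (\<lambda>x. cot (arccos (cos_dist n x i j)) \<le> cot (arccos (cos \<psi>0))
     - sin \<psi>0 / \<bar>sin \<psi>0\<bar> ^ 3 * (state_angles n x i - state_angles n x j - \<psi>0)
     + (hessian_weight \<psi>0 + \<kappa>) * (state_angles n x i - state_angles n x j - \<psi>0)\<^sup>2
     + \<mu> * transverse_weight \<psi>0 * (((x (QTheta i) - pi / 2)\<^sup>2 + (x (QTheta j) - pi / 2)\<^sup>2) / 2))
     (ngon_nbhd n)"
proof -
  define \<psi> where "\<psi> x = state_angles n x i - state_angles n x j" for x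
  define q where "q x = ((x (QTheta i) - pi / 2)\<^sup>2 + (x (QTheta j) - pi / 2)\<^sup>2) / 2" for x :: "coord \<Rightarrow> real"
  \<comment> \<open>One factor \<open>\<nu>\<close> each for the variation of the derivative and of \<open>1 - cos \<psi>\<close>.\<close>
  define \<nu> where "\<nu> = sqrt \<mu>"
  have \<nu>: "1 < \<nu>" "\<nu> * \<nu> = \<mu>" using \<open>1 < \<mu>\<close> by (auto simp: \<nu>_def)
  have s0: "sin \<psi>0 \<noteq> 0" unfolding \<psi>0_def by (rule polygon_angle_sin_pair[OF \<open>odd n\<close> ij])
  have c0: "\<bar>cos \<psi>0\<bar> < 1" by (rule abs_cos_less_one[OF s0])
  have \<psi>: "(\<psi> \<longlongrightarrow> \<psi>0) (ngon_nbhd n)"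
    using lipschitz_near_tendsto[OF lipschitz_near_diff[OF lipschitz_near_state_angles[OF ij(1)]
          lipschitz_near_state_angles[OF ij(2)]], of "ngon_equilibrium n"]
    unfolding \<psi>_def \<psi>0_def ngon_angle_difference[OF ij(1,2)] .
  then have cos\<psi>: "((\<lambda>x. cos (\<psi> x)) \<longlongrightarrow> cos \<psi>0) (ngon_nbhd n)" by (rule isCont_tendsto_compose[OF isCont_cos])
  have C: "((\<lambda>x. cos_dist n x i j) \<longlongrightarrow> cos \<psi>0) (ngon_nbhd n)"
    using lipschitz_near_tendsto[OF lipschitz_near_cos_dist[OF ij(1,2)], of "ngon_equilibrium n"]
    unfolding ngon_cos_dist[OF ij(1,2)] \<psi>0_def .
  have \<theta>: "((\<lambda>x. x (QTheta l)) \<longlongrightarrow> pi / 2) (ngon_nbhd n)" if "l \<in> {1..n}" for l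
    using lipschitz_near_tendsto[OF lipschitz_near_theta(1)[OF that], of "ngon_equilibrium n"] by simp
  have "(q \<longlongrightarrow> ((pi / 2 - pi / 2)\<^sup>2 + (pi / 2 - pi / 2)\<^sup>2) / 2) (ngon_nbhd n)"
    unfolding q_def by (intro tendsto_divide tendsto_add tendsto_power tendsto_diff tendsto_const \<theta> ij) auto
  then have q: "(q \<longlongrightarrow> 0) (ngon_nbhd n)" by simp
  have "((\<lambda>x. q x * (1 - cos (\<psi> x))) \<longlongrightarrow> 0 * (1 - cos \<psi>0)) (ngon_nbhd n)"
    by (intro tendsto_mult tendsto_diff tendsto_const q cos\<psi>)
  then have h: "((\<lambda>x. q x * (1 - cos (\<psi> x))) \<longlongrightarrow> 0) (ngon_nbhd n)" by simp
  have w: "transverse_weight \<psi>0 = cot_arccos_derivative (cos \<psi>0) * (1 - cos \<psi>0)"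
    by (simp add: transverse_weight_def cot_arccos_derivative_cos)
  have D: "0 < cot_arccos_derivative (cos \<psi>0)" using s0 by (simp add: cot_arccos_derivative_cos)
  have M: "cot_arccos_derivative (cos \<psi>0) < \<nu> * cot_arccos_derivative (cos \<psi>0)" using D \<nu>(1) by simp
  have "eventually (\<lambda>x. 1 - cos (\<psi> x) < \<nu> * (1 - cos \<psi>0)) (ngon_nbhd n)"
  proof (rule order_tendstoD(2)[OF tendsto_diff[OF tendsto_const cos\<psi>]])
    show "1 - cos \<psi>0 < \<nu> * (1 - cos \<psi>0)" using mult_strict_right_mono[OF \<nu>(1), of "1 - cos \<psi>0"] c0 by (simp only: abs_less_iff mult_1 diff_gt_0_iff_gt)
  qed
  moreover have "eventually (\<lambda>x. cot (arccos (cos (\<psi> x))) \<le> cot (arccos (cos \<psi>0))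
           - sin \<psi>0 / \<bar>sin \<psi>0\<bar> ^ 3 * (\<psi> x - \<psi>0) + (hessian_weight \<psi>0 + \<kappa>) * (\<psi> x - \<psi>0)\<^sup>2) (ngon_nbhd n)"
    using \<open>0 < \<kappa>\<close> by (intro eventually_compose_filterlim[OF cot_arccos_cos_second_order[OF s0] \<psi>]) simp
  ultimately show ?thesis
    using cot_arccos_increase[OF c0 M C cos\<psi> h]
  proof eventually_elim
    case (elim x)
    have "cos_dist n x i j \<le> cos (\<psi> x) + q x * (1 - cos (\<psi> x))"
      using off_equator_bound[of "x (QTheta i) - pi / 2" "x (QTheta j) - pi / 2" "\<psi> x"]
      by (simp add: cos_dist_def \<psi>_def q_def sin_diff cos_diff)
    moreover have "0 \<le> q x * (1 - cos (\<psi> x))" by (simp add: q_def)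
    ultimately have "cot (arccos (cos_dist n x i j)) \<le> cot (arccos (cos (\<psi> x)))
        + \<nu> * cot_arccos_derivative (cos \<psi>0) * (q x * (1 - cos (\<psi> x)))"
      using elim(3) by blast
    moreover have "\<nu> * cot_arccos_derivative (cos \<psi>0) * (q x * (1 - cos (\<psi> x)))
        \<le> \<nu> * cot_arccos_derivative (cos \<psi>0) * (q x * (\<nu> * (1 - cos \<psi>0)))"
      using elim(1) D \<nu>(1) by (intro mult_left_mono) (auto simp: q_def)
    moreover have "\<nu> * cot_arccos_derivative (cos \<psi>0) * (q x * (\<nu> * (1 - cos \<psi>0)))
        = \<mu> * transverse_weight \<psi>0 * q x"
      unfolding w \<nu>(2)[symmetric] by simp
    ultimately show ?case using elim(2) unfolding \<psi>_def[symmetric] q_def[symmetric] by linarith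
  qed
qed

lemma jacobi_rows_orthogonal:
  assumes k: "k \<in> {2..n}" and l: "l \<in> {2..n}"
  shows "(\<Sum>i=1..n. jacobi_matrix n k i * jacobi_matrix n l i) = (if k = l then real k / (real k - 1) else 0)"
proof -
  have below: "(\<Sum>i=1..n. jacobi_matrix n k i * jacobi_matrix n l i) = 0"
    if k: "k \<in> {2..n}" and l: "l \<in> {2..n}" and "k < l" for k l
  proof -
    have "(\<Sum>i=1..k-1. jacobi_matrix n l i) = (\<Sum>i=1..k-1. - 1 / (real l - 1))"
      using that by (intro sum.cong) (auto simp: jacobi_matrix_def)
    then show ?thesis
      using that unfolding jacobi_matrix_relative[OF k] by (simp add: jacobi_matrix_def)
  qed
  consider "k < l" | "l < k" | "k = l" by linarith
  then show ?thesis
  proof cases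
    case 1
    then show ?thesis using below[OF k l] by simp
  next
    case 2
    then show ?thesis using below[OF l k] by (simp add: mult.commute)
  next
    case 3
    have "(\<Sum>i=1..k-1. jacobi_matrix n k i) = (\<Sum>i=1..k-1. - 1 / (real k - 1))"
      using k by (intro sum.cong) (auto simp: jacobi_matrix_def)
    also have "\<dots> = -1" using k by (simp add: of_nat_diff)
    finally show ?thesis
      using k 3 unfolding jacobi_matrix_relative[OF k]
      by (auto simp: jacobi_matrix_def of_nat_diff field_simps)
  qed
qed

text \<open>
  The rows of the Jacobi matrix are orthogonal with squared norms \<open>k / (k - 1) \<ge> 1\<close>.
\<close>

lemma sum_momentum_squares:
  assumes "n \<ge> 1"
  shows "(\<Sum>k=2..n. (x (PV k))\<^sup>2) \<le> (\<Sum>i=1..n. (momentum n 0 x i)\<^sup>2)"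
proof -
  let ?J = "jacobi_matrix n" and ?v = "\<lambda>k. x (PV k)"
  have "(\<Sum>i=1..n. (momentum n 0 x i)\<^sup>2)
      = (\<Sum>i=1..n. \<Sum>k=2..n. \<Sum>l=2..n. ?v k * ?v l * (?J k i * ?J l i))"
    unfolding momentum_split[OF assms] power2_eq_square
    by (intro sum.cong refl) (simp add: sum_product mult_ac)
  also have "\<dots> = (\<Sum>k=2..n. \<Sum>i=1..n. \<Sum>l=2..n. ?v k * ?v l * (?J k i * ?J l i))"
    by (rule sum.swap)
  also have "\<dots> = (\<Sum>k=2..n. \<Sum>l=2..n. \<Sum>i=1..n. ?v k * ?v l * (?J k i * ?J l i))"
    by (intro sum.cong refl sum.swap)
  also have "\<dots> = (\<Sum>k=2..n. \<Sum>l=2..n. if k = l then ?v k * ?v k * (real k / (real k - 1)) else 0)"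
    unfolding sum_distrib_left[symmetric]
    by (intro sum.cong refl) (simp add: jacobi_rows_orthogonal del: One_nat_def)
  also have "\<dots> = (\<Sum>k=2..n. ?v k * ?v k * (real k / (real k - 1)))" by simp
  also have "\<dots> \<ge> (\<Sum>k=2..n. (?v k)\<^sup>2)"
  proof (rule sum_mono)
    fix k assume "k \<in> {2..n}"
    then have "1 \<le> real k / (real k - 1)" by (simp add: field_simps)
    then have "?v k * ?v k * 1 \<le> ?v k * ?v k * (real k / (real k - 1))"
      by (intro mult_left_mono) auto
    then show "(?v k)\<^sup>2 \<le> ?v k * ?v k * (real k / (real k - 1))" by (simp add: power2_eq_square)
  qed
  finally show ?thesis .
qed

text \<open>
  The coordinate \<open>u k\<close> is the mean of the differences \<open>\<xi> k - \<xi> i\<close> over \<open>i < k\<close>, so its square is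
  at most the sum of their squares.
\<close>

lemma sum_relative_angle_squares:
  assumes "n \<ge> 1" and u: "\<And>k. k \<in> {2..n} \<Longrightarrow> (\<Sum>i=1..n. jacobi_matrix n k i * \<xi> i) = u k"
  shows "(\<Sum>k=2..n. (u k)\<^sup>2) \<le> (\<Sum>j=1..n. \<Sum>i=1..<j. (\<xi> i - \<xi> j)\<^sup>2)"
proof -
  have "(\<Sum>k=2..n. (u k)\<^sup>2) \<le> (\<Sum>k=2..n. \<Sum>i=1..<k. (\<xi> i - \<xi> k)\<^sup>2)"
  proof (rule sum_mono)
    fix k assume k: "k \<in> {2..n}"
    define m where "m = real (k - 1)"
    have m: "1 \<le> m" using k by (simp add: m_def)
    have set: "{1..<k} = {1..k-1}" using k by auto
    have "(\<Sum>i=1..<k. \<xi> k - \<xi> i) = m * u k"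
      using m u[OF k] unfolding jacobi_matrix_relative[OF k] set
      by (simp add: sum_subtractf m_def field_simps)
    then have "m\<^sup>2 * (u k)\<^sup>2 \<le> (\<Sum>i=1..<k. (\<xi> k - \<xi> i)\<^sup>2) * m"
      using sum_squared_le_sum_of_squares[of "\<lambda>i. \<xi> k - \<xi> i" "{1..<k}"]
      by (simp add: power_mult_distrib m_def)
    then have "m * (m * (u k)\<^sup>2) \<le> m * (\<Sum>i=1..<k. (\<xi> k - \<xi> i)\<^sup>2)"
      by (simp add: power2_eq_square mult_ac)
    then have "m * (u k)\<^sup>2 \<le> (\<Sum>i=1..<k. (\<xi> k - \<xi> i)\<^sup>2)" using m by simp
    moreover have "1 * (u k)\<^sup>2 \<le> m * (u k)\<^sup>2" using m by (intro mult_right_mono) auto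
    ultimately show "(u k)\<^sup>2 \<le> (\<Sum>i=1..<k. (\<xi> i - \<xi> k)\<^sup>2)" by (simp add: power2_commute)
  qed
  also have "\<dots> = (\<Sum>j=1..n. \<Sum>i=1..<j. (\<xi> i - \<xi> j)\<^sup>2)"
    using assms(1) by (subst sum.atLeast_Suc_atMost[of 1]) (auto simp: numeral_2_eq_2)
  finally show ?thesis .
qed

lemma sum_transverse_weight:
  assumes "n = 2 * p + 1"
  shows "(\<Sum>j=1..n. \<Sum>i=1..<j. transverse_weight (polygon_angle n (int i - int j)) * (b i + b j))
     = (2 * (\<Sum>j=1..p. transverse_weight (polygon_angle n (int j)))) * (\<Sum>i=1..n. b i)"
proof -
  let ?w = "\<lambda>i j :: nat. transverse_weight (polygon_angle n (int i - int j))"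
  define S where "S = 2 * (\<Sum>j=1..p. transverse_weight (polygon_angle n (int j)))"
  have sym: "?w i j = ?w j i" for i j
    using polygon_angle_minus[of n "int j - int i"] by (simp add: transverse_weight_def)
  have row: "(\<Sum>j=1..n. ?w i j) = S" for i
    unfolding S_def using assms by (intro sum_polygon_angle_even) (auto simp: transverse_weight_def)
  have "2 * (\<Sum>j=1..n. \<Sum>i=1..<j. ?w i j * (b i + b j)) = (\<Sum>i=1..n. \<Sum>j=1..n. ?w i j * (b i + b j))"
    by (rule sum_pairs_symmetric[symmetric])
       (subst sym, auto simp: add.commute transverse_weight_def polygon_angle_def)
  also have "\<dots> = (\<Sum>i=1..n. b i * (\<Sum>j=1..n. ?w i j)) + (\<Sum>i=1..n. \<Sum>j=1..n. ?w j i * b j)"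
    unfolding sum.distrib[symmetric] sum_distrib_left
  proof (intro sum.cong refl)
    fix i j show "?w i j * (b i + b j) = b i * ?w i j + ?w j i * b j"
      by (subst sym[of j i]) (simp add: algebra_simps)
  qed
  also have "(\<Sum>i=1..n. \<Sum>j=1..n. ?w j i * b j) = (\<Sum>j=1..n. (\<Sum>i=1..n. ?w j i) * b j)"
    unfolding sum_distrib_right by (rule sum.swap)
  also have "(\<Sum>i=1..n. b i * (\<Sum>j=1..n. ?w i j)) + (\<Sum>j=1..n. (\<Sum>i=1..n. ?w j i) * b j)
      = 2 * (S * (\<Sum>i=1..n. b i))"
    unfolding row sum_distrib_left[symmetric] sum_distrib_right[symmetric] by simp
  finally show ?thesis unfolding S_def[symmetric] by simp
qed

text \<open>
  Write the momenta as \<open>\<alpha> + \<eta> i\<close> and the colatitudes as \<open>\<pi> / 2 + a i\<close>. The estimate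
  \<open>1 / cos\<^sup>2 a \<ge> 1 + a\<^sup>2\<close> separates \<open>(\<alpha> + \<eta> i)\<^sup>2\<close>, whose cross terms cancel because the \<open>\<eta> i\<close> add up
  to zero, from a centrifugal term with a coefficient close to \<open>\<alpha>\<^sup>2\<close>.
\<close>

lemma kinetic_bound:
  assumes "n \<ge> 1" and "\<beta> < \<alpha>\<^sup>2"
  shows "eventually (\<lambda>x. real n * \<alpha>\<^sup>2 / 2 + (\<Sum>k=2..n. (x (PV k))\<^sup>2) / 2
           + \<beta> / 2 * (\<Sum>i=1..n. (x (QTheta i) - pi / 2)\<^sup>2)
         \<le> (\<Sum>i=1..n. (momentum n (real n * \<alpha>) x i)\<^sup>2 / (2 * (sin (x (QTheta i)))\<^sup>2))) (ngon_nbhd n)"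
proof -
  have m: "momentum n (real n * \<alpha>) x i = \<alpha> + momentum n 0 x i" for x i
    using assms(1) by (simp add: momentum_split)
  have "eventually (\<lambda>x. \<forall>i\<in>{1..n}. \<beta> < (\<alpha> + momentum n 0 x i)\<^sup>2 \<and> dist (x (QTheta i)) (pi / 2) < pi / 2) (ngon_nbhd n)"
  proof (intro eventually_ball_finite ballI finite_atLeastAtMost eventually_conj)
    fix i assume i: "i \<in> {1..n}"
    have "((\<lambda>x. (\<alpha> + momentum n 0 x i)\<^sup>2) \<longlongrightarrow> (\<alpha> + momentum n 0 (ngon_equilibrium n) i)\<^sup>2) (ngon_nbhd n)"
      by (intro lipschitz_near_tendsto lipschitz_near_power lipschitz_near_add lipschitz_near_const
          lipschitz_near_momentum)
    moreover have "momentum n 0 (ngon_equilibrium n) i = 0"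
      using assms(1) by (simp add: momentum_split)
    ultimately show "\<forall>\<^sub>F x in ngon_nbhd n. \<beta> < (\<alpha> + momentum n 0 x i)\<^sup>2"
      using assms(2) by (intro order_tendstoD(1)) auto
    have "((\<lambda>x. x (QTheta i)) \<longlongrightarrow> pi / 2) (ngon_nbhd n)"
      using lipschitz_near_tendsto[OF lipschitz_near_theta(1)[OF i], of "ngon_equilibrium n"] by simp
    then show "\<forall>\<^sub>F x in ngon_nbhd n. dist (x (QTheta i)) (pi / 2) < pi / 2"
      by (rule tendstoD) simp
  qed
  then show ?thesis
  proof eventually_elim
    case (elim x)
    define a where "a i = x (QTheta i) - pi / 2" for i
    define \<eta> where "\<eta> i = momentum n 0 x i" for i
    have each: "(\<alpha> + \<eta> i)\<^sup>2 / 2 + \<beta> / 2 * (a i)\<^sup>2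
        \<le> (momentum n (real n * \<alpha>) x i)\<^sup>2 / (2 * (sin (x (QTheta i)))\<^sup>2)" if i: "i \<in> {1..n}" for i
    proof -
      have a: "\<bar>a i\<bar> < pi / 2" using elim i by (auto simp: a_def dist_real_def)
      have cos: "cos (a i) > 0" using a by (intro cos_gt_zero_pi) auto
      have sin: "sin (x (QTheta i)) = cos (a i)" by (simp add: a_def cos_diff)
      have "(a i)\<^sup>2 \<le> (tan (a i))\<^sup>2" using abs_tan_ge[OF a] by (simp only: abs_le_square_iff)
      then have "1 + (a i)\<^sup>2 \<le> 1 / (cos (a i))\<^sup>2"
        using tan_sec[of "a i"] cos by (simp add: power_inverse divide_inverse)
      then have "(\<alpha> + \<eta> i)\<^sup>2 * (1 + (a i)\<^sup>2) \<le> (\<alpha> + \<eta> i)\<^sup>2 * (1 / (cos (a i))\<^sup>2)"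
        by (rule mult_left_mono) simp
      moreover have "\<beta> * (a i)\<^sup>2 \<le> (\<alpha> + \<eta> i)\<^sup>2 * (a i)\<^sup>2"
        using elim i by (intro mult_right_mono) (auto simp: \<eta>_def less_imp_le)
      ultimately have "(\<alpha> + \<eta> i)\<^sup>2 + \<beta> * (a i)\<^sup>2 \<le> (\<alpha> + \<eta> i)\<^sup>2 / (cos (a i))\<^sup>2"
        by (simp add: distrib_left)
      then show ?thesis unfolding m sin \<eta>_def[symmetric] by simp
    qed
    have "real n * \<alpha>\<^sup>2 / 2 + (\<Sum>i=1..n. (\<eta> i)\<^sup>2) / 2 = (\<Sum>i=1..n. (\<alpha> + \<eta> i)\<^sup>2 / 2)"
    proof -
      have "(\<Sum>i=1..n. (\<alpha> + \<eta> i)\<^sup>2) = (\<Sum>i=1..n. \<alpha>\<^sup>2) + 2 * \<alpha> * (\<Sum>i=1..n. \<eta> i) + (\<Sum>i=1..n. (\<eta> i)\<^sup>2)"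
        unfolding sum_distrib_left sum.distrib[symmetric]
        by (intro sum.cong refl) (simp add: power2_sum)
      also have "(\<Sum>i=1..n. \<eta> i) = 0" unfolding \<eta>_def by (rule sum_momentum_zero[OF assms(1)])
      finally show ?thesis by (simp add: sum_divide_distrib[symmetric] add_divide_distrib)
    qed
    moreover have "(\<Sum>k=2..n. (x (PV k))\<^sup>2) \<le> (\<Sum>i=1..n. (\<eta> i)\<^sup>2)"
      unfolding \<eta>_def by (rule sum_momentum_squares[OF assms(1)])
    moreover have "(\<Sum>i=1..n. (\<alpha> + \<eta> i)\<^sup>2 / 2) + \<beta> / 2 * (\<Sum>i=1..n. (a i)\<^sup>2)
        \<le> (\<Sum>i=1..n. (momentum n (real n * \<alpha>) x i)\<^sup>2 / (2 * (sin (x (QTheta i)))\<^sup>2))"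
      unfolding sum_distrib_left sum.distrib[symmetric] by (rule sum_mono) (rule each)
    ultimately show ?case unfolding a_def[symmetric] by linarith
  qed
qed

lemma potential_bound:
  assumes n: "n = 2 * p + 1" and "1 < \<mu>"
  defines "S \<equiv> 2 * (\<Sum>j=1..p. transverse_weight (polygon_angle n (int j)))"
  shows "\<exists>\<kappa>>0. eventually (\<lambda>x. (\<Sum>j=1..n. \<Sum>i=1..<j. cot (arccos (cos_dist n x i j)))
      \<le> (\<Sum>j=1..n. \<Sum>i=1..<j. cot (arccos (cos_dist n (ngon_equilibrium n) i j)))
        - \<kappa> * (\<Sum>k=2..n. (x (QU k) - ngon_equilibrium n (QU k))\<^sup>2)
        + \<mu> * S / 2 * (\<Sum>i=1..n. (x (QTheta i) - pi / 2)\<^sup>2)) (ngon_nbhd n)"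
proof -
  have "odd n" "n \<ge> 1" using n by auto
  obtain \<kappa> where "\<kappa> > 0" and \<kappa>: "\<forall>\<xi> :: nat \<Rightarrow> real.
    (\<Sum>i=1..n. \<Sum>j=1..n. hessian_weight (polygon_angle n (int i - int j)) * (\<xi> i - \<xi> j)\<^sup>2)
      \<le> - \<kappa> * (\<Sum>i=1..n. \<Sum>j=1..n. (\<xi> i - \<xi> j)\<^sup>2)"
    using polygon_hessian_negative[OF \<open>odd n\<close>] by blast
  let ?\<psi> = "\<lambda>i j :: nat. polygon_angle n (int i - int j)"
  let ?e = "ngon_equilibrium n"
  have flip: "?\<psi> i j = - ?\<psi> j i" for i j
    using polygon_angle_minus[of n "int j - int i"] by simp
  have hess: "(\<Sum>j=1..n. \<Sum>i=1..<j. hessian_weight (?\<psi> i j) * (\<xi> i - \<xi> j)\<^sup>2)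
      \<le> - \<kappa> * (\<Sum>j=1..n. \<Sum>i=1..<j. (\<xi> i - \<xi> j)\<^sup>2)" for \<xi> :: "nat \<Rightarrow> real"
  proof -
    have "(\<Sum>i=1..n. \<Sum>j=1..n. hessian_weight (?\<psi> i j) * (\<xi> i - \<xi> j)\<^sup>2)
        = 2 * (\<Sum>j=1..n. \<Sum>i=1..<j. hessian_weight (?\<psi> i j) * (\<xi> i - \<xi> j)\<^sup>2)"
      by (rule sum_pairs_symmetric) (subst flip, auto simp: hessian_weight_def power2_commute)
    moreover have "(\<Sum>i=1..n. \<Sum>j=1..n. (\<xi> i - \<xi> j)\<^sup>2) = 2 * (\<Sum>j=1..n. \<Sum>i=1..<j. (\<xi> i - \<xi> j)\<^sup>2)"
      by (rule sum_pairs_symmetric) (auto simp: power2_commute)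
    ultimately show ?thesis using \<kappa>[rule_format, of \<xi>] by (simp only: mult.left_commute[of _ 2])
  qed
  \<comment> \<open>Half of \<open>\<kappa>\<close> is spent on the higher order terms; the other half remains in the result.\<close>
  have "eventually (\<lambda>x. \<forall>j\<in>{1..n}. \<forall>i\<in>{1..<j}. cot (arccos (cos_dist n x i j)) \<le> cot (arccos (cos (?\<psi> i j)))
     - sin (?\<psi> i j) / \<bar>sin (?\<psi> i j)\<bar> ^ 3 * (state_angles n x i - state_angles n x j - ?\<psi> i j)
     + (hessian_weight (?\<psi> i j) + \<kappa> / 2) * (state_angles n x i - state_angles n x j - ?\<psi> i j)\<^sup>2
     + \<mu> * transverse_weight (?\<psi> i j) * (((x (QTheta i) - pi / 2)\<^sup>2 + (x (QTheta j) - pi / 2)\<^sup>2) / 2))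
     (ngon_nbhd n)"
    using \<open>\<kappa> > 0\<close>
    by (intro eventually_ball_finite ballI finite_atLeastAtMost finite_atLeastLessThan
        pair_potential_bound \<open>odd n\<close> \<open>1 < \<mu>\<close>) auto
  then have "eventually (\<lambda>x. (\<Sum>j=1..n. \<Sum>i=1..<j. cot (arccos (cos_dist n x i j)))
      \<le> (\<Sum>j=1..n. \<Sum>i=1..<j. cot (arccos (cos_dist n ?e i j)))
        - \<kappa> / 2 * (\<Sum>k=2..n. (x (QU k) - ?e (QU k))\<^sup>2)
        + \<mu> * S / 2 * (\<Sum>i=1..n. (x (QTheta i) - pi / 2)\<^sup>2)) (ngon_nbhd n)"
  proof eventually_elim
    case (elim x)
    define \<xi> where "\<xi> i = state_angles n x i - state_angles n ?e i" for i
    define b where "b i = (x (QTheta i) - pi / 2)\<^sup>2" for i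
    define g where "g \<psi> = - (sin \<psi> / \<bar>sin \<psi>\<bar> ^ 3)" for \<psi> :: real
    have "(\<Sum>j=1..n. \<Sum>i=1..<j. cot (arccos (cos_dist n x i j)))
        \<le> (\<Sum>j=1..n. \<Sum>i=1..<j. cot (arccos (cos_dist n ?e i j)) + g (?\<psi> i j) * (\<xi> i - \<xi> j)
            + hessian_weight (?\<psi> i j) * (\<xi> i - \<xi> j)\<^sup>2 + \<kappa> / 2 * (\<xi> i - \<xi> j)\<^sup>2
            + \<mu> / 2 * (transverse_weight (?\<psi> i j) * (b i + b j)))"
    proof (intro sum_mono)
      fix j i assume ij: "j \<in> {1..n}" "i \<in> {1..<j}"
      then have i: "i \<in> {1..n}" by auto
      have \<xi>: "state_angles n x i - state_angles n x j - ?\<psi> i j = \<xi> i - \<xi> j"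
        using ngon_angle_difference[OF i ij(1)] by (simp add: \<xi>_def)
      show "cot (arccos (cos_dist n x i j)) \<le> cot (arccos (cos_dist n ?e i j)) + g (?\<psi> i j) * (\<xi> i - \<xi> j)
            + hessian_weight (?\<psi> i j) * (\<xi> i - \<xi> j)\<^sup>2 + \<kappa> / 2 * (\<xi> i - \<xi> j)\<^sup>2
            + \<mu> / 2 * (transverse_weight (?\<psi> i j) * (b i + b j))"
        using elim[rule_format, OF ij]
        unfolding \<xi> ngon_cos_dist[OF i ij(1)] b_def[symmetric] g_def distrib_right by simp
    qed
    also have "\<dots> = (\<Sum>j=1..n. \<Sum>i=1..<j. cot (arccos (cos_dist n ?e i j)))
        + (\<Sum>j=1..n. \<Sum>i=1..<j. g (?\<psi> i j) * (\<xi> i - \<xi> j))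
        + (\<Sum>j=1..n. \<Sum>i=1..<j. hessian_weight (?\<psi> i j) * (\<xi> i - \<xi> j)\<^sup>2)
        + \<kappa> / 2 * (\<Sum>j=1..n. \<Sum>i=1..<j. (\<xi> i - \<xi> j)\<^sup>2)
        + \<mu> / 2 * (\<Sum>j=1..n. \<Sum>i=1..<j. transverse_weight (?\<psi> i j) * (b i + b j))"
      by (simp only: sum.distrib sum_distrib_left)
    also have "(\<Sum>j=1..n. \<Sum>i=1..<j. g (?\<psi> i j) * (\<xi> i - \<xi> j)) = 0"
      using \<open>n \<ge> 1\<close> by (intro sum_odd_pairs) (auto simp: g_def)
    also have "(\<Sum>j=1..n. \<Sum>i=1..<j. transverse_weight (?\<psi> i j) * (b i + b j)) = S * (\<Sum>i=1..n. b i)"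
      unfolding S_def by (rule sum_transverse_weight[OF n])
    finally have upper: "(\<Sum>j=1..n. \<Sum>i=1..<j. cot (arccos (cos_dist n x i j)))
        \<le> (\<Sum>j=1..n. \<Sum>i=1..<j. cot (arccos (cos_dist n ?e i j)))
          + (\<Sum>j=1..n. \<Sum>i=1..<j. hessian_weight (?\<psi> i j) * (\<xi> i - \<xi> j)\<^sup>2)
          + \<kappa> / 2 * (\<Sum>j=1..n. \<Sum>i=1..<j. (\<xi> i - \<xi> j)\<^sup>2) + \<mu> / 2 * (S * (\<Sum>i=1..n. b i))"
      by simp
    have "(\<Sum>k=2..n. (x (QU k) - ?e (QU k))\<^sup>2) \<le> (\<Sum>j=1..n. \<Sum>i=1..<j. (\<xi> i - \<xi> j)\<^sup>2)"
    proof (rule sum_relative_angle_squares[OF \<open>n \<ge> 1\<close>])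
      fix k assume k: "k \<in> {2..n}"
      then have "k \<in> {2..n+1}" by simp
      from jacobi_angles_inverse[OF \<open>n \<ge> 1\<close> this] k
      have "(\<Sum>i=1..n. jacobi_matrix n k i * state_angles n y i) = y (QU k)" for y
        by (simp add: state_angles_def)
      then show "(\<Sum>i=1..n. jacobi_matrix n k i * \<xi> i) = x (QU k) - ?e (QU k)"
        unfolding \<xi>_def right_diff_distrib sum_subtractf by simp
    qed
    then have "\<kappa> / 2 * (\<Sum>k=2..n. (x (QU k) - ?e (QU k))\<^sup>2) \<le> \<kappa> / 2 * (\<Sum>j=1..n. \<Sum>i=1..<j. (\<xi> i - \<xi> j)\<^sup>2)"
      using \<open>\<kappa> > 0\<close> by (intro mult_left_mono) auto
    then show ?case using upper hess[of \<xi>] unfolding b_def[symmetric] by (simp add: mult.assoc)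
  qed
  then show ?thesis using \<open>\<kappa> > 0\<close> by (intro exI[of _ "\<kappa> / 2"]) auto
qed

theorem ngon_strict_minimum:
  assumes n: "n = 2 * p + 1"
    and stable: "2 * (\<Sum>j=1..p. transverse_weight (polygon_angle n (int j))) < \<alpha>\<^sup>2"
  shows "\<exists>\<kappa>>0. eventually (\<lambda>x. reduced_hamiltonian n (real n * \<alpha>) (ngon_equilibrium n)
      + \<kappa> * (coord_dist (reduced_coords n) x (ngon_equilibrium n))\<^sup>2
      \<le> reduced_hamiltonian n (real n * \<alpha>) x) (ngon_nbhd n)"
proof -
  have "n \<ge> 1" using n by auto
  let ?e = "ngon_equilibrium n"
  define S where "S = 2 * (\<Sum>j=1..p. transverse_weight (polygon_angle n (int j)))"
  have "S \<ge> 0" unfolding S_def transverse_weight_def by (auto intro!: sum_nonneg divide_nonneg_nonneg)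
  \<comment> \<open>A third of the gap between \<open>S\<close> and \<open>\<alpha>\<^sup>2\<close> is lost in the kinetic estimate, a third in the
    potential estimate, and the last third remains as the transverse coefficient.\<close>
  define \<gamma> where "\<gamma> = (\<alpha>\<^sup>2 - S) / 3"
  have "\<gamma> > 0" using stable by (simp add: \<gamma>_def S_def)
  define \<mu> where "\<mu> = 1 + \<gamma> / (S + 1)"
  have "\<mu> > 1" using \<open>\<gamma> > 0\<close> \<open>S \<ge> 0\<close> by (simp add: \<mu>_def)
  have "\<gamma> * (S / (S + 1)) \<le> \<gamma> * 1"
    using \<open>\<gamma> > 0\<close> \<open>S \<ge> 0\<close> by (intro mult_left_mono) auto
  then have \<mu>S: "\<mu> * S \<le> S + \<gamma>" by (simp add: \<mu>_def distrib_right)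
  obtain \<kappa> where "\<kappa> > 0" and \<kappa>: "eventually (\<lambda>x. (\<Sum>j=1..n. \<Sum>i=1..<j. cot (arccos (cos_dist n x i j)))
      \<le> (\<Sum>j=1..n. \<Sum>i=1..<j. cot (arccos (cos_dist n ?e i j)))
        - \<kappa> * (\<Sum>k=2..n. (x (QU k) - ?e (QU k))\<^sup>2)
        + \<mu> * S / 2 * (\<Sum>i=1..n. (x (QTheta i) - pi / 2)\<^sup>2)) (ngon_nbhd n)"
    using potential_bound[OF n \<open>\<mu> > 1\<close>] unfolding S_def[symmetric] by blast
  have "\<alpha>\<^sup>2 - \<gamma> < \<alpha>\<^sup>2" using \<open>\<gamma> > 0\<close> by simp
  note kin = kinetic_bound[OF \<open>n \<ge> 1\<close> this]
  define \<kappa>' where "\<kappa>' = min (1/2) (min (\<gamma> / 2) \<kappa>)"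
  have "\<kappa>' > 0" using \<open>\<gamma> > 0\<close> \<open>\<kappa> > 0\<close> by (simp add: \<kappa>'_def)
  have "eventually (\<lambda>x. reduced_hamiltonian n (real n * \<alpha>) ?e
      + \<kappa>' * (coord_dist (reduced_coords n) x ?e)\<^sup>2 \<le> reduced_hamiltonian n (real n * \<alpha>) x) (ngon_nbhd n)"
    using \<kappa> kin
  proof eventually_elim
    case (elim x)
    define U A V P where "U = (\<Sum>k=2..n. (x (QU k) - ?e (QU k))\<^sup>2)"
      and "A = (\<Sum>i=1..n. (x (QTheta i) - pi / 2)\<^sup>2)"
      and "V = (\<Sum>k=2..n. (x (PV k))\<^sup>2)" and "P = (\<Sum>i=1..n. (x (PTheta i))\<^sup>2)"
    have nonneg: "U \<ge> 0" "A \<ge> 0" "V \<ge> 0" "P \<ge> 0" by (simp_all add: U_def A_def V_def P_def sum_nonneg)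
    have dist: "(coord_dist (reduced_coords n) x ?e)\<^sup>2 = U + A + V + P"
      by (simp add: coord_dist_square sum_reduced_coords U_def A_def V_def P_def)
    have "(\<Sum>i=1..n. (momentum n (real n * \<alpha>) ?e i)\<^sup>2 / (2 * (sin (?e (QTheta i)))\<^sup>2)) = (\<Sum>i=1..n. \<alpha>\<^sup>2 / 2)"
      by (intro sum.cong refl) (simp only: ngon_momentum, simp)
    then have He: "reduced_hamiltonian n (real n * \<alpha>) ?e
        = real n * \<alpha>\<^sup>2 / 2 - (\<Sum>j=1..n. \<Sum>i=1..<j. cot (arccos (cos_dist n ?e i j)))"
      unfolding reduced_hamiltonian_eq by simp
    have "\<kappa>' * U \<le> \<kappa> * U" "\<kappa>' * A \<le> \<gamma> / 2 * A" "\<kappa>' * V \<le> 1/2 * V" "\<kappa>' * P \<le> 1/2 * P"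
      using nonneg by (intro mult_right_mono; simp add: \<kappa>'_def)+
    moreover have "\<mu> * S / 2 * A \<le> (S + \<gamma>) / 2 * A"
      using \<mu>S nonneg by (intro mult_right_mono) auto
    moreover have "(\<alpha>\<^sup>2 - \<gamma>) / 2 * A = (S + \<gamma>) / 2 * A + \<gamma> / 2 * A"
      by (simp add: \<gamma>_def field_simps)
    moreover have "reduced_hamiltonian n (real n * \<alpha>) x
        = (\<Sum>i=1..n. (momentum n (real n * \<alpha>) x i)\<^sup>2 / (2 * (sin (x (QTheta i)))\<^sup>2)) + P / 2
          - (\<Sum>j=1..n. \<Sum>i=1..<j. cot (arccos (cos_dist n x i j)))"
      unfolding reduced_hamiltonian_eq P_def by (simp add: sum_divide_distrib)
    ultimately show ?case
      using elim unfolding He dist distrib_left U_def[symmetric] A_def[symmetric] V_def[symmetric]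
      by linarith
  qed
  then show ?thesis using \<open>\<kappa>' > 0\<close> by blast
qed

theorem ngon_lyapunov_stable:
  assumes n: "n = 2 * p + 1"
    and stable: "2 * (\<Sum>j=1..p. transverse_weight (polygon_angle n (int j))) < \<alpha>\<^sup>2"
  shows "lyapunov_stable (reduced_coords n) (reduced_phase_space n)
    (hamiltonian_field (reduced_hamiltonian n (real n * \<alpha>))) (ngon_equilibrium n)"
proof -
  have "odd n" using n by simp
  note reg = ngon_noncollision[OF \<open>odd n\<close>]
  obtain \<kappa> where "\<kappa> > 0" and \<kappa>: "eventually (\<lambda>x. reduced_hamiltonian n (real n * \<alpha>) (ngon_equilibrium n)
      + \<kappa> * (coord_dist (reduced_coords n) x (ngon_equilibrium n))\<^sup>2
      \<le> reduced_hamiltonian n (real n * \<alpha>) x) (ngon_nbhd n)"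
    using ngon_strict_minimum[OF assms] by blast
  show ?thesis
  proof (rule lyapunov_stable_strict_minimum[OF finite_reduced_coords _ _ _ _ \<open>\<kappa> > 0\<close> \<kappa>])
    show "\<forall>\<^sub>F z in ngon_nbhd n. \<forall>x t T. x t = z \<longrightarrow>
        (\<forall>c\<in>reduced_coords n. ((\<lambda>s. x s c) has_real_derivative
          hamiltonian_field (reduced_hamiltonian n (real n * \<alpha>)) z c) (at t within T)) \<longrightarrow>
        ((\<lambda>s. reduced_hamiltonian n (real n * \<alpha>) (x s)) has_real_derivative 0) (at t within T)"
      using eventually_noncollision[OF reg]
    proof eventually_elim
      case (elim z)
      show ?case
      proof (intro allI impI)
        fix x :: "real \<Rightarrow> coord \<Rightarrow> real" and t T
        assume z: "x t = z" and x: "\<forall>c\<in>reduced_coords n. ((\<lambda>s. x s c) has_real_derivative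
          hamiltonian_field (reduced_hamiltonian n (real n * \<alpha>)) z c) (at t within T)"
        have "((\<lambda>s. reduced_hamiltonian n (real n * \<alpha>) (x s)) has_real_derivative
            hamiltonian_derivative n (real n * \<alpha>) (x t)
              (hamiltonian_field (reduced_hamiltonian n (real n * \<alpha>)) z)) (at t within T)"
          using x elim z by (intro reduced_hamiltonian_has_derivative) auto
        then show "((\<lambda>s. reduced_hamiltonian n (real n * \<alpha>) (x s)) has_real_derivative 0) (at t within T)"
          using hamiltonian_derivative_field[OF elim] z by simp
      qed
    qed
  qed (use \<open>odd n\<close> reg in \<open>auto intro: ngon_field ngon_eventually_phase_space
        lipschitz_near_hamiltonian_field reduced_hamiltonian_tendsto\<close>)
qed

section \<open>The unstable transverse mode\<close>

text \<open>
  The second derivative of the Hamiltonian at the polygon in the directions \<open>z\<close> and \<open>y\<close>, for \<open>z\<close>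
  without components along the relative longitudes and their momenta.
\<close>

definition transverse_hessian :: "nat \<Rightarrow> real \<Rightarrow> (coord \<Rightarrow> real) \<Rightarrow> (coord \<Rightarrow> real) \<Rightarrow> real" where
  "transverse_hessian n \<alpha> z y =
     (\<Sum>i=1..n. \<alpha>\<^sup>2 * z (QTheta i) * y (QTheta i)) + (\<Sum>i=1..n. z (PTheta i) * y (PTheta i))
     - (\<Sum>j=1..n. \<Sum>i=1..<j. let \<psi> = polygon_angle n (int i - int j) in
         1 / \<bar>sin \<psi>\<bar> ^ 3 * ((z (QTheta j) - z (QTheta i) * cos \<psi>) * y (QTheta i)
                          + (z (QTheta i) - z (QTheta j) * cos \<psi>) * y (QTheta j)))"

text \<open>
  All mixed terms vanish: on the equator, the cosines of the distances and the centrifugal factors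
  are stationary in the colatitudes. What remains are the second derivatives of these quantities.
\<close>

lemma transverse_second_derivative:
  assumes "odd n" and x: "\<And>d. d \<in> reduced_coords n \<Longrightarrow> ((\<lambda>s. x s d) has_real_derivative z d) (at t within T)"
    and xt: "x t = ngon_equilibrium n"
    and z: "\<And>k. z (QU k) = 0" "\<And>k. z (PV k) = 0"
  shows "((\<lambda>s. hamiltonian_derivative n (real n * \<alpha>) (x s) y) has_real_derivative transverse_hessian n \<alpha> z y)
    (at t within T)"
  unfolding hamiltonian_derivative_def transverse_hessian_def
proof (rule DERIV_diff, rule DERIV_add)
  have "n \<ge> 1" using \<open>odd n\<close> by (cases n) auto
  have mz: "momentum n 0 z i = 0" for i
    using \<open>n \<ge> 1\<close> by (simp add: momentum_split z)
  have az: "state_angles n z i = 0" if "i \<in> {1..n}" for i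
    by (simp add: state_angles_explicit[OF that] z)
  have \<theta>: "((\<lambda>s. x s (QTheta i)) has_real_derivative z (QTheta i)) (at t within T)" if "i \<in> {1..n}" for i
    using that by (auto intro!: x simp: reduced_coords_def)
  show "((\<lambda>s. \<Sum>i=1..n. momentum n (real n * \<alpha>) (x s) i * momentum n 0 y i / (sin (x s (QTheta i)))\<^sup>2
        - (momentum n (real n * \<alpha>) (x s) i)\<^sup>2 * cos (x s (QTheta i)) / sin (x s (QTheta i)) ^ 3 * y (QTheta i))
      has_real_derivative (\<Sum>i=1..n. \<alpha>\<^sup>2 * z (QTheta i) * y (QTheta i))) (at t within T)"
  proof (rule DERIV_sum)
    fix i assume i: "i \<in> {1..n}"
    have m: "((\<lambda>s. momentum n (real n * \<alpha>) (x s) i) has_real_derivative 0) (at t within T)"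
      using momentum_has_derivative[where n = n and x = x and y = z and c = "real n * \<alpha>" and i = i, OF x] by (simp add: mz)
    note [derivative_intros] = \<theta>[OF i] m
    show "((\<lambda>s. momentum n (real n * \<alpha>) (x s) i * momentum n 0 y i / (sin (x s (QTheta i)))\<^sup>2
        - (momentum n (real n * \<alpha>) (x s) i)\<^sup>2 * cos (x s (QTheta i)) / sin (x s (QTheta i)) ^ 3 * y (QTheta i))
      has_real_derivative \<alpha>\<^sup>2 * z (QTheta i) * y (QTheta i)) (at t within T)"
      by (auto intro!: derivative_eq_intros simp: xt ngon_momentum[OF i])
  qed
  show "((\<lambda>s. \<Sum>i=1..n. x s (PTheta i) * y (PTheta i)) has_real_derivative
      (\<Sum>i=1..n. z (PTheta i) * y (PTheta i))) (at t within T)"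
    by (intro DERIV_sum DERIV_cmult_right x) (auto simp: reduced_coords_def)
  show "((\<lambda>s. \<Sum>j=1..n. \<Sum>i=1..<j. cot_arccos_derivative (cos_dist n (x s) i j) * cos_dist_derivative n (x s) y i j)
      has_real_derivative (\<Sum>j=1..n. \<Sum>i=1..<j. let \<psi> = polygon_angle n (int i - int j) in
         1 / \<bar>sin \<psi>\<bar> ^ 3 * ((z (QTheta j) - z (QTheta i) * cos \<psi>) * y (QTheta i)
                          + (z (QTheta i) - z (QTheta j) * cos \<psi>) * y (QTheta j)))) (at t within T)"
  proof (intro DERIV_sum)
    fix j i assume ij: "j \<in> {1..n}" "i \<in> {1..<j}"
    then have i: "i \<in> {1..n}" and "i \<noteq> j" by auto
    define \<psi> where "\<psi> = polygon_angle n (int i - int j)"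
    have s: "sin \<psi> \<noteq> 0" unfolding \<psi>_def by (rule polygon_angle_sin_pair[OF \<open>odd n\<close> i ij(1) \<open>i \<noteq> j\<close>])
    have ang: "state_angles n (ngon_equilibrium n) i - state_angles n (ngon_equilibrium n) j = \<psi>"
      unfolding \<psi>_def by (rule ngon_angle_difference[OF i ij(1)])
    have d: "((\<lambda>s. state_angles n (x s) i - state_angles n (x s) j) has_real_derivative 0) (at t within T)"
      using DERIV_diff[OF state_angles_has_derivative[where x = x and y = z, OF x i]
          state_angles_has_derivative[where x = x and y = z, OF x ij(1)]]
      by (simp add: az[OF i] az[OF ij(1)])
    have C: "((\<lambda>s. cos_dist n (x s) i j) has_real_derivative 0) (at t within T)"
      using cos_dist_has_derivative[where x = x and y = z, OF x i ij(1)]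
      by (simp add: cos_dist_derivative_def Let_def xt az[OF i] az[OF ij(1)])
    have Ct: "cos_dist n (x t) i j = cos \<psi>" unfolding xt \<psi>_def by (rule ngon_cos_dist[OF i ij(1)])
    have "1 - (cos \<psi>)\<^sup>2 > 0" using s by (simp add: cos_squared_eq)
    then have G: "((\<lambda>s. cot_arccos_derivative (cos_dist n (x s) i j)) has_real_derivative 0) (at t within T)"
      unfolding cot_arccos_derivative_def by (auto intro!: derivative_eq_intros C simp: Ct)
    note [derivative_intros] = \<theta>[OF i] \<theta>[OF ij(1)] d G
    have D: "((\<lambda>s. cos_dist_derivative n (x s) y i j) has_real_derivative
        ((z (QTheta j) - z (QTheta i) * cos \<psi>) * y (QTheta i)
          + (z (QTheta i) - z (QTheta j) * cos \<psi>) * y (QTheta j))) (at t within T)"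
      unfolding cos_dist_derivative_def Let_def
      by (auto intro!: derivative_eq_intros simp: xt ang)
    show "((\<lambda>s. cot_arccos_derivative (cos_dist n (x s) i j) * cos_dist_derivative n (x s) y i j)
      has_real_derivative (let \<psi> = polygon_angle n (int i - int j) in
         1 / \<bar>sin \<psi>\<bar> ^ 3 * ((z (QTheta j) - z (QTheta i) * cos \<psi>) * y (QTheta i)
                          + (z (QTheta i) - z (QTheta j) * cos \<psi>) * y (QTheta j)))) (at t within T)"
      unfolding Let_def \<psi>_def[symmetric]
      using DERIV_mult[OF G D] by (simp add: Ct cot_arccos_derivative_cos mult.commute)
  qed
qed

lemma transverse_hessian_linear:
  "transverse_hessian n \<alpha> (\<lambda>d. a * y d + z d) u = a * transverse_hessian n \<alpha> y u + transverse_hessian n \<alpha> z u"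
proof -
  have position: "(\<Sum>i=1..n. \<alpha>\<^sup>2 * (a * y (QTheta i) + z (QTheta i)) * u (QTheta i))
      = a * (\<Sum>i=1..n. \<alpha>\<^sup>2 * y (QTheta i) * u (QTheta i)) + (\<Sum>i=1..n. \<alpha>\<^sup>2 * z (QTheta i) * u (QTheta i))"
    unfolding sum_distrib_left sum.distrib[symmetric] by (intro sum.cong refl) (simp add: algebra_simps)
  have momenta: "(\<Sum>i=1..n. (a * y (PTheta i) + z (PTheta i)) * u (PTheta i))
      = a * (\<Sum>i=1..n. y (PTheta i) * u (PTheta i)) + (\<Sum>i=1..n. z (PTheta i) * u (PTheta i))"
    unfolding sum_distrib_left sum.distrib[symmetric] by (intro sum.cong refl) (simp add: algebra_simps)
  have pairs: "(\<Sum>j=1..n. \<Sum>i=1..<j. w i j * ((a * y (QTheta j) + z (QTheta j) - (a * y (QTheta i) + z (QTheta i)) * c i j) * u (QTheta i)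
          + (a * y (QTheta i) + z (QTheta i) - (a * y (QTheta j) + z (QTheta j)) * c i j) * u (QTheta j)))
      = a * (\<Sum>j=1..n. \<Sum>i=1..<j. w i j * ((y (QTheta j) - y (QTheta i) * c i j) * u (QTheta i)
          + (y (QTheta i) - y (QTheta j) * c i j) * u (QTheta j)))
        + (\<Sum>j=1..n. \<Sum>i=1..<j. w i j * ((z (QTheta j) - z (QTheta i) * c i j) * u (QTheta i)
          + (z (QTheta i) - z (QTheta j) * c i j) * u (QTheta j)))" for w c :: "nat \<Rightarrow> nat \<Rightarrow> real"
    unfolding sum_distrib_left sum.distrib[symmetric] by (intro sum.cong refl) (simp only: algebra_simps)
  have collect: "(a * A + A') + (a * B + B') - (a * C + C') = a * (A + B - C) + (A' + B' - C')"
    for A A' B B' C C' :: real by (simp add: algebra_simps)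
  show ?thesis
    unfolding transverse_hessian_def Let_def position momenta
      pairs[of "\<lambda>i j. 1 / \<bar>sin (polygon_angle n (int i - int j))\<bar> ^ 3"
        "\<lambda>i j. cos (polygon_angle n (int i - int j))"]
    by (rule collect)
qed

lemma transverse_hessian_expansion:
  "transverse_hessian n \<alpha> z u = (\<Sum>d\<in>reduced_coords n. z d * transverse_hessian n \<alpha> (unit_vector d) u)"
proof (rule linear_coordinate_expansion[where F = "\<lambda>z. transverse_hessian n \<alpha> z u", OF finite_reduced_coords])
  fix y z :: "coord \<Rightarrow> real"
  assume "\<And>d. d \<in> reduced_coords n \<Longrightarrow> y d = z d"
  then have yz: "i \<in> {1..n} \<Longrightarrow> y (QTheta i) = z (QTheta i)" "i \<in> {1..n} \<Longrightarrow> y (PTheta i) = z (PTheta i)" for i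
    by (auto simp: reduced_coords_def)
  have pair: "y (QTheta i) = z (QTheta i)" if "j \<in> {1..n}" "i \<in> {1..<j}" for i j
    using that by (intro yz) auto
  show "transverse_hessian n \<alpha> y u = transverse_hessian n \<alpha> z u"
    unfolding transverse_hessian_def Let_def by (simp add: yz pair)
qed (rule transverse_hessian_linear)

lemma partial_hamiltonian_derivative:
  assumes "odd n" and d: "\<And>k. d \<noteq> QU k" "\<And>k. d \<noteq> PV k"
    and F: "\<And>x. noncollision n x \<Longrightarrow> F x = \<sigma> * hamiltonian_derivative n (real n * \<alpha>) x u"
  shows "partial F d (ngon_equilibrium n) = \<sigma> * transverse_hessian n \<alpha> (unit_vector d) u"
proof -
  let ?e = "ngon_equilibrium n"
  have "((\<lambda>s. hamiltonian_derivative n (real n * \<alpha>) (?e(d := s)) u) has_real_derivative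
      transverse_hessian n \<alpha> (unit_vector d) u) (at (?e d))"
  proof (rule transverse_second_derivative[OF \<open>odd n\<close>])
    show "((\<lambda>s. (?e(d := s)) b) has_real_derivative unit_vector d b) (at (?e d))" for b
      by (cases "b = d") (auto simp: unit_vector_def)
  qed (use d in \<open>auto simp: unit_vector_def\<close>)
  then have "((\<lambda>s. \<sigma> * hamiltonian_derivative n (real n * \<alpha>) (?e(d := s)) u) has_real_derivative
      \<sigma> * transverse_hessian n \<alpha> (unit_vector d) u) (at (?e d))" by (rule DERIV_cmult)
  moreover have "eventually (\<lambda>s. \<sigma> * hamiltonian_derivative n (real n * \<alpha>) (?e(d := s)) u = F (?e(d := s)))
      (nhds (?e d))"
  proof -
    obtain r where "r > 0" and r: "\<forall>x. coord_dist (reduced_coords n) x ?e < r \<longrightarrow> noncollision n x"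
      using eventually_noncollision[OF ngon_noncollision[OF \<open>odd n\<close>]] unfolding eventually_nbhd by blast
    have "coord_dist (reduced_coords n) (?e(d := s)) ?e \<le> \<bar>s - ?e d\<bar>" for s
    proof -
      have "coord_dist (reduced_coords n) (?e(d := s)) ?e \<le> (\<Sum>c\<in>reduced_coords n. if c = d then \<bar>s - ?e d\<bar> else 0)"
        by (intro order_trans[OF coord_dist_le_sum] sum_mono) auto
      also have "\<dots> \<le> \<bar>s - ?e d\<bar>" by (simp add: sum.delta)
      finally show ?thesis .
    qed
    then have "noncollision n (?e(d := s))" if "dist s (?e d) < r" for s
      using r le_less_trans[OF _ that] unfolding dist_real_def by blast
    then show ?thesis
      unfolding eventually_nhds_metric using \<open>r > 0\<close> F by (intro exI[of _ r]) simp
  qed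
  ultimately have "((\<lambda>s. F (?e(d := s))) has_real_derivative \<sigma> * transverse_hessian n \<alpha> (unit_vector d) u)
      (at (?e d))"
    by (subst (asm) DERIV_cong_ev[OF refl _ refl])
  then show ?thesis unfolding partial_def by (rule DERIV_imp_deriv)
qed

lemma linearization_hamiltonian_derivative:
  assumes "odd n" and z: "\<And>k. z (QU k) = 0" "\<And>k. z (PV k) = 0"
    and F: "\<And>x. noncollision n x \<Longrightarrow> X x c = \<sigma> * hamiltonian_derivative n (real n * \<alpha>) x u"
  shows "linearization (reduced_coords n) X (ngon_equilibrium n) z c = \<sigma> * transverse_hessian n \<alpha> z u"
proof -
  have p: "partial (\<lambda>x. X x c) d (ngon_equilibrium n) * z d
      = \<sigma> * (z d * transverse_hessian n \<alpha> (unit_vector d) u)" for d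
  proof (cases "\<exists>k. d = QU k \<or> d = PV k")
    case False
    then show ?thesis
      using partial_hamiltonian_derivative[OF \<open>odd n\<close> _ _ F, of d] by (simp add: mult_ac)
  qed (use z in auto)
  show ?thesis
    unfolding linearization_def transverse_hessian_expansion[of n \<alpha> z u] sum_distrib_left
    by (intro sum.cong refl p)
qed

text \<open>
  The direction in which all bodies leave the equator to the same side, with their momenta.
\<close>

definition transverse_mode :: "real \<Rightarrow> coord \<Rightarrow> real" where
  "transverse_mode \<nu> c = (case c of QTheta i \<Rightarrow> 1 | PTheta i \<Rightarrow> \<nu> | _ \<Rightarrow> 0)"

text \<open>
  Along the mode of common displacement each pair contributes \<open>1 - cos \<psi>\<close> times its weight, and the
  sum over the pairs is the same for every body.
\<close>

lemma transverse_hessian_mode: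
  assumes n: "n = 2 * p + 1"
  defines "S \<equiv> 2 * (\<Sum>j=1..p. transverse_weight (polygon_angle n (int j)))"
  shows "transverse_hessian n \<alpha> (\<lambda>d. a * transverse_mode \<nu> d) u
    = a * ((\<alpha>\<^sup>2 - S) * (\<Sum>i=1..n. u (QTheta i)) + \<nu> * (\<Sum>i=1..n. u (PTheta i)))"
proof -
  have "(\<Sum>j=1..n. \<Sum>i=1..<j. let \<psi> = polygon_angle n (int i - int j) in
         1 / \<bar>sin \<psi>\<bar> ^ 3 * ((a - a * cos \<psi>) * u (QTheta i) + (a - a * cos \<psi>) * u (QTheta j)))
      = a * (\<Sum>j=1..n. \<Sum>i=1..<j. transverse_weight (polygon_angle n (int i - int j)) * (u (QTheta i) + u (QTheta j)))"
    unfolding sum_distrib_left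
    by (intro sum.cong refl) (simp add: transverse_weight_def Let_def add_divide_distrib diff_divide_distrib algebra_simps)
  also have "\<dots> = a * (S * (\<Sum>i=1..n. u (QTheta i)))"
    unfolding S_def sum_transverse_weight[OF n, of "\<lambda>i. u (QTheta i)"] ..
  finally have pairs: "(\<Sum>j=1..n. \<Sum>i=1..<j. let \<psi> = polygon_angle n (int i - int j) in
         1 / \<bar>sin \<psi>\<bar> ^ 3 * ((a - a * cos \<psi>) * u (QTheta i) + (a - a * cos \<psi>) * u (QTheta j)))
      = a * (S * (\<Sum>i=1..n. u (QTheta i)))" .
  have "transverse_hessian n \<alpha> (\<lambda>d. a * transverse_mode \<nu> d) u
      = \<alpha>\<^sup>2 * a * (\<Sum>i=1..n. u (QTheta i)) + a * \<nu> * (\<Sum>i=1..n. u (PTheta i)) - a * (S * (\<Sum>i=1..n. u (QTheta i)))"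
    unfolding transverse_hessian_def transverse_mode_def coord.case mult_1_right pairs sum_distrib_left ..
  then show ?thesis by (simp only: left_diff_distrib distrib_left right_diff_distrib mult.left_commute mult.assoc)
qed

text \<open>
  The equations along this mode are \<open>\<theta>' = p\<close> and \<open>p' = (S - \<alpha>\<^sup>2) \<theta>\<close>, so it is an eigenvector of the
  linearization with the eigenvalue \<open>\<nu> = sqrt (S - \<alpha>\<^sup>2)\<close>.
\<close>

theorem ngon_linearly_unstable:
  assumes n: "n = 2 * p + 1"
    and unst: "\<alpha>\<^sup>2 < 2 * (\<Sum>j=1..p. transverse_weight (polygon_angle n (int j)))"
  shows "linearly_unstable (reduced_coords n) (reduced_phase_space n)
    (hamiltonian_field (reduced_hamiltonian n (real n * \<alpha>))) (ngon_equilibrium n)"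
proof -
  have "odd n" using n by simp
  let ?I = "reduced_coords n" and ?e = "ngon_equilibrium n"
  let ?X = "hamiltonian_field (reduced_hamiltonian n (real n * \<alpha>))"
  let ?L = "linearization ?I ?X ?e"
  define S where "S = 2 * (\<Sum>j=1..p. transverse_weight (polygon_angle n (int j)))"
  define \<nu> where "\<nu> = sqrt (S - \<alpha>\<^sup>2)"
  have \<nu>: "\<nu> > 0" "\<nu> * \<nu> = S - \<alpha>\<^sup>2" using unst by (auto simp: \<nu>_def S_def)
  have mode: "transverse_mode \<nu> (QU k) = 0" "transverse_mode \<nu> (PV k) = 0" for k
    by (simp_all add: transverse_mode_def)
  have eigen: "?L (\<lambda>d. a * transverse_mode \<nu> d) c = \<nu> * (a * transverse_mode \<nu> c)" if c: "c \<in> ?I" for a c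
  proof -
    have L: "?L (\<lambda>d. a * transverse_mode \<nu> d) c
        = \<sigma> * (a * ((\<alpha>\<^sup>2 - S) * (\<Sum>i=1..n. u (QTheta i)) + \<nu> * (\<Sum>i=1..n. u (PTheta i))))"
      if "\<And>x. noncollision n x \<Longrightarrow> ?X x c = \<sigma> * hamiltonian_derivative n (real n * \<alpha>) x u" for \<sigma> u
      unfolding transverse_hessian_mode[OF n, folded S_def, symmetric]
      by (rule linearization_hamiltonian_derivative[OF \<open>odd n\<close>]) (simp add: mode, simp add: mode, rule that)
    show ?thesis
    proof (cases c)
      case (QU k)
      show ?thesis
        by (subst L[of 1 "unit_vector (PV k)"])
           (simp_all add: QU partial_reduced_hamiltonian unit_vector_def[abs_def] transverse_mode_def)
    next
      case (QTheta i)
      then have "i \<in> {1..n}" using c by (auto simp: reduced_coords_def)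
      then show ?thesis
        by (subst L[of 1 "unit_vector (PTheta i)"])
           (simp_all add: QTheta partial_reduced_hamiltonian unit_vector_def[abs_def] transverse_mode_def)
    next
      case (PV k)
      show ?thesis
        by (subst L[of "-1" "unit_vector (QU k)"])
           (simp_all add: PV partial_reduced_hamiltonian unit_vector_def[abs_def] transverse_mode_def)
    next
      case (PTheta i)
      then have "i \<in> {1..n}" using c by (auto simp: reduced_coords_def)
      then have "?L (\<lambda>d. a * transverse_mode \<nu> d) c = - (a * (\<alpha>\<^sup>2 - S))"
        by (subst L[of "-1" "unit_vector (QTheta i)"])
           (simp_all add: PTheta partial_reduced_hamiltonian unit_vector_def[abs_def])
      also have "\<dots> = a * (\<nu> * \<nu>)" unfolding \<nu>(2) by (simp add: algebra_simps)
      finally show ?thesis by (simp add: PTheta transverse_mode_def)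
    qed
  qed
  have "\<not> lyapunov_stable ?I UNIV ?L (\<lambda>_. 0)"
  proof
    assume "lyapunov_stable ?I UNIV ?L (\<lambda>_. 0)"
    then have "\<forall>\<epsilon>>0. \<exists>\<delta>>0. \<forall>a\<in>UNIV. coord_dist ?I a (\<lambda>_. 0) < \<delta> \<longrightarrow>
        (\<exists>x. solution_on ?I UNIV ?L {0..} x \<and> (\<forall>c\<in>?I. x 0 c = a c)) \<and>
        (\<forall>T x. solution_on ?I UNIV ?L {0..T} x \<and> (\<forall>c\<in>?I. x 0 c = a c) \<longrightarrow>
           (\<forall>t\<in>{0..T}. coord_dist ?I (x t) (\<lambda>_. 0) < \<epsilon>))"
      unfolding lyapunov_stable_def by (rule conjunct2)
    from this[rule_format, OF zero_less_one] obtain \<delta> where "\<delta> > 0"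
      and \<delta>: "\<forall>a\<in>UNIV. coord_dist ?I a (\<lambda>_. 0) < \<delta> \<longrightarrow>
        (\<exists>x. solution_on ?I UNIV ?L {0..} x \<and> (\<forall>c\<in>?I. x 0 c = a c)) \<and>
        (\<forall>T x. solution_on ?I UNIV ?L {0..T} x \<and> (\<forall>c\<in>?I. x 0 c = a c) \<longrightarrow>
           (\<forall>t\<in>{0..T}. coord_dist ?I (x t) (\<lambda>_. 0) < 1))"
      by (elim exE conjE) (rule that)
    \<comment> \<open>Initial values of size \<open>\<delta> / 2\<close> in the sum norm, followed until each displacement reaches \<open>1\<close>.\<close>
    define r where "r = \<delta> / (2 * (real n * (1 + \<nu>)))"
    have "real n > 0" using n by simp
    then have "r > 0" using \<open>\<delta> > 0\<close> \<nu>(1) by (simp add: r_def)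
    define T where "T = 1 / (r * \<nu>)"
    have "T > 0" using \<open>r > 0\<close> \<nu> by (simp add: T_def)
    define x where "x t c = r * exp (\<nu> * t) * transverse_mode \<nu> c" for t c
    have "coord_dist ?I (x 0) (\<lambda>_. 0) \<le> (\<Sum>c\<in>?I. \<bar>x 0 c - 0\<bar>)" by (rule coord_dist_le_sum)
    also have "\<dots> = real n * r * (1 + \<nu>)"
      using \<open>r > 0\<close> \<nu> by (simp add: sum_reduced_coords x_def transverse_mode_def algebra_simps)
    also have "\<dots> = (real n * (1 + \<nu>)) * r" by simp
    also have "\<dots> = \<delta> / 2"
    proof -
      have "k * (\<delta> / (2 * k)) = \<delta> / 2" if "k > 0" for k :: real using that by simp
      moreover have "real n * (1 + \<nu>) > 0" using \<nu>(1) \<open>real n > 0\<close> by simp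
      ultimately show ?thesis unfolding r_def by blast
    qed
    also have "\<dots> < \<delta>" using \<open>\<delta> > 0\<close> by simp
    finally have small: "coord_dist ?I (x 0) (\<lambda>_. 0) < \<delta>" .
    have "solution_on ?I UNIV ?L {0..T} x"
      unfolding solution_on_def
    proof (intro ballI conjI)
      fix t c assume "c \<in> ?I"
      then have "?L (x t) c = \<nu> * x t c" using eigen[of c "r * exp (\<nu> * t)"] by (simp add: x_def[abs_def])
      then show "((\<lambda>s. x s c) has_real_derivative ?L (x t) c) (at t within {0..T})"
        unfolding x_def by (auto intro!: derivative_eq_intros)
    qed simp
    moreover have "\<forall>T z. solution_on ?I UNIV ?L {0..T} z \<and> (\<forall>c\<in>?I. z 0 c = x 0 c) \<longrightarrow>
           (\<forall>t\<in>{0..T}. coord_dist ?I (z t) (\<lambda>_. 0) < 1)"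
      using bspec[OF \<delta> UNIV_I[of "x 0"]] small by (elim impE conjE)
    ultimately have "\<forall>t\<in>{0..T}. coord_dist ?I (x t) (\<lambda>_. 0) < 1" by simp
    then have "coord_dist ?I (x T) (\<lambda>_. 0) < 1" using \<open>T > 0\<close> by simp
    moreover have "\<bar>x T (QTheta 1) - 0\<bar> \<le> coord_dist ?I (x T) (\<lambda>_. 0)"
      using n by (intro coord_le_coord_dist finite_reduced_coords) (auto simp: reduced_coords_def)
    moreover have "1 \<le> x T (QTheta 1)"
    proof -
      have T: "\<nu> * T = 1 / r" using \<nu>(1) by (simp add: T_def)
      have "1 + 1 / r \<le> exp (\<nu> * T)" unfolding T by (rule exp_ge_add_one_self)
      then have "1 / r \<le> exp (\<nu> * T)" by linarith
      then have "1 \<le> r * exp (\<nu> * T)" using \<open>r > 0\<close> by (simp add: divide_le_eq mult.commute)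
      then show ?thesis by (simp add: x_def transverse_mode_def)
    qed
    ultimately show False by linarith
  qed
  moreover have "is_equilibrium ?I UNIV ?L (\<lambda>_. 0)"
    by (simp add: is_equilibrium_def linearization_def)
  moreover have "is_equilibrium ?I (reduced_phase_space n) ?X ?e"
    unfolding is_equilibrium_def
    using eventually_nbhd_self[OF ngon_eventually_phase_space[OF \<open>odd n\<close>]]
    by (simp add: ngon_field[OF \<open>odd n\<close>])
  ultimately show ?thesis unfolding linearly_unstable_def unstable_def by (intro conjI)
qed

theorem theorem7:
  fixes p n :: nat and \<alpha> :: real
  assumes "p \<ge> 1" and "n = 2 * p + 1"
  shows "(\<alpha>\<^sup>2 < 2 * (\<Sum>j=1..p. (1 - cos (real j * (2 * pi / real n))) / (sin (real j * (2 * pi / real n))) ^ 3) \<longrightarrow>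
           linearly_unstable (reduced_coords n) (reduced_phase_space n)
             (hamiltonian_field (reduced_hamiltonian n (real n * \<alpha>))) (ngon_equilibrium n)) \<and>
         (\<alpha>\<^sup>2 > 2 * (\<Sum>j=1..p. (1 - cos (real j * (2 * pi / real n))) / (sin (real j * (2 * pi / real n))) ^ 3) \<longrightarrow>
           lyapunov_stable (reduced_coords n) (reduced_phase_space n)
             (hamiltonian_field (reduced_hamiltonian n (real n * \<alpha>))) (ngon_equilibrium n))"
proof -
  have "(1 - cos (real j * (2 * pi / real n))) / (sin (real j * (2 * pi / real n))) ^ 3
      = transverse_weight (polygon_angle n (int j))" if "j \<in> {1..p}" for j
  proof -
    have angle: "real j * (2 * pi / real n) = polygon_angle n (int j)" by (simp add: polygon_angle_def)
    have "0 \<le> sin (polygon_angle n (int j))"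
    proof (rule sin_ge_zero)
      show "0 \<le> polygon_angle n (int j)" by (simp add: polygon_angle_def)
      have "2 * real j \<le> real n" using that assms(2) by simp
      then have "pi * (2 * real j) \<le> pi * real n" by (intro mult_left_mono) auto
      moreover have "real n > 0" using assms(2) by simp
      ultimately show "polygon_angle n (int j) \<le> pi" by (simp add: polygon_angle_def divide_le_eq mult_ac)
    qed
    then show ?thesis unfolding angle by (simp add: transverse_weight_def)
  qed
  then have threshold: "(\<Sum>j=1..p. (1 - cos (real j * (2 * pi / real n))) / (sin (real j * (2 * pi / real n))) ^ 3)
      = (\<Sum>j=1..p. transverse_weight (polygon_angle n (int j)))"
    by (intro sum.cong refl)
  show ?thesis
    unfolding threshold using ngon_linearly_unstable[OF assms(2)] ngon_lyapunov_stable[OF assms(2)] by blast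
qed

end
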